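(* Let $S,T$ be any stopping times with $S\le T$ (possibly unbounded or infinite), and let $\{X_n\}_{n\in\mathbb{N}}$ be a uniformly integrable $\mathcal{SL}$-martingale. Defining $X_\infty=\lim_{n\to\infty}X_n$ (quasi-sure limit), we have $X_S=\mathcal{E}_S(X_T)$ quasi-surely.
   Context: Let $(\Omega,\mathcal{F})$ be a measurable space with a discrete-time filtration $\{\mathcal{F}_t\}_{t\in\mathbb{N}}$, $\mathbb{N}=\{0,1,2,\dots\}$, such that $\mathcal{F}=\mathcal{F}_\infty=\sigma(\bigcup_t\mathcal{F}_t)$ and $\mathcal{F}_0$ is trivial. $m\mathcal{F}_t$ denotes the $\mathcal{F}_t$-measurable $\mathbb{R}\cup\{\pm\infty\}$-valued functions. $\mathcal{H}$ is a linear space of $\mathcal{F}$-measurable $\mathbb{R}$-valued functions on $\Omega$ containing the constants, such that $X\in\mathcal{H}$ implies $|X|\in\mathcal{H}$ and $I_AX\in\mathcal{H}$ for all $A\in\mathcal{F}$; $\mathcal{H}_t:=\mathcal{H}\cap m\mathcal{F}_t$. $\mathcal{E}$ is an $\mathcal{SL}$-expectation: a family of maps $\mathcal{E}_t:\mathcal{H}\to\mathcal{H}_t$ such that for all $X,Y\in\mathcal{H}$, $s\le t$: (i) $X\ge Y$ implies $\mathcal{E}_t(X)\ge\mathcal{E}_t(Y)$; (ii) $\mathcal{E}_s(Y)=\mathcal{E}_s(\mathcal{E}_t(Y))$; (iii) $\mathcal{E}_t(I_AY)=I_A\mathcal{E}_t(Y)$ for $A\in\mathcal{F}_t$; (iv)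 $\mathcal{E}_t(Y)=Y$ for $Y\in\mathcal{H}_t$; (v) $\mathcal{E}_t(X+Y)\le\mathcal{E}_t(X)+\mathcal{E}_t(Y)$; (vi) $\mathcal{E}_t(\lambda Y)=\lambda^+\mathcal{E}_t(Y)+\lambda^-\mathcal{E}_t(-Y)$ for $\lambda\in\mathcal{H}_t$ with $\lambda Y\in\mathcal{H}$; (vii) if $X_i\in\mathcal{H}$ and $X_i(\omega)\downarrow0$ for every $\omega$, then $\mathcal{E}_0(X_i)\to0$. Write $\mathcal{E}=\mathcal{E}_0$ (real-valued). Such $\mathcal{E}$ has a representation $\mathcal{E}(Y)=\sup_{\theta\in\Theta}E_\theta[Y]$ for a collection $\Theta$ of ($\sigma$-additive) probability measures. A statement holds quasi-surely (q.s.) if it holds outside a set $N$ with $\mathcal{E}(I_N)=0$. $L^1$ is the completion of $\{X\in\mathcal{H}:\mathcal{E}(|X|)<\infty\}$ under $\|X\|_1=\mathcal{E}(|X|)$, modulo equality in $\|\cdot\|_1$; its elements are regarded as $\mathcal{F}$-measurable functions (up to q.s. equality), and each $\mathcal{E}_t$ extends to $L^1$ by $\mathcal{E}_t(X)=\lim\mathcal{E}_t(X_n)$ (limit in $L^1$) for $X_n\to X$ in $L^1$. A set $K\subset L^1$ is uniformly integrable if $\mathcal{E}(I_{\{|X|\ge c\}}|X|)\to0$ uniformly in $X\in K$ as $c\to\infty$. An $\mathcal{SL}$-martingale is a process $X$ with $X_t\in L^1\cap m\mathcal{F}_t$ for all $t$ and $X_s=\mathcal{E}_s(X_t)$ for all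 $s\le t$ (relations in $L^1$ are understood q.s.). For a stopping time $S$, $\mathcal{E}_S(\cdot)(\omega):=\mathcal{E}_{S(\omega)}(\cdot)(\omega)$, with $\mathcal{E}_\infty(X)=X$. *)

theory Defs
  imports "HOL-Analysis.Analysis" "HOL-Probability.Stopping_Time" "HOL-Library.Extended_Nat"
begin

text \<open>
  The measurable space \<open>(\<Omega>, \<F>)\<close> is given by \<open>space M\<close> and \<open>sets M\<close>; the measure carried by \<open>M\<close>
  plays no role. Functions on \<open>\<Omega>\<close> are total functions on the ambient type, and all pointwise
  relations between them are required on \<open>space M\<close> only.
\<close>

locale discrete_filtered_space = filtration "space M" F
  for M :: "'a measure" and F :: "nat \<Rightarrow> 'a measure" +
  assumes space_nonempty: "space M \<noteq> {}"
    and sets_F_infinity: "sets M = sigma_sets (space M) (\<Union>t. sets (F t))"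
    and F_0_trivial: "sets (F 0) = {{}, space M}"

locale SL_function_space = discrete_filtered_space M F
  for M :: "'a measure" and F :: "nat \<Rightarrow> 'a measure" +
  fixes H :: "('a \<Rightarrow> real) set"
  assumes H_measurable: "H \<subseteq> borel_measurable M"
    and H_const: "(\<lambda>_. c) \<in> H"
    and H_add: "X \<in> H \<Longrightarrow> Y \<in> H \<Longrightarrow> (\<lambda>\<omega>. X \<omega> + Y \<omega>) \<in> H"
    and H_scale: "X \<in> H \<Longrightarrow> (\<lambda>\<omega>. c * X \<omega>) \<in> H"
    and H_abs: "X \<in> H \<Longrightarrow> (\<lambda>\<omega>. \<bar>X \<omega>\<bar>) \<in> H"
    and H_indicator: "X \<in> H \<Longrightarrow> A \<in> sets M \<Longrightarrow> (\<lambda>\<omega>. indicator A \<omega> * X \<omega>) \<in> H"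

text \<open>
  The real-valued \<open>\<E> = \<E>\<^sub>0\<close>. As \<open>\<F>\<^sub>0\<close> is trivial, \<open>E 0 X\<close> is constant on \<open>space M\<close> for \<open>X \<in> H\<close>,
  so the choice of the evaluation point is immaterial.
\<close>

definition SL_mean :: "'a measure \<Rightarrow> (nat \<Rightarrow> ('a \<Rightarrow> real) \<Rightarrow> 'a \<Rightarrow> real) \<Rightarrow> ('a \<Rightarrow> real) \<Rightarrow> real" where
  "SL_mean M E X = E 0 X (SOME \<omega>. \<omega> \<in> space M)"

locale SL_expectation = SL_function_space M F H
  for M :: "'a measure" and F :: "nat \<Rightarrow> 'a measure" and H :: "('a \<Rightarrow> real) set" +
  fixes E :: "nat \<Rightarrow> ('a \<Rightarrow> real) \<Rightarrow> 'a \<Rightarrow> real"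
  assumes E_range: "X \<in> H \<Longrightarrow> E t X \<in> H \<inter> borel_measurable (F t)"
    and E_mono: "X \<in> H \<Longrightarrow> Y \<in> H \<Longrightarrow> (\<And>\<omega>. \<omega> \<in> space M \<Longrightarrow> Y \<omega> \<le> X \<omega>) \<Longrightarrow>
      \<omega> \<in> space M \<Longrightarrow> E t Y \<omega> \<le> E t X \<omega>"
    and E_tower: "Y \<in> H \<Longrightarrow> s \<le> t \<Longrightarrow> \<omega> \<in> space M \<Longrightarrow> E s Y \<omega> = E s (E t Y) \<omega>"
    and E_indicator: "Y \<in> H \<Longrightarrow> A \<in> sets (F t) \<Longrightarrow> \<omega> \<in> space M \<Longrightarrow>
      E t (\<lambda>\<omega>. indicator A \<omega> * Y \<omega>) \<omega> = indicator A \<omega> * E t Y \<omega>"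
    and E_measurable: "Y \<in> H \<inter> borel_measurable (F t) \<Longrightarrow> \<omega> \<in> space M \<Longrightarrow> E t Y \<omega> = Y \<omega>"
    and E_subadditive: "X \<in> H \<Longrightarrow> Y \<in> H \<Longrightarrow> \<omega> \<in> space M \<Longrightarrow>
      E t (\<lambda>\<omega>. X \<omega> + Y \<omega>) \<omega> \<le> E t X \<omega> + E t Y \<omega>"
    and E_homogeneous: "Y \<in> H \<Longrightarrow> l \<in> H \<inter> borel_measurable (F t) \<Longrightarrow> (\<lambda>\<omega>. l \<omega> * Y \<omega>) \<in> H \<Longrightarrow>
      \<omega> \<in> space M \<Longrightarrow>
      E t (\<lambda>\<omega>. l \<omega> * Y \<omega>) \<omega> =
        max (l \<omega>) 0 * E t Y \<omega> + max (- l \<omega>) 0 * E t (\<lambda>\<omega>. - Y \<omega>) \<omega>"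
    and E_continuous: "(\<And>i. Z i \<in> H) \<Longrightarrow> (\<And>\<omega>. \<omega> \<in> space M \<Longrightarrow> decseq (\<lambda>i. Z i \<omega>)) \<Longrightarrow>
      (\<And>\<omega>. \<omega> \<in> space M \<Longrightarrow> (\<lambda>i. Z i \<omega>) \<longlonglongrightarrow> 0) \<Longrightarrow>
      (\<lambda>i. SL_mean M E (Z i)) \<longlonglongrightarrow> 0"

definition quasi_surely ::
  "'a measure \<Rightarrow> (nat \<Rightarrow> ('a \<Rightarrow> real) \<Rightarrow> 'a \<Rightarrow> real) \<Rightarrow> ('a \<Rightarrow> bool) \<Rightarrow> bool" where
  "quasi_surely M E P \<longleftrightarrow>
    (\<exists>N\<in>sets M. SL_mean M E (indicator N) = 0 \<and> (\<forall>\<omega>\<in>space M - N. P \<omega>))"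

text \<open>
  The elements of the completion are classes of sequences in \<open>H\<close> that are Cauchy for
  \<open>\<parallel>X\<parallel> = \<E>(\<bar>X\<bar>)\<close>; the condition \<open>\<E>(\<bar>X\<bar>) < \<infinity>\<close> is automatic because \<open>\<E>\<close> is real-valued on \<open>H\<close>.
  Such a class is regarded as a measurable function as usual: a Cauchy sequence has a
  quasi-surely convergent subsequence, and its limit, which is unique up to quasi-sure equality,
  represents the class. Representatives may take the values \<open>\<plusminus>\<infinity>\<close> (on a null set).
\<close>

definition L1_Cauchy ::
  "'a measure \<Rightarrow> ('a \<Rightarrow> real) set \<Rightarrow> (nat \<Rightarrow> ('a \<Rightarrow> real) \<Rightarrow> 'a \<Rightarrow> real) \<Rightarrow> (nat \<Rightarrow> 'a \<Rightarrow> real) \<Rightarrow> bool"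
where
  "L1_Cauchy M H E Xs \<longleftrightarrow> (\<forall>n. Xs n \<in> H) \<and>
    (\<forall>e>0. \<exists>N. \<forall>m\<ge>N. \<forall>n\<ge>N. SL_mean M E (\<lambda>\<omega>. \<bar>Xs m \<omega> - Xs n \<omega>\<bar>) < e)"

definition L1_represents ::
  "'a measure \<Rightarrow> ('a \<Rightarrow> real) set \<Rightarrow> (nat \<Rightarrow> ('a \<Rightarrow> real) \<Rightarrow> 'a \<Rightarrow> real) \<Rightarrow> (nat \<Rightarrow> 'a \<Rightarrow> real) \<Rightarrow>
    ('a \<Rightarrow> ereal) \<Rightarrow> bool"
where
  "L1_represents M H E Xs X \<longleftrightarrow> L1_Cauchy M H E Xs \<and> X \<in> borel_measurable M \<and>
    (\<exists>r. strict_mono r \<and> quasi_surely M E (\<lambda>\<omega>. (\<lambda>n. ereal (Xs (r n) \<omega>)) \<longlonglongrightarrow> X \<omega>))"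

definition L1_space ::
  "'a measure \<Rightarrow> ('a \<Rightarrow> real) set \<Rightarrow> (nat \<Rightarrow> ('a \<Rightarrow> real) \<Rightarrow> 'a \<Rightarrow> real) \<Rightarrow> ('a \<Rightarrow> ereal) set" where
  "L1_space M H E = {X. \<exists>Xs. L1_represents M H E Xs X}"

text \<open>
  The extension of \<open>\<E>\<^sub>t\<close> to \<open>L\<^sup>1\<close> maps the class of \<open>(X\<^sub>n)\<close> to the class of \<open>(\<E>\<^sub>t(X\<^sub>n))\<close>. It is
  determined up to quasi-sure equality, and an \<open>\<F>\<^sub>t\<close>-measurable version is chosen; for \<open>t = 0\<close>
  this version is a constant, namely the value of \<open>\<E>\<close> on \<open>L\<^sup>1\<close>.
\<close>

definition L1_expect ::
  "'a measure \<Rightarrow> (nat \<Rightarrow> 'a measure) \<Rightarrow> ('a \<Rightarrow> real) set \<Rightarrow> (nat \<Rightarrow> ('a \<Rightarrow> real) \<Rightarrow> 'a \<Rightarrow> real) \<Rightarrow>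
    nat \<Rightarrow> ('a \<Rightarrow> ereal) \<Rightarrow> 'a \<Rightarrow> ereal"
where
  "L1_expect M F H E t X = (SOME Y. Y \<in> borel_measurable (F t) \<and>
    (\<exists>Xs. L1_represents M H E Xs X \<and> L1_represents M H E (\<lambda>n. E t (Xs n)) Y))"

definition L1_mean ::
  "'a measure \<Rightarrow> (nat \<Rightarrow> 'a measure) \<Rightarrow> ('a \<Rightarrow> real) set \<Rightarrow> (nat \<Rightarrow> ('a \<Rightarrow> real) \<Rightarrow> 'a \<Rightarrow> real) \<Rightarrow>
    ('a \<Rightarrow> ereal) \<Rightarrow> real"
where
  "L1_mean M F H E X = real_of_ereal (L1_expect M F H E 0 X (SOME \<omega>. \<omega> \<in> space M))"

definition SL_uniformly_integrable ::
  "'a measure \<Rightarrow> (nat \<Rightarrow> 'a measure) \<Rightarrow> ('a \<Rightarrow> real) set \<Rightarrow> (nat \<Rightarrow> ('a \<Rightarrow> real) \<Rightarrow> 'a \<Rightarrow> real) \<Rightarrow>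
    ('a \<Rightarrow> ereal) set \<Rightarrow> bool"
where
  "SL_uniformly_integrable M F H E K \<longleftrightarrow> K \<subseteq> L1_space M H E \<and>
    uniform_limit K
      (\<lambda>(c::real) X. L1_mean M F H E
        (\<lambda>\<omega>. indicator {\<omega>\<in>space M. \<bar>X \<omega>\<bar> \<ge> ereal c} \<omega> * \<bar>X \<omega>\<bar>))
      (\<lambda>_. 0) at_top"

definition SL_martingale ::
  "'a measure \<Rightarrow> (nat \<Rightarrow> 'a measure) \<Rightarrow> ('a \<Rightarrow> real) set \<Rightarrow> (nat \<Rightarrow> ('a \<Rightarrow> real) \<Rightarrow> 'a \<Rightarrow> real) \<Rightarrow>
    (nat \<Rightarrow> 'a \<Rightarrow> ereal) \<Rightarrow> bool"
where
  "SL_martingale M F H E X \<longleftrightarrow>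
    (\<forall>t. X t \<in> L1_space M H E \<inter> borel_measurable (F t)) \<and>
    (\<forall>s t. s \<le> t \<longrightarrow> quasi_surely M E (\<lambda>\<omega>. X s \<omega> = L1_expect M F H E s (X t) \<omega>))"

definition qs_limit ::
  "'a measure \<Rightarrow> (nat \<Rightarrow> ('a \<Rightarrow> real) \<Rightarrow> 'a \<Rightarrow> real) \<Rightarrow> (nat \<Rightarrow> 'a \<Rightarrow> ereal) \<Rightarrow> ('a \<Rightarrow> ereal) \<Rightarrow> bool"
where
  "qs_limit M E X Xinf \<longleftrightarrow> Xinf \<in> borel_measurable M \<and>
    quasi_surely M E (\<lambda>\<omega>. (\<lambda>n. X n \<omega>) \<longlonglongrightarrow> Xinf \<omega>)"

text \<open>
  The filtration indexed by \<open>{0, 1, 2, \<dots>, \<infinity>}\<close> with \<open>\<F>\<^sub>\<infinity> = \<F>\<close>. Stopping times with values in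
  \<open>enat\<close> are stopping times of this filtration; the condition at \<open>\<infinity>\<close> is void.
\<close>

definition F_enat :: "'a measure \<Rightarrow> (nat \<Rightarrow> 'a measure) \<Rightarrow> enat \<Rightarrow> 'a measure" where
  "F_enat M F t = (case t of enat n \<Rightarrow> F n | \<infinity> \<Rightarrow> M)"

definition process_at :: "(nat \<Rightarrow> 'a \<Rightarrow> ereal) \<Rightarrow> ('a \<Rightarrow> ereal) \<Rightarrow> ('a \<Rightarrow> enat) \<Rightarrow> 'a \<Rightarrow> ereal" where
  "process_at X Xinf T \<omega> = (case T \<omega> of enat n \<Rightarrow> X n \<omega> | \<infinity> \<Rightarrow> Xinf \<omega>)"

definition L1_expect_at ::
  "'a measure \<Rightarrow> (nat \<Rightarrow> 'a measure) \<Rightarrow> ('a \<Rightarrow> real) set \<Rightarrow> (nat \<Rightarrow> ('a \<Rightarrow> real) \<Rightarrow> 'a \<Rightarrow> real) \<Rightarrow>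
    ('a \<Rightarrow> enat) \<Rightarrow> ('a \<Rightarrow> ereal) \<Rightarrow> 'a \<Rightarrow> ereal"
where
  "L1_expect_at M F H E S X \<omega> = (case S \<omega> of enat t \<Rightarrow> L1_expect M F H E t X \<omega> | \<infinity> \<Rightarrow> X \<omega>)"

end

theory Submission
  imports Defs
begin

text \<open>
  Doob's upcrossing inequality survives for sublinear expectations, because it only uses that the gain of a \<open>{0, 1}\<close>-valued predictable strategy is again an
  \<open>SL\<close>-martingale; this gives quasi-sure convergence. Uniform integrability upgrades it to
  \<open>L\<^sup>1\<close>-convergence, so that \<open>X\<^sub>t = E\<^sub>t(X\<^sub>\<infinity>)\<close>. The stopped process \<open>X\<^sub>T\<^sub>\<and>\<^sub>n\<close> is an \<open>SL\<close>-martingale by locality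
  of \<open>E\<^sub>n\<close>. It is uniformly integrable: with \<open>\<phi>(x) = (\<bar>x\<bar> - c)\<^sup>+\<close>, Jensen's inequality bounds \<open>\<phi>(X\<^sub>T\<^sub>\<and>\<^sub>n)\<close> by the
  martingale \<open>E\<^sub>t(\<phi>(X\<^sub>n))\<close> stopped at \<open>T \<and> n\<close>, whose mean is \<open>E(\<phi>(X\<^sub>n))\<close>. Since it converges to \<open>X\<^sub>T\<close>, the
  closure result applied to the stopped process yields \<open>E\<^sub>t(X\<^sub>T) = X\<^sub>T\<^sub>\<and>\<^sub>t\<close>, which is \<open>X\<^sub>t\<close> on \<open>{S = t}\<close>.
\<close>

section \<open>The upper expectation\<close>

text \<open>A sublinear \<open>E t\<close> is additive only up to summands known at time t, and the
  negative of a martingale need not be one. Every classical step is therefore arranged around a few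
  operations: one-sided comparison of positive parts, translation by an
  \<open>F t\<close>-measurable function, pasting along a set of \<open>F t\<close>, and the tower
  property. A short position would bring in E_t(-X), which these do not control. Limits are the
  second obstacle: the axioms give continuity only along sequences of \<open>H\<close> that decrease
  to 0 at every point. From this, continuity from below is derived for an inner extension to
  [0, \<infinity>]-valued functions, which gives Fatou's lemma, while dominated convergence is
  recovered for dominating functions in the closure of \<open>H\<close>. The excess (|x| - c)^+ is
  the test function for uniform integrability because it is built from absolute value, translation
  and positive part, all of which \<open>E t\<close> respects. Classes of Cauchy sequences, chosen
  versions and extended values enter only at the end; until then all processes are
  real-valued.\<close>

context SL_function_space
begin

lemma sets_F_subset: "sets (F t) \<subseteq> sets M"
  using sets_F_infinity by (auto intro: sigma_sets.Basic)

lemma measurable_F_M: "f \<in> borel_measurable (F t) \<Longrightarrow> f \<in> borel_measurable M"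
  by (rule measurable_mono[THEN subsetD, of borel borel "F t" M]) (auto simp: space_F sets_F_subset)

lemma measurable_F_mono: "s \<le> t \<Longrightarrow> f \<in> borel_measurable (F s) \<Longrightarrow> f \<in> borel_measurable (F t)"
  by (rule measurable_mono[THEN subsetD, of borel borel "F s" "F t"]) (auto simp: space_F sets_F_mono[THEN subsetD])

lemma H_measurableD [measurable_dest]: "X \<in> H \<Longrightarrow> X \<in> borel_measurable M"
  using H_measurable by auto

lemma H_uminus: "X \<in> H \<Longrightarrow> (\<lambda>\<omega>. - X \<omega>) \<in> H"
  using H_scale[of X "-1"] by simp

lemma H_diff: "X \<in> H \<Longrightarrow> Y \<in> H \<Longrightarrow> (\<lambda>\<omega>. X \<omega> - Y \<omega>) \<in> H"
  using H_add[OF _ H_uminus, of X Y] by simp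

lemma H_pos_part:
  assumes "X \<in> H" shows "(\<lambda>\<omega>. max (X \<omega>) 0) \<in> H"
proof -
  have "(\<lambda>\<omega>. max (X \<omega>) 0) = (\<lambda>\<omega>. (1/2) * (\<bar>X \<omega>\<bar> + X \<omega>))"
    by (auto simp: fun_eq_iff max_def)
  then show ?thesis
    using H_scale[OF H_add[OF H_abs[OF assms] assms], of "1/2"] by simp
qed

lemma H_indicator_const: "A \<in> sets M \<Longrightarrow> (\<lambda>\<omega>. indicator A \<omega> * c) \<in> H"
  by (rule H_indicator[OF H_const])

lemma H_indicator_set: "A \<in> sets M \<Longrightarrow> indicator A \<in> H"
  using H_indicator_const[of A 1] by simp

lemma H_sum: "finite I \<Longrightarrow> (\<And>i. i \<in> I \<Longrightarrow> X i \<in> H) \<Longrightarrow> (\<lambda>\<omega>. \<Sum>i\<in>I. X i \<omega>) \<in> H"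
  by (induction I rule: finite_induct) (auto intro: H_add H_const)

text \<open>Membership in \<open>H\<close> may depend on values outside \<open>space M\<close>, hence the representative \<open>h\<close>.\<close>

lemma simple_function_H:
  assumes f: "simple_function N (f :: 'a \<Rightarrow> real)"
    and N: "space N = space M" "sets N \<subseteq> sets M"
  shows "\<exists>h\<in>H. h \<in> borel_measurable N \<and> (\<forall>\<omega>\<in>space M. h \<omega> = f \<omega>)"
proof (intro bexI conjI ballI)
  let ?h = "\<lambda>\<omega>. \<Sum>y\<in>f ` space N. indicator (f -` {y} \<inter> space N) \<omega> * y"
  have fin: "finite (f ` space N)" and meas: "f -` {y} \<inter> space N \<in> sets N" for y
    using f by (auto simp: simple_function_def intro: simple_functionD)
  show "?h \<in> H"
    using fin meas N(2) by (intro H_sum H_indicator_const) auto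
  show "?h \<in> borel_measurable N"
    using meas by (intro borel_measurable_sum borel_measurable_times borel_measurable_indicator) auto
  fix \<omega> assume "\<omega> \<in> space M"
  have "?h \<omega> = (\<Sum>y\<in>f ` space N. if y = f \<omega> then y else 0)"
    using \<open>\<omega> \<in> space M\<close> N(1) by (intro sum.cong) (auto simp: indicator_def)
  also have "\<dots> = f \<omega>"
    using fin \<open>\<omega> \<in> space M\<close> N(1) by (simp add: sum.delta)
  finally show "?h \<omega> = f \<omega>" .
qed

text \<open>Simple functions agree on \<open>space M\<close> with members of \<open>H\<close>, so
  the usual increasing approximation can be carried out in \<open>H\<close>. The sigma-algebra
  \<open>N\<close> is left free: it is \<open>M\<close> for subadditivity of the upper expectation
  and \<open>F t\<close> for approximating \<open>F t\<close>-measurable functions.\<close>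

lemma ennreal_approx_H:
  assumes Z: "Z \<in> borel_measurable N" and N: "space N = space M" "sets N \<subseteq> sets M"
  obtains h :: "nat \<Rightarrow> 'a \<Rightarrow> real" where "\<And>n. h n \<in> H" "\<And>n. h n \<in> borel_measurable N"
    "\<And>n \<omega>. \<omega> \<in> space M \<Longrightarrow> 0 \<le> h n \<omega>"
    "\<And>\<omega>. \<omega> \<in> space M \<Longrightarrow> incseq (\<lambda>n. ennreal (h n \<omega>))"
    "\<And>\<omega>. \<omega> \<in> space M \<Longrightarrow> (SUP n. ennreal (h n \<omega>)) = Z \<omega>"
proof -
  obtain f where f: "\<And>n. simple_function N (f n)" "incseq f" "\<And>n \<omega>. f n \<omega> < top"
      "\<And>\<omega>. (SUP n. f n \<omega>) = Z \<omega>"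
    by (rule borel_measurable_implies_simple_function_sequence'[OF Z]) (auto simp: less_top)
  have "\<exists>h\<in>H. h \<in> borel_measurable N \<and> (\<forall>\<omega>\<in>space M. h \<omega> = enn2real (f n \<omega>))" for n
    using simple_function_compose1[OF f(1), of enn2real n] N by (intro simple_function_H) auto
  then obtain h where h: "\<And>n. h n \<in> H" "\<And>n. h n \<in> borel_measurable N"
      "\<And>n \<omega>. \<omega> \<in> space M \<Longrightarrow> h n \<omega> = enn2real (f n \<omega>)"
    by metis
  have eq: "ennreal (h n \<omega>) = f n \<omega>" if "\<omega> \<in> space M" for n \<omega>
    using h(3)[OF that, of n] f(3)[of n \<omega>] by simp
  show ?thesis
  proof (rule that[of h])
    show "incseq (\<lambda>n. ennreal (h n \<omega>))" if "\<omega> \<in> space M" for \<omega>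
      using f(2) by (auto simp: eq[OF that] incseq_def le_fun_def)
  qed (use h eq f(4) in auto)
qed

end

section \<open>Elementary consequences of the axioms\<close>

context SL_expectation
begin

abbreviation mean :: "('a \<Rightarrow> real) \<Rightarrow> real" where "mean \<equiv> SL_mean M E"

lemma some_space: "(SOME \<omega>. \<omega> \<in> space M) \<in> space M"
  using space_nonempty by (simp add: some_in_eq)

lemma E_const: "\<omega> \<in> space M \<Longrightarrow> E t (\<lambda>_. c) \<omega> = c"
  by (rule E_measurable) (auto intro: H_const)

lemma E_H: "X \<in> H \<Longrightarrow> E t X \<in> H" and E_F: "X \<in> H \<Longrightarrow> E t X \<in> borel_measurable (F t)"
  using E_range by auto

lemma E_nonneg: "X \<in> H \<Longrightarrow> (\<And>\<omega>. \<omega> \<in> space M \<Longrightarrow> 0 \<le> X \<omega>) \<Longrightarrow> \<omega> \<in> space M \<Longrightarrow> 0 \<le> E t X \<omega>"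
  using E_mono[of X "\<lambda>_. 0" \<omega> t] by (simp add: H_const E_const)

lemma E_diff_le:
  assumes "X \<in> H" "Y \<in> H" "\<omega> \<in> space M"
  shows "E t X \<omega> - E t Y \<omega> \<le> E t (\<lambda>\<omega>. X \<omega> - Y \<omega>) \<omega>"
  using E_subadditive[OF H_diff[OF assms(1,2)] assms(2,3), of t] by simp

text \<open>Subadditivity gives E_t(X) - E_t(Y) \<le> E_t(X - Y), and monotonicity does the rest.
  Keeping only the positive part is deliberate: this one-sided form passes to L^1 and yields
  monotonicity there.\<close>

lemma E_pos_part_le:
  assumes "X \<in> H" "Y \<in> H" "\<omega> \<in> space M"
  shows "max (E t X \<omega> - E t Y \<omega>) 0 \<le> E t (\<lambda>\<omega>. max (X \<omega> - Y \<omega>) 0) \<omega>"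
proof -
  have "E t (\<lambda>\<omega>. X \<omega> - Y \<omega>) \<omega> \<le> E t (\<lambda>\<omega>. max (X \<omega> - Y \<omega>) 0) \<omega>"
    using assms by (intro E_mono H_pos_part H_diff) auto
  moreover have "0 \<le> E t (\<lambda>\<omega>. max (X \<omega> - Y \<omega>) 0) \<omega>"
    using assms by (intro E_nonneg H_pos_part H_diff) auto
  ultimately show ?thesis
    using E_diff_le[OF assms, of t] by simp
qed

text \<open>Subadditivity is applied once to X + W and once to (X + W) + (-W), with E_t(-W) = -W.
  This exact additivity is what makes trading gains martingales.\<close>

lemma E_translate:
  assumes X: "X \<in> H" and W: "W \<in> H" "W \<in> borel_measurable (F t)" and \<omega>: "\<omega> \<in> space M"
  shows "E t (\<lambda>\<omega>. X \<omega> + W \<omega>) \<omega> = E t X \<omega> + W \<omega>"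
proof (rule antisym)
  show "E t (\<lambda>\<omega>. X \<omega> + W \<omega>) \<omega> \<le> E t X \<omega> + W \<omega>"
    using E_subadditive[OF X W(1) \<omega>, of t] E_measurable[of W t \<omega>] W \<omega> by simp
  have "E t (\<lambda>\<omega>. (X \<omega> + W \<omega>) + - W \<omega>) \<omega> \<le> E t (\<lambda>\<omega>. X \<omega> + W \<omega>) \<omega> + E t (\<lambda>\<omega>. - W \<omega>) \<omega>"
    using X W(1) \<omega> by (intro E_subadditive H_add H_uminus)
  moreover have "E t (\<lambda>\<omega>. - W \<omega>) \<omega> = - W \<omega>"
    using W \<omega> by (intro E_measurable) (auto intro: H_uminus)
  ultimately show "E t X \<omega> + W \<omega> \<le> E t (\<lambda>\<omega>. X \<omega> + W \<omega>) \<omega>"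
    by simp
qed

lemma mean_const: "mean (\<lambda>_. c) = c"
  by (simp add: SL_mean_def E_const some_space)

lemma mean_mono: "X \<in> H \<Longrightarrow> Y \<in> H \<Longrightarrow> (\<And>\<omega>. \<omega> \<in> space M \<Longrightarrow> X \<omega> \<le> Y \<omega>) \<Longrightarrow> mean X \<le> mean Y"
  unfolding SL_mean_def by (intro E_mono some_space)

lemma mean_nonneg: "X \<in> H \<Longrightarrow> (\<And>\<omega>. \<omega> \<in> space M \<Longrightarrow> 0 \<le> X \<omega>) \<Longrightarrow> 0 \<le> mean X"
  unfolding SL_mean_def by (intro E_nonneg some_space)

lemma mean_add: "X \<in> H \<Longrightarrow> Y \<in> H \<Longrightarrow> mean (\<lambda>\<omega>. X \<omega> + Y \<omega>) \<le> mean X + mean Y"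
  unfolding SL_mean_def by (intro E_subadditive some_space)

lemma mean_scale: "X \<in> H \<Longrightarrow> 0 \<le> c \<Longrightarrow> mean (\<lambda>\<omega>. c * X \<omega>) = c * mean X"
  unfolding SL_mean_def
  using E_homogeneous[of X "\<lambda>_. c" 0, OF _ _ _ some_space] by (simp add: H_const H_scale)

lemma mean_E: "X \<in> H \<Longrightarrow> mean (E t X) = mean X"
  unfolding SL_mean_def using E_tower[of X 0 t, OF _ _ some_space] by simp

lemma mean_le_add: "X \<in> H \<Longrightarrow> Y \<in> H \<Longrightarrow> Z \<in> H \<Longrightarrow> (\<And>\<omega>. \<omega> \<in> space M \<Longrightarrow> X \<omega> \<le> Y \<omega> + Z \<omega>) \<Longrightarrow> mean X \<le> mean Y + mean Z"
  using mean_mono[of X "\<lambda>\<omega>. Y \<omega> + Z \<omega>"] mean_add[of Y Z] by (simp add: H_add)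

text \<open>The only entry of the continuity axiom. The products decrease to 0 at every point
  because the sets shrink to the empty set, which is why null sets have to be removed before it is
  applied.\<close>

lemma mean_decseq_sets:
  assumes h: "h \<in> H" "\<And>\<omega>. \<omega> \<in> space M \<Longrightarrow> 0 \<le> h \<omega>"
    and A: "\<And>n. A n \<in> sets M" "decseq A" "(\<Inter>n. A n) = {}"
  shows "(\<lambda>n. mean (\<lambda>\<omega>. indicator (A n) \<omega> * h \<omega>)) \<longlonglongrightarrow> 0"
proof (rule E_continuous)
  fix \<omega> assume "\<omega> \<in> space M"
  show "decseq (\<lambda>n. indicator (A n) \<omega> * h \<omega>)"
    using h(2)[OF \<open>\<omega> \<in> space M\<close>]
    by (intro decseq_SucI mult_right_mono indicator_leI) (auto dest: subsetD[OF decseq_SucD[OF A(2)]])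
  obtain k where "\<omega> \<notin> A k" using A(3) by blast
  then have "\<forall>\<^sub>F n in sequentially. indicator (A n) \<omega> * h \<omega> = 0"
    using A(2) by (intro eventually_sequentiallyI[of k]) (auto simp: indicator_def dest: subsetD[OF decseqD])
  then show "(\<lambda>n. indicator (A n) \<omega> * h \<omega>) \<longlonglongrightarrow> 0"
    by (simp add: tendsto_eventually)
qed (use h A in \<open>auto intro: H_indicator\<close>)

text \<open>
  The upper expectation extends \<open>E 0\<close> to all nonnegative functions. It is continuous along increasing
  sequences and countably subadditive on measurable functions, which is all that is needed in place of
  the representation of \<open>E 0\<close> as a supremum of \<open>\<sigma>\<close>-additive expectations.
\<close>

definition upper :: "('a \<Rightarrow> ennreal) \<Rightarrow> ennreal" where
  "upper Z = (SUP h\<in>{h\<in>H. \<forall>\<omega>\<in>space M. 0 \<le> h \<omega> \<and> ennreal (h \<omega>) \<le> Z \<omega>}. ennreal (mean h))"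

lemma upper_geI:
  "h \<in> H \<Longrightarrow> (\<And>\<omega>. \<omega> \<in> space M \<Longrightarrow> 0 \<le> h \<omega>) \<Longrightarrow> (\<And>\<omega>. \<omega> \<in> space M \<Longrightarrow> ennreal (h \<omega>) \<le> Z \<omega>) \<Longrightarrow> ennreal (mean h) \<le> upper Z"
  unfolding upper_def by (intro SUP_upper) auto

lemma upper_leI:
  "(\<And>h. h \<in> H \<Longrightarrow> (\<And>\<omega>. \<omega> \<in> space M \<Longrightarrow> 0 \<le> h \<omega>) \<Longrightarrow> (\<And>\<omega>. \<omega> \<in> space M \<Longrightarrow> ennreal (h \<omega>) \<le> Z \<omega>) \<Longrightarrow> ennreal (mean h) \<le> u) \<Longrightarrow> upper Z \<le> u"
  unfolding upper_def by (intro SUP_least) auto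

lemma upper_mono: "(\<And>\<omega>. \<omega> \<in> space M \<Longrightarrow> Z \<omega> \<le> W \<omega>) \<Longrightarrow> upper Z \<le> upper W"
  by (rule upper_leI) (auto intro!: upper_geI intro: order_trans)

lemma upper_H:
  assumes "h \<in> H" "\<And>\<omega>. \<omega> \<in> space M \<Longrightarrow> 0 \<le> h \<omega>"
  shows "upper (\<lambda>\<omega>. ennreal (h \<omega>)) = ennreal (mean h)"
proof (rule antisym)
  show "upper (\<lambda>\<omega>. ennreal (h \<omega>)) \<le> ennreal (mean h)"
    using assms by (intro upper_leI ennreal_leI mean_mono) (auto simp: ennreal_le_iff)
qed (use assms in \<open>auto intro: upper_geI\<close>)

text \<open>Continuity from below is drawn from continuity from above. For a test function h below
  the supremum and c < 1, the sets where c h exceeds \<open>Z n\<close> decrease to the empty set,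
  so the part of h on them has vanishing mean, while c h cut down to the complement is a test
  function for \<open>Z n\<close>.\<close>

lemma upper_SUP:
  assumes Z [measurable]: "\<And>n. Z n \<in> borel_measurable M"
    and inc: "\<And>\<omega>. \<omega> \<in> space M \<Longrightarrow> incseq (\<lambda>n. Z n \<omega>)"
  shows "upper (\<lambda>\<omega>. SUP n. Z n \<omega>) = (SUP n. upper (Z n))"
proof (rule antisym)
  show "(SUP n. upper (Z n)) \<le> upper (\<lambda>\<omega>. SUP n. Z n \<omega>)"
    by (intro SUP_least upper_mono SUP_upper) auto
  show "upper (\<lambda>\<omega>. SUP n. Z n \<omega>) \<le> (SUP n. upper (Z n))" (is "_ \<le> ?S")
  proof (rule upper_leI)
    fix h assume h: "h \<in> H" and pos: "\<And>\<omega>. \<omega> \<in> space M \<Longrightarrow> 0 \<le> h \<omega>"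
      and le: "\<And>\<omega>. \<omega> \<in> space M \<Longrightarrow> ennreal (h \<omega>) \<le> (SUP n. Z n \<omega>)"
    note [measurable] = H_measurableD[OF h]
    \<comment> \<open>The factor c < 1 gives room: where h > 0, c h lies strictly below the supremum
      and is eventually reached by \<open>Z n\<close>; where h = 0 there is nothing to
      reach.\<close>
    have *: "ennreal (c * mean h) \<le> ?S" if c: "0 < c" "c < 1" for c
    proof -
      define A where "A n = {\<omega>\<in>space M. ennreal (c * h \<omega>) \<le> Z n \<omega>}" for n
      have [measurable]: "A n \<in> sets M" for n unfolding A_def by measurable
      let ?a = "\<lambda>n \<omega>. indicator (A n) \<omega> * h \<omega>" and ?b = "\<lambda>n \<omega>. indicator (space M - A n) \<omega> * h \<omega>"
      have b: "(\<lambda>n. mean (?b n)) \<longlonglongrightarrow> 0"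
      proof (rule mean_decseq_sets[OF h pos])
        show "decseq (\<lambda>n. space M - A n)"
          using inc by (auto simp: decseq_def A_def incseq_def intro: order_trans)
        show "(\<Inter>n. space M - A n) = {}"
        proof (rule equals0I)
          fix \<omega> assume \<omega>': "\<omega> \<in> (\<Inter>n. space M - A n)"
          then have \<omega>: "\<omega> \<in> space M" by blast
          have "Z n \<omega> < ennreal (c * h \<omega>)" for n using \<omega>' by (auto simp: A_def not_le)
          then have "(SUP n. Z n \<omega>) \<le> ennreal (c * h \<omega>)" by (intro SUP_least) (auto intro: less_imp_le)
          then have "ennreal (h \<omega>) \<le> ennreal (c * h \<omega>)" using le[OF \<omega>] by (rule order_trans[rotated])
          then have "h \<omega> \<le> c * h \<omega>" using pos[OF \<omega>] c by (subst (asm) ennreal_le_iff) auto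
          then have "h \<omega> = 0" using c pos[OF \<omega>] by (simp add: mult_le_cancel_right1 mult_le_cancel_right2)
          then show False using \<open>Z 0 \<omega> < ennreal (c * h \<omega>)\<close> by simp
        qed
      qed auto
      have "ennreal (c * mean h) \<le> ?S + ennreal (c * mean (?b n))" for n
      proof -
        have "mean h \<le> mean (?a n) + mean (?b n)"
          using h by (intro mean_le_add H_indicator) (auto simp: indicator_def)
        then have "ennreal (c * mean h) \<le> ennreal (c * mean (?a n) + c * mean (?b n))"
          using c by (intro ennreal_leI) (simp add: mult_left_mono flip: distrib_left)
        also have "\<dots> = ennreal (c * mean (?a n)) + ennreal (c * mean (?b n))"
          using c h pos by (intro ennreal_plus mult_nonneg_nonneg mean_nonneg H_indicator) auto
        also have "c * mean (?a n) = mean (\<lambda>\<omega>. c * ?a n \<omega>)"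
          using c h by (simp add: mean_scale H_indicator)
        also have "ennreal \<dots> \<le> upper (Z n)"
          using c h pos by (intro upper_geI H_scale H_indicator) (auto simp: A_def indicator_def)
        also have "upper (Z n) \<le> ?S" by (intro SUP_upper) auto
        finally show ?thesis by (simp add: add_right_mono)
      qed
      moreover have "(\<lambda>n. ?S + ennreal (c * mean (?b n))) \<longlonglongrightarrow> ?S + ennreal (c * 0)"
        by (intro tendsto_intros b tendsto_ennrealI tendsto_add)
      ultimately show ?thesis by (intro LIMSEQ_le_const) auto
    qed
    show "ennreal (mean h) \<le> ?S"
    proof (cases ?S rule: ennreal_cases)
      case (real s)
      have "mean h \<le> s"
      proof (rule field_le_mult_one_interval)
        fix c :: real assume "0 < c" "c < 1"
        then show "c * mean h \<le> s"
          using *[of c] unfolding real(2) by (subst (asm) ennreal_le_iff[OF real(1)])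
      qed
      then show ?thesis unfolding real(2) by (rule ennreal_leI)
    next
      case top
      show ?thesis unfolding top by (rule top_greatest)
    qed
  qed
qed

text \<open>A test function below Z + W need not split into test functions below Z and W. Increasing
  sequences of \<open>H\<close> do split: on \<open>H\<close> the inequality is an axiom, and
  \<open>upper_SUP\<close> passes to the limit.\<close>

lemma upper_add:
  assumes Z: "Z \<in> borel_measurable M" and W: "W \<in> borel_measurable M"
  shows "upper (\<lambda>\<omega>. Z \<omega> + W \<omega>) \<le> upper Z + upper W"
proof -
  obtain f where f: "\<And>n. f n \<in> H" "\<And>n \<omega>. \<omega> \<in> space M \<Longrightarrow> 0 \<le> f n \<omega>"
    "\<And>\<omega>. \<omega> \<in> space M \<Longrightarrow> incseq (\<lambda>n. ennreal (f n \<omega>))"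
    "\<And>\<omega>. \<omega> \<in> space M \<Longrightarrow> (SUP n. ennreal (f n \<omega>)) = Z \<omega>"
    using ennreal_approx_H[OF Z] by auto
  obtain g where g: "\<And>n. g n \<in> H" "\<And>n \<omega>. \<omega> \<in> space M \<Longrightarrow> 0 \<le> g n \<omega>"
    "\<And>\<omega>. \<omega> \<in> space M \<Longrightarrow> incseq (\<lambda>n. ennreal (g n \<omega>))"
    "\<And>\<omega>. \<omega> \<in> space M \<Longrightarrow> (SUP n. ennreal (g n \<omega>)) = W \<omega>"
    using ennreal_approx_H[OF W] by auto
  have [measurable]: "f n \<in> borel_measurable M" "g n \<in> borel_measurable M" for n
    using f g H_measurableD by auto
  have "upper (\<lambda>\<omega>. Z \<omega> + W \<omega>) \<le> upper (\<lambda>\<omega>. SUP n. ennreal (f n \<omega>) + ennreal (g n \<omega>))"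
    by (rule upper_mono) (simp add: SUP_add_directed_ennreal f g ennreal_SUP_add flip: f(4) g(4))
  also have "\<dots> = (SUP n. upper (\<lambda>\<omega>. ennreal (f n \<omega>) + ennreal (g n \<omega>)))"
    using f(3) g(3) by (intro upper_SUP) (auto simp: incseq_def intro: add_mono)
  also have "\<dots> \<le> upper Z + upper W"
  proof (rule SUP_least)
    fix n
    have "upper (\<lambda>\<omega>. ennreal (f n \<omega>) + ennreal (g n \<omega>)) \<le> upper (\<lambda>\<omega>. ennreal (f n \<omega> + g n \<omega>))"
      using f(2) g(2) by (intro upper_mono) simp
    also have "\<dots> = ennreal (mean (\<lambda>\<omega>. f n \<omega> + g n \<omega>))"
      using f(1,2) g(1,2) by (intro upper_H H_add) auto
    also have "\<dots> \<le> ennreal (mean (f n) + mean (g n))"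
      using f g by (intro ennreal_leI mean_add)
    also have "\<dots> = ennreal (mean (f n)) + ennreal (mean (g n))"
      using f g by (intro ennreal_plus mean_nonneg)
    also have "\<dots> \<le> upper Z + upper W"
      using f(1,2) g(1,2) by (intro add_mono upper_geI) (auto intro: SUP_upper simp flip: f(4) g(4))
    finally show "upper (\<lambda>\<omega>. ennreal (f n \<omega>) + ennreal (g n \<omega>)) \<le> upper Z + upper W" .
  qed
  finally show ?thesis .
qed

lemma upper_zero: "upper (\<lambda>_. 0) = 0"
  using upper_H[of "\<lambda>_. 0"] by (simp add: H_const mean_const)

lemma upper_sum:
  "finite I \<Longrightarrow> (\<And>i. i \<in> I \<Longrightarrow> Z i \<in> borel_measurable M) \<Longrightarrow> upper (\<lambda>\<omega>. \<Sum>i\<in>I. Z i \<omega>) \<le> (\<Sum>i\<in>I. upper (Z i))"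
proof (induction I rule: finite_induct)
  case (insert i I)
  have "upper (\<lambda>\<omega>. Z i \<omega> + (\<Sum>i\<in>I. Z i \<omega>)) \<le> upper (Z i) + upper (\<lambda>\<omega>. \<Sum>i\<in>I. Z i \<omega>)"
    using insert by (intro upper_add borel_measurable_sum) auto
  also have "\<dots> \<le> upper (Z i) + (\<Sum>i\<in>I. upper (Z i))"
    using insert by (intro add_left_mono) auto
  finally show ?case using insert by simp
qed (simp add: upper_zero)

lemma upper_suminf:
  assumes [measurable]: "\<And>n. Z n \<in> borel_measurable M"
  shows "upper (\<lambda>\<omega>. \<Sum>n. Z n \<omega>) \<le> (\<Sum>n. upper (Z n))"
proof -
  have "upper (\<lambda>\<omega>. \<Sum>n. Z n \<omega>) = (SUP n. upper (\<lambda>\<omega>. \<Sum>i<n. Z i \<omega>))"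
    unfolding suminf_eq_SUP
    by (rule upper_SUP) (auto simp: incseq_def intro!: sum_mono2)
  also have "\<dots> \<le> (SUP n. \<Sum>i<n. upper (Z i))"
    by (intro SUP_mono' upper_sum) auto
  finally show ?thesis by (simp add: suminf_eq_SUP)
qed

lemma upper_indicator: "A \<in> sets M \<Longrightarrow> upper (indicator A) = ennreal (mean (indicator A))"
  using upper_H[OF H_indicator_set, of A] by (simp add: ennreal_indicator)

lemma ennreal_suminf_one: "(\<Sum>n::nat. 1 :: ennreal) = \<infinity>"
  using summable_iff_suminf_neq_top[of "\<lambda>_. 1"] by (simp add: summable_const_iff)

text \<open>On N, the value \<infinity> is a sum of countably many ones, so countable subadditivity
  bounds the left-hand side by a sum of zeros.\<close>

lemma upper_null_top:
  assumes N: "N \<in> sets M" "mean (indicator N) = 0"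
  shows "upper (\<lambda>\<omega>. \<infinity> * indicator N \<omega>) = 0"
proof -
  have "upper (\<lambda>\<omega>. \<infinity> * indicator N \<omega>) \<le> upper (\<lambda>\<omega>. \<Sum>n::nat. indicator N \<omega>)"
    by (intro upper_mono) (auto simp: indicator_def ennreal_suminf_one)
  also have "\<dots> \<le> (\<Sum>n::nat. upper (indicator N))"
    using N by (intro upper_suminf) auto
  also have "\<dots> = 0" by (simp add: upper_indicator N)
  finally show ?thesis by simp
qed

text \<open>
  The measure is \<open>0\<close> on the polar sets and \<open>\<infinity>\<close> on all other sets, so that quasi-sure statements are
  almost-everywhere statements.
\<close>

definition qs_measure :: "'a measure" where
  "qs_measure = measure_of (space M) (sets M) (\<lambda>A. if mean (indicator A) = 0 then 0 else \<infinity>)"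

lemma sets_qs_measure [simp, measurable_cong]: "sets qs_measure = sets M"
  and space_qs_measure [simp]: "space qs_measure = space M"
  by (auto simp: qs_measure_def sets.space_closed)

text \<open>Countable additivity has two cases. If all sets are polar, so is their union, by
  countable subadditivity of \<open>upper\<close>; if one is not polar, both sides are
  \<infinity>.\<close>

lemma emeasure_qs_measure:
  assumes "A \<in> sets M"
  shows "emeasure qs_measure A = (if mean (indicator A) = 0 then 0 else \<infinity>)"
  unfolding qs_measure_def
proof (rule emeasure_measure_of_sigma[OF _ _ _ assms])
  let ?\<mu> = "\<lambda>A. if mean (indicator A) = 0 then 0 else \<infinity> :: ennreal"
  show "sigma_algebra (space M) (sets M)" by (rule sets.sigma_algebra_axioms)
  show "positive (sets M) ?\<mu>"
  proof -
    have "indicator {} = (\<lambda>_::'a. 0::real)" by (simp add: fun_eq_iff)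
    then show ?thesis using mean_const[of 0] by (simp only: positive_def) simp
  qed
  show "countably_additive (sets M) ?\<mu>"
  proof (rule countably_additiveI)
    fix A :: "nat \<Rightarrow> 'a set" assume A: "range A \<subseteq> sets M" "(\<Union>i. A i) \<in> sets M"
    show "(\<Sum>i. ?\<mu> (A i)) = ?\<mu> (\<Union>i. A i)"
    proof (cases "\<forall>i. mean (indicator (A i)) = 0")
      case True
      have "upper (indicator (\<Union>i. A i)) \<le> upper (\<lambda>\<omega>. \<Sum>i. indicator (A i) \<omega>)"
      proof (rule upper_mono)
        fix \<omega> show "indicator (\<Union>i. A i) \<omega> \<le> (\<Sum>i. indicator (A i) \<omega> :: ennreal)"
        proof (cases "\<omega> \<in> (\<Union>i. A i)")
          case True
          then obtain i where "\<omega> \<in> A i" by auto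
          then have "indicator (\<Union>i. A i) \<omega> \<le> (\<Sum>i\<in>{i}. indicator (A i) \<omega> :: ennreal)" by (auto simp: indicator_def)
          also have "\<dots> \<le> (\<Sum>i. indicator (A i) \<omega>)" by (intro sum_le_suminf) auto
          finally show ?thesis .
        qed simp
      qed
      also have "\<dots> \<le> (\<Sum>i. upper (indicator (A i)))"
        using A by (intro upper_suminf) auto
      also have "\<dots> = 0"
        using A True by (subst upper_indicator) auto
      finally have "mean (indicator (\<Union>i. A i)) \<le> 0"
        using A by (simp add: upper_indicator ennreal_eq_0_iff)
      moreover have "0 \<le> mean (indicator (\<Union>i. A i))"
        using A by (intro mean_nonneg H_indicator_set) auto
      ultimately show ?thesis using True by simp
    next
      case False
      then obtain i where i: "mean (indicator (A i)) \<noteq> 0" by auto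
      have "0 \<le> mean (indicator (A i))" "mean (indicator (A i)) \<le> mean (indicator (\<Union>i. A i))"
        using A by (auto intro!: mean_nonneg mean_mono H_indicator_set simp: indicator_def)
      then have "mean (indicator (\<Union>i. A i)) \<noteq> 0" using i by auto
      moreover have "(\<Sum>j\<in>{i}. ?\<mu> (A j)) \<le> (\<Sum>j. ?\<mu> (A j))"
        by (intro sum_le_suminf) auto
      ultimately show ?thesis using i by (simp add: top_unique)
    qed
  qed
qed

section \<open>Quasi-sure calculus for the upper expectation\<close>

lemma quasi_surely_iff_AE: "quasi_surely M E P \<longleftrightarrow> (AE \<omega> in qs_measure. P \<omega>)"
proof
  assume "quasi_surely M E P"
  then obtain N where N: "N \<in> sets M" "mean (indicator N) = 0" "\<forall>\<omega>\<in>space M - N. P \<omega>"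
    by (auto simp: quasi_surely_def)
  then show "AE \<omega> in qs_measure. P \<omega>"
    by (intro AE_I[of _ _ N]) (auto simp: emeasure_qs_measure)
next
  assume "AE \<omega> in qs_measure. P \<omega>"
  then obtain N where "{\<omega>\<in>space M. \<not> P \<omega>} \<subseteq> N" "emeasure qs_measure N = 0" "N \<in> sets M"
    by (auto elim!: AE_E)
  then show "quasi_surely M E P"
    by (auto simp: quasi_surely_def emeasure_qs_measure split: if_splits)
qed

text \<open>Adding \<infinity> on the exceptional set makes the inequality hold everywhere on
  \<open>space M\<close>, and this addition has upper expectation 0.\<close>

lemma upper_mono_AE:
  assumes "AE \<omega> in qs_measure. Z \<omega> \<le> W \<omega>" and [measurable]: "W \<in> borel_measurable M"
  shows "upper Z \<le> upper W"
proof -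
  obtain N where N: "N \<in> sets M" "mean (indicator N) = 0" "\<forall>\<omega>\<in>space M - N. Z \<omega> \<le> W \<omega>"
    using assms(1) by (auto simp: quasi_surely_def simp flip: quasi_surely_iff_AE)
  have "upper Z \<le> upper (\<lambda>\<omega>. W \<omega> + \<infinity> * indicator N \<omega>)"
    using N by (intro upper_mono) (auto simp: indicator_def)
  also have "\<dots> \<le> upper W + upper (\<lambda>\<omega>. \<infinity> * indicator N \<omega>)"
    using N by (intro upper_add) auto
  finally show ?thesis using upper_null_top[OF N(1,2)] by simp
qed

text \<open>The infima over tails increase to the liminf, so continuity from below suffices. The
  bound is asked from \<open>n0\<close> on, because Cauchy sequences are controlled only
  eventually.\<close>

lemma upper_Fatou:
  assumes [measurable]: "\<And>n. Z n \<in> borel_measurable M"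
    and le: "AE \<omega> in qs_measure. W \<omega> \<le> liminf (\<lambda>n. Z n \<omega>)" and u: "\<And>n. n \<ge> n0 \<Longrightarrow> upper (Z n) \<le> u"
  shows "upper W \<le> u"
proof -
  have "upper W \<le> upper (\<lambda>\<omega>. liminf (\<lambda>n. Z n \<omega>))"
    using le by (rule upper_mono_AE) measurable
  also have "\<dots> = (SUP n. upper (\<lambda>\<omega>. INF k\<in>{n..}. Z k \<omega>))"
    unfolding liminf_SUP_INF
    by (intro upper_SUP) (auto simp: incseq_def intro!: INF_superset_mono)
  also have "\<dots> \<le> u"
  proof (rule SUP_least)
    fix n
    have "upper (\<lambda>\<omega>. INF k\<in>{n..}. Z k \<omega>) \<le> upper (Z (max n n0))"
      by (intro upper_mono INF_lower) auto
    then show "upper (\<lambda>\<omega>. INF k\<in>{n..}. Z k \<omega>) \<le> u"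
      using u[of "max n n0"] by (meson max.cobounded2 order_trans)
  qed
  finally show ?thesis .
qed

text \<open>Every multiple of the indicator of {Z = \<infinity>} lies below Z, so all multiples of
  its mean stay under one finite bound.\<close>

lemma upper_finite_AE:
  assumes [measurable]: "Z \<in> borel_measurable M" and fin: "upper Z < \<infinity>"
  shows "AE \<omega> in qs_measure. Z \<omega> < \<infinity>"
proof -
  define A where "A = {\<omega>\<in>space M. Z \<omega> = \<infinity>}"
  have [measurable]: "A \<in> sets M" unfolding A_def by measurable
  obtain u where u: "0 \<le> u" "upper Z = ennreal u"
    using fin by (cases "upper Z" rule: ennreal_cases) auto
  have "mean (indicator A) * real k \<le> u" for k
  proof -
    have "mean (\<lambda>\<omega>. real k * indicator A \<omega>) = real k * mean (indicator A)"
      by (intro mean_scale H_indicator_set) auto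
    moreover have "ennreal (mean (\<lambda>\<omega>. real k * indicator A \<omega>)) \<le> upper Z"
      by (intro upper_geI H_scale H_indicator_set) (auto simp: A_def indicator_def)
    ultimately show ?thesis using u by (simp add: ennreal_le_iff mult.commute)
  qed
  moreover have "0 \<le> mean (indicator A)" by (intro mean_nonneg H_indicator_set) auto
  ultimately have "mean (indicator A) = 0"
    by (metis linorder_not_less mult.commute order_le_less reals_Archimedean3)
  then show ?thesis
    by (intro AE_I[of _ _ A]) (auto simp: emeasure_qs_measure, auto simp: A_def not_less top_unique)
qed

section \<open>The upper $L^1$ norm\<close>

text \<open>Infinitely many copies of Z still have total upper expectation 0, so their sum is finite
  quasi-surely; where Z > 0 it would be \<infinity>.\<close>

lemma upper_eq_0_AE:
  assumes [measurable]: "Z \<in> borel_measurable M" and Z: "upper Z = 0"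
  shows "AE \<omega> in qs_measure. Z \<omega> = 0"
proof -
  have "upper (\<lambda>\<omega>. \<Sum>n::nat. Z \<omega>) \<le> (\<Sum>n::nat. upper Z)"
    by (intro upper_suminf) simp
  then have "AE \<omega> in qs_measure. (\<Sum>n::nat. Z \<omega>) < \<infinity>"
    by (intro upper_finite_AE) (auto simp: Z)
  then show ?thesis
  proof eventually_elim
    case (elim \<omega>)
    have "(\<Sum>n::nat. Z \<omega>) = Z \<omega> * (\<Sum>n::nat. 1)"
      by (subst ennreal_suminf_cmult[symmetric]) simp
    then show ?case using elim by (simp add: ennreal_suminf_one ennreal_mult_top split: if_splits)
  qed
qed

text \<open>Taking all functions as arguments and values in [0, \<infinity>] frees triangle
  inequalities and limit arguments from integrability conditions.\<close>

definition L1_norm :: "('a \<Rightarrow> real) \<Rightarrow> ennreal" where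
  "L1_norm X = upper (\<lambda>\<omega>. ennreal \<bar>X \<omega>\<bar>)"

lemma L1_norm_H: "h \<in> H \<Longrightarrow> L1_norm h = ennreal (mean (\<lambda>\<omega>. \<bar>h \<omega>\<bar>))"
  unfolding L1_norm_def by (intro upper_H H_abs) auto

lemma L1_norm_H_nonneg:
  assumes "h \<in> H" "\<And>\<omega>. \<omega> \<in> space M \<Longrightarrow> 0 \<le> h \<omega>"
  shows "L1_norm h = ennreal (mean h)"
proof -
  have "L1_norm h \<le> upper (\<lambda>\<omega>. ennreal (h \<omega>))" "upper (\<lambda>\<omega>. ennreal (h \<omega>)) \<le> L1_norm h"
    unfolding L1_norm_def using assms(2) by (auto intro!: upper_mono)
  then show ?thesis using upper_H[OF assms] by simp
qed

lemma L1_norm_const: "L1_norm (\<lambda>_. c) = ennreal \<bar>c\<bar>"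
  by (simp add: L1_norm_H H_const mean_const)

lemma L1_norm_mono:
  assumes "AE \<omega> in qs_measure. \<bar>X \<omega>\<bar> \<le> \<bar>Y \<omega>\<bar>" "Y \<in> borel_measurable M"
  shows "L1_norm X \<le> L1_norm Y"
  unfolding L1_norm_def
proof (rule upper_mono_AE)
  show "AE \<omega> in qs_measure. ennreal \<bar>X \<omega>\<bar> \<le> ennreal \<bar>Y \<omega>\<bar>"
    using assms(1) by eventually_elim (simp add: ennreal_leI)
qed (use assms(2) in measurable)

lemma L1_norm_le2:
  assumes le: "AE \<omega> in qs_measure. \<bar>X \<omega>\<bar> \<le> \<bar>Y \<omega>\<bar> + \<bar>Z \<omega>\<bar>"
    and [measurable]: "Y \<in> borel_measurable M" "Z \<in> borel_measurable M"
  shows "L1_norm X \<le> L1_norm Y + L1_norm Z"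
proof -
  have "L1_norm X \<le> upper (\<lambda>\<omega>. ennreal \<bar>Y \<omega>\<bar> + ennreal \<bar>Z \<omega>\<bar>)"
    unfolding L1_norm_def
  proof (rule upper_mono_AE)
    show "AE \<omega> in qs_measure. ennreal \<bar>X \<omega>\<bar> \<le> ennreal \<bar>Y \<omega>\<bar> + ennreal \<bar>Z \<omega>\<bar>"
      using le by eventually_elim (simp add: ennreal_leI flip: ennreal_plus)
  qed simp
  also have "\<dots> \<le> L1_norm Y + L1_norm Z"
    unfolding L1_norm_def by (intro upper_add) auto
  finally show ?thesis .
qed

lemma L1_norm_le3:
  assumes le: "AE \<omega> in qs_measure. \<bar>X \<omega>\<bar> \<le> \<bar>Y \<omega>\<bar> + \<bar>Z \<omega>\<bar> + \<bar>W \<omega>\<bar>"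
    and [measurable]: "Y \<in> borel_measurable M" "Z \<in> borel_measurable M" "W \<in> borel_measurable M"
  shows "L1_norm X \<le> L1_norm Y + L1_norm Z + L1_norm W"
proof -
  have "L1_norm X \<le> L1_norm (\<lambda>\<omega>. \<bar>Y \<omega>\<bar> + \<bar>Z \<omega>\<bar>) + L1_norm W"
    using le by (intro L1_norm_le2) auto
  also have "L1_norm (\<lambda>\<omega>. \<bar>Y \<omega>\<bar> + \<bar>Z \<omega>\<bar>) \<le> L1_norm Y + L1_norm Z"
    by (intro L1_norm_le2) auto
  finally show ?thesis by (simp add: add_right_mono)
qed

lemma L1_norm_eq_0_AE:
  assumes [measurable]: "X \<in> borel_measurable M" and "L1_norm X = 0"
  shows "AE \<omega> in qs_measure. X \<omega> = 0"
  using upper_eq_0_AE[of "\<lambda>\<omega>. ennreal \<bar>X \<omega>\<bar>"] assms(2) by (simp add: L1_norm_def)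

lemma L1_norm_eps_AE:
  assumes "X \<in> borel_measurable M" and "\<And>e. 0 < e \<Longrightarrow> L1_norm X \<le> ennreal e"
  shows "AE \<omega> in qs_measure. X \<omega> = 0"
proof (rule L1_norm_eq_0_AE[OF assms(1)])
  have "L1_norm X \<le> 0" by (rule ennreal_le_epsilon) (use assms(2) in simp)
  then show "L1_norm X = 0" by simp
qed

lemma L1_norm_Fatou:
  assumes [measurable]: "\<And>n. Z n \<in> borel_measurable M"
    and lim: "AE \<omega> in qs_measure. (\<lambda>n. Z n \<omega>) \<longlonglongrightarrow> W \<omega>" and u: "\<And>n. n \<ge> n0 \<Longrightarrow> L1_norm (Z n) \<le> u"
  shows "L1_norm W \<le> u"
  unfolding L1_norm_def
proof (rule upper_Fatou[of "\<lambda>n \<omega>. ennreal \<bar>Z n \<omega>\<bar>" _ n0])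
  show "AE \<omega> in qs_measure. ennreal \<bar>W \<omega>\<bar> \<le> liminf (\<lambda>n. ennreal \<bar>Z n \<omega>\<bar>)"
    using lim
  proof eventually_elim
    case (elim \<omega>)
    then have "(\<lambda>n. ennreal \<bar>Z n \<omega>\<bar>) \<longlonglongrightarrow> ennreal \<bar>W \<omega>\<bar>"
      by (intro tendsto_ennrealI tendsto_rabs)
    then have "liminf (\<lambda>n. ennreal \<bar>Z n \<omega>\<bar>) = ennreal \<bar>W \<omega>\<bar>"
      by (rule lim_imp_Liminf[OF sequentially_bot])
    then show ?case by simp
  qed
qed (use u in \<open>auto simp: L1_norm_def\<close>)

text \<open>Countable subadditivity bounds the upper expectation of the whole series by a geometric
  series. This supplies quasi-sure convergence along fast subsequences.\<close>

lemma L1_norm_summable_AE: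
  assumes [measurable]: "\<And>n. Z n \<in> borel_measurable M"
    and le: "\<And>n. L1_norm (Z n) \<le> ennreal ((1/2)^n)"
  shows "AE \<omega> in qs_measure. summable (\<lambda>n. \<bar>Z n \<omega>\<bar>)"
proof -
  have "upper (\<lambda>\<omega>. \<Sum>n. ennreal \<bar>Z n \<omega>\<bar>) \<le> (\<Sum>n. L1_norm (Z n))"
    unfolding L1_norm_def by (intro upper_suminf) simp
  also have "\<dots> \<le> (\<Sum>n. ennreal ((1/2)^n))"
    by (intro suminf_le le) auto
  also have "\<dots> < \<infinity>"
    unfolding infinity_ennreal_def less_top[symmetric]
    by (rule ennreal_suminf_neq_top) (auto intro: summable_geometric)
  finally have "AE \<omega> in qs_measure. (\<Sum>n. ennreal \<bar>Z n \<omega>\<bar>) < \<infinity>"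
    by (intro upper_finite_AE) auto
  then show ?thesis
    by eventually_elim (auto intro!: summable_suminf_not_top)
qed

section \<open>Contraction property of \<open>E t\<close>, the closure of \<open>H\<close>,
  dominated convergence and completeness\<close>

lemma E_abs_diff_le:
  assumes "X \<in> H" "Y \<in> H" "\<omega> \<in> space M"
  shows "\<bar>E t X \<omega> - E t Y \<omega>\<bar> \<le> E t (\<lambda>\<omega>. \<bar>X \<omega> - Y \<omega>\<bar>) \<omega>"
proof -
  have "E t (\<lambda>\<omega>. X \<omega> - Y \<omega>) \<omega> \<le> E t (\<lambda>\<omega>. \<bar>X \<omega> - Y \<omega>\<bar>) \<omega>"
    "E t (\<lambda>\<omega>. Y \<omega> - X \<omega>) \<omega> \<le> E t (\<lambda>\<omega>. \<bar>X \<omega> - Y \<omega>\<bar>) \<omega>"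
    using assms by (auto intro!: E_mono H_abs H_diff)
  then show ?thesis
    using E_diff_le[OF assms(1,2,3), of t] E_diff_le[OF assms(2,1,3), of t] by linarith
qed

lemma E_M: "X \<in> H \<Longrightarrow> E t X \<in> borel_measurable M"
  by (intro H_measurableD E_H)

lemma L1_norm_E_nonneg:
  assumes "X \<in> H" "\<And>\<omega>. \<omega> \<in> space M \<Longrightarrow> 0 \<le> X \<omega>"
  shows "L1_norm (E t X) = L1_norm X"
  using assms by (simp add: L1_norm_H_nonneg E_H E_nonneg mean_E)

text \<open>The mean of E_t(|X - Y|) is that of |X - Y| by the tower property at time 0. This
  contraction lets \<open>E t\<close> extend to the completion.\<close>

lemma L1_norm_E_diff:
  assumes "X \<in> H" "Y \<in> H"
  shows "L1_norm (\<lambda>\<omega>. E t X \<omega> - E t Y \<omega>) \<le> L1_norm (\<lambda>\<omega>. X \<omega> - Y \<omega>)"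
proof -
  let ?D = "\<lambda>\<omega>. \<bar>X \<omega> - Y \<omega>\<bar>"
  have D: "?D \<in> H" using assms by (intro H_abs H_diff)
  have "L1_norm (\<lambda>\<omega>. E t X \<omega> - E t Y \<omega>) \<le> L1_norm (E t ?D)"
    using D by (intro L1_norm_mono E_M AE_I2 order_trans[OF E_abs_diff_le[OF assms] abs_ge_self]) auto
  also have "\<dots> = L1_norm ?D"
    using D by (intro L1_norm_E_nonneg) auto
  finally show ?thesis by (simp add: L1_norm_def)
qed

text \<open>The closure of \<open>H\<close> among measurable functions, that is, the real-valued
  representatives of elements of L^1; \<open>L1_space_iff\<close> links it to the
  completion.\<close>

definition L1_real :: "('a \<Rightarrow> real) set" where
  "L1_real = {X \<in> borel_measurable M. \<forall>e>0. \<exists>h\<in>H. L1_norm (\<lambda>\<omega>. h \<omega> - X \<omega>) \<le> ennreal e}"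

lemma L1_realE:
  assumes "X \<in> L1_real" "0 < e"
  obtains h where "h \<in> H" "L1_norm (\<lambda>\<omega>. h \<omega> - X \<omega>) \<le> ennreal e"
  using assms by (auto simp: L1_real_def)

lemma L1_real_measurable: "X \<in> L1_real \<Longrightarrow> X \<in> borel_measurable M"
  by (simp add: L1_real_def)

lemma H_L1_real: "h \<in> H \<Longrightarrow> h \<in> L1_real"
  by (auto simp: L1_real_def L1_norm_const H_measurableD intro!: bexI[of _ h])

lemma L1_real_seq:
  assumes X: "X \<in> L1_real"
  shows "\<exists>h :: nat \<Rightarrow> 'a \<Rightarrow> real. (\<forall>n. h n \<in> H) \<and>
    (\<forall>e>0. \<exists>n0. \<forall>n\<ge>n0. L1_norm (\<lambda>\<omega>. h n \<omega> - X \<omega>) \<le> ennreal e)"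
proof -
  have "\<exists>h\<in>H. L1_norm (\<lambda>\<omega>. h \<omega> - X \<omega>) \<le> ennreal (1 / Suc n)" for n
    using L1_realE[OF X, of "1 / Suc n"] by (metis of_nat_0_less_iff zero_less_Suc zero_less_divide_1_iff)
  then obtain h where h: "\<And>n. h n \<in> H" "\<And>n. L1_norm (\<lambda>\<omega>. h n \<omega> - X \<omega>) \<le> ennreal (1 / Suc n)"
    by metis
  have "\<exists>n0. \<forall>n\<ge>n0. L1_norm (\<lambda>\<omega>. h n \<omega> - X \<omega>) \<le> ennreal e" if e: "0 < e" for e
  proof -
    obtain n0 where n0: "inverse (real (Suc n0)) < e" using reals_Archimedean[OF e] by auto
    have "L1_norm (\<lambda>\<omega>. h n \<omega> - X \<omega>) \<le> ennreal e" if "n0 \<le> n" for n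
    proof -
      have "1 / Suc n \<le> 1 / Suc n0" using that by (intro divide_left_mono) auto
      then show ?thesis using h(2)[of n] n0
        by (intro order_trans[OF h(2)] ennreal_leI) (simp add: inverse_eq_divide)
    qed
    then show ?thesis by blast
  qed
  with h(1) show ?thesis by blast
qed

lemma L1_norm_decseq_sets:
  assumes h: "h \<in> H" and A: "\<And>n. A n \<in> sets M" "decseq A" "(\<Inter>n. A n) = {}" and e: "0 < (e::real)"
  shows "\<forall>\<^sub>F n in sequentially. L1_norm (\<lambda>\<omega>. indicator (A n) \<omega> * h \<omega>) \<le> ennreal e"
proof -
  have "(\<lambda>n. mean (\<lambda>\<omega>. indicator (A n) \<omega> * \<bar>h \<omega>\<bar>)) \<longlonglongrightarrow> 0"
    using h A by (intro mean_decseq_sets H_abs) auto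
  then have "\<forall>\<^sub>F n in sequentially. mean (\<lambda>\<omega>. indicator (A n) \<omega> * \<bar>h \<omega>\<bar>) < e"
    using e by (rule order_tendstoD)
  then show ?thesis
  proof eventually_elim
    case (elim n)
    have "L1_norm (\<lambda>\<omega>. indicator (A n) \<omega> * h \<omega>) = ennreal (mean (\<lambda>\<omega>. indicator (A n) \<omega> * \<bar>h \<omega>\<bar>))"
      using h A by (simp add: L1_norm_H H_indicator abs_mult)
    then show ?case using elim by (simp add: ennreal_leI)
  qed
qed

text \<open>The dominating function is taken from the closure of \<open>H\<close>, since continuity
  from above is available for a fixed member of \<open>H\<close> cut down by sets that shrink to the
  empty set. Off these sets \<open>Z n\<close> is small; on them it is compared with that member
  through |X|.\<close>

lemma L1_dominated_convergence:
  assumes X: "X \<in> L1_real" and [measurable]: "\<And>n. Z n \<in> borel_measurable M"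
    and le: "\<And>n. AE \<omega> in qs_measure. \<bar>Z n \<omega>\<bar> \<le> \<bar>X \<omega>\<bar>"
    and lim: "AE \<omega> in qs_measure. (\<lambda>n. Z n \<omega>) \<longlonglongrightarrow> 0" and e: "0 < (e::real)"
  shows "\<forall>\<^sub>F n in sequentially. L1_norm (Z n) \<le> ennreal e"
proof -
  obtain h where h: "h \<in> H" "L1_norm (\<lambda>\<omega>. h \<omega> - X \<omega>) \<le> ennreal (e/3)"
    using X e by (auto elim: L1_realE[where e = "e/3"])
  note [measurable] = L1_real_measurable[OF X] H_measurableD[OF h(1)]
  obtain N where N: "N \<in> sets M" "mean (indicator N) = 0" "\<And>\<omega>. \<omega> \<in> space M - N \<Longrightarrow> (\<lambda>n. Z n \<omega>) \<longlonglongrightarrow> 0"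
    using lim by (auto simp: quasi_surely_def simp flip: quasi_surely_iff_AE)
  have "AE \<omega> in qs_measure. \<omega> \<notin> N"
    using N by (intro AE_not_in null_setsI) (auto simp: emeasure_qs_measure)
  \<comment> \<open>Asking for some k \<ge> n makes the sets decrease; \<open>N\<close> is taken out
    because their intersection must be empty at every point.\<close>
  define A where "A n = {\<omega>\<in>space M. \<exists>k\<ge>n. e/3 < \<bar>Z k \<omega>\<bar>} - N" for n
  have [measurable]: "A n \<in> sets M" for n unfolding A_def using N(1) by measurable
  have "\<forall>\<^sub>F n in sequentially. L1_norm (\<lambda>\<omega>. indicator (A n) \<omega> * h \<omega>) \<le> ennreal (e/3)"
  proof (rule L1_norm_decseq_sets)
    show "decseq A" by (rule decseq_SucI) (auto simp: A_def dest: Suc_leD)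
    show "(\<Inter>n. A n) = {}"
    proof (rule equals0I)
      fix \<omega> assume \<omega>: "\<omega> \<in> (\<Inter>n. A n)"
      then have "\<omega> \<in> space M - N" by (auto simp: A_def)
      then have "(\<lambda>n. \<bar>Z n \<omega>\<bar>) \<longlonglongrightarrow> 0" using N(3) by (simp add: tendsto_rabs_zero)
      then have "\<forall>\<^sub>F n in sequentially. \<bar>Z n \<omega>\<bar> < e/3" using e by (intro order_tendstoD) auto
      then obtain n where "\<And>k. k \<ge> n \<Longrightarrow> \<bar>Z k \<omega>\<bar> < e/3" by (auto simp: eventually_sequentially)
      moreover have "\<omega> \<in> A n" using \<omega> by blast
      ultimately show False by (force simp: A_def)
    qed
  qed (use h e in auto)
  then show ?thesis
  proof eventually_elim
    case (elim n)
    \<comment> \<open>Off \<open>A n\<close> the constant e/3 dominates; on \<open>A n\<close>, |Z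
      n| \<le> |X| \<le> |h - X| + |h|.\<close>
    have "L1_norm (Z n) \<le> L1_norm (\<lambda>\<omega>. h \<omega> - X \<omega>) + L1_norm (\<lambda>_. e/3) + L1_norm (\<lambda>\<omega>. indicator (A n) \<omega> * h \<omega>)"
    proof (rule L1_norm_le3)
      have "AE \<omega> in qs_measure. \<omega> \<in> space M" using AE_space[of qs_measure] by simp
      then show "AE \<omega> in qs_measure. \<bar>Z n \<omega>\<bar> \<le> \<bar>h \<omega> - X \<omega>\<bar> + \<bar>e/3\<bar> + \<bar>indicator (A n) \<omega> * h \<omega>\<bar>"
        using le[of n] \<open>AE \<omega> in qs_measure. \<omega> \<notin> N\<close>
      proof eventually_elim
        case (elim \<omega>)
        then show ?case
          using e by (cases "\<omega> \<in> A n") (auto simp: A_def not_less)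
      qed
    qed auto
    also have "\<dots> \<le> ennreal (e/3) + ennreal (e/3) + ennreal (e/3)"
      using h(2) elim e by (intro add_mono) (auto simp: L1_norm_const)
    also have "\<dots> = ennreal e" using e by (simp flip: ennreal_plus)
    finally show ?case .
  qed
qed

text \<open>Riesz-Fischer: a subsequence with increments of norm at most 2^-k converges
  quasi-surely, and Fatou along it identifies the limit in norm. Working in \<open>F t\<close> keeps
  limits of \<open>E t (h n)\<close> measurable for \<open>F t\<close>.\<close>

lemma L1_complete:
  fixes X :: "nat \<Rightarrow> 'a \<Rightarrow> real"
  assumes N: "\<And>n. X n \<in> borel_measurable (F t)"
    and Cauchy: "\<And>e. 0 < e \<Longrightarrow> \<exists>n0. \<forall>m\<ge>n0. \<forall>n\<ge>n0. L1_norm (\<lambda>\<omega>. X m \<omega> - X n \<omega>) \<le> ennreal e"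
  obtains Y where "Y \<in> borel_measurable (F t)"
    "\<And>e. 0 < e \<Longrightarrow> \<exists>n0. \<forall>n\<ge>n0. L1_norm (\<lambda>\<omega>. X n \<omega> - Y \<omega>) \<le> ennreal e"
proof -
  have [measurable]: "X n \<in> borel_measurable M" for n using N by (rule measurable_F_M)
  have "\<forall>k. \<exists>n0. \<forall>m\<ge>n0. \<forall>n\<ge>n0. L1_norm (\<lambda>\<omega>. X m \<omega> - X n \<omega>) \<le> ennreal ((1/2)^k)"
    by (intro allI Cauchy) simp
  then obtain K :: "nat \<Rightarrow> nat" where K: "\<And>k m n. m \<ge> K k \<Longrightarrow> n \<ge> K k \<Longrightarrow> L1_norm (\<lambda>\<omega>. X m \<omega> - X n \<omega>) \<le> ennreal ((1/2)^k)"
    by metis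
  \<comment> \<open>Summing the thresholds puts both \<open>r k\<close> and \<open>r (Suc k)\<close>
    beyond \<open>K k\<close>; the summand k gives k \<le> \<open>r k\<close>.\<close>
  define r where "r k = (\<Sum>i\<le>k. K i) + k" for k
  have r: "K k \<le> r k" "K k \<le> r (Suc k)" "k \<le> r k" for k
    using member_le_sum[of k "{..k}" K] by (simp_all add: r_def)
  \<comment> \<open>\<open>lim\<close> has a fixed default where the sequence diverges, so
    \<open>Y\<close> is measurable for \<open>F t\<close> without a modification on an exceptional
    set.\<close>
  define Y where "Y \<omega> = lim (\<lambda>k. X (r k) \<omega>)" for \<omega>
  have "AE \<omega> in qs_measure. summable (\<lambda>k. \<bar>X (r (Suc k)) \<omega> - X (r k) \<omega>\<bar>)"
    using K r by (intro L1_norm_summable_AE) auto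
  then have lim: "AE \<omega> in qs_measure. (\<lambda>k. X (r k) \<omega>) \<longlonglongrightarrow> Y \<omega>"
  proof eventually_elim
    case (elim \<omega>)
    then have "summable (\<lambda>k. X (r (Suc k)) \<omega> - X (r k) \<omega>)" by (rule summable_rabs_cancel)
    then have "convergent (\<lambda>k. X (r k) \<omega>)" 
      using sum_lessThan_telescope[of "\<lambda>k. X (r k) \<omega>"]
      by (simp add: summable_iff_convergent convergent_diff_const_right_iff)
    then show ?case by (simp add: Y_def convergent_LIMSEQ_iff)
  qed
  show ?thesis
  proof (rule that)
    show "Y \<in> borel_measurable (F t)" unfolding Y_def by (intro borel_measurable_lim_metric N)
    fix e :: real assume "0 < e"
    then obtain n0 where n0: "\<And>m n. m \<ge> n0 \<Longrightarrow> n \<ge> n0 \<Longrightarrow> L1_norm (\<lambda>\<omega>. X m \<omega> - X n \<omega>) \<le> ennreal e"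
      using Cauchy by metis
    show "\<exists>n0. \<forall>n\<ge>n0. L1_norm (\<lambda>\<omega>. X n \<omega> - Y \<omega>) \<le> ennreal e"
    proof (intro exI[of _ n0] allI impI)
      fix n assume "n0 \<le> n"
      show "L1_norm (\<lambda>\<omega>. X n \<omega> - Y \<omega>) \<le> ennreal e"
      proof (rule L1_norm_Fatou[of "\<lambda>k \<omega>. X n \<omega> - X (r k) \<omega>" _ n0])
        show "AE \<omega> in qs_measure. (\<lambda>k. X n \<omega> - X (r k) \<omega>) \<longlonglongrightarrow> X n \<omega> - Y \<omega>"
          using lim by eventually_elim (intro tendsto_intros)
        show "L1_norm (\<lambda>\<omega>. X n \<omega> - X (r k) \<omega>) \<le> ennreal e" if "n0 \<le> k" for k
          using that \<open>n0 \<le> n\<close> r(3)[of k] by (intro n0) auto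
      qed simp
    qed
  qed
qed

section \<open>Conditional expectations on $L^1$\<close>

text \<open>
  \<open>Y\<close> is a version of the extension of \<open>E t\<close> to \<open>L\<^sup>1\<close> at \<open>X\<close>; versions are kept as a relation, so that no
  choice is involved.
\<close>

definition is_cond_exp :: "nat \<Rightarrow> ('a \<Rightarrow> real) \<Rightarrow> ('a \<Rightarrow> real) \<Rightarrow> bool" where
  "is_cond_exp t X Y \<longleftrightarrow> X \<in> borel_measurable M \<and> Y \<in> borel_measurable (F t) \<and>
    (\<forall>e>0. \<exists>h\<in>H. L1_norm (\<lambda>\<omega>. h \<omega> - X \<omega>) \<le> ennreal e \<and> L1_norm (\<lambda>\<omega>. E t h \<omega> - Y \<omega>) \<le> ennreal e)"

lemma is_cond_expE:
  assumes "is_cond_exp t X Y" "0 < e"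
  obtains h where "h \<in> H" "L1_norm (\<lambda>\<omega>. h \<omega> - X \<omega>) \<le> ennreal e" "L1_norm (\<lambda>\<omega>. E t h \<omega> - Y \<omega>) \<le> ennreal e"
  using assms by (auto simp: is_cond_exp_def)

lemma is_cond_exp_measurable:
  assumes "is_cond_exp t X Y"
  shows "X \<in> borel_measurable M" "Y \<in> borel_measurable (F t)" "Y \<in> borel_measurable M"
  using assms by (auto simp: is_cond_exp_def measurable_F_M)

lemma is_cond_exp_L1_real:
  assumes "is_cond_exp t X Y" shows "X \<in> L1_real" "Y \<in> L1_real"
  using assms is_cond_exp_measurable[OF assms]
  unfolding L1_real_def is_cond_exp_def by (blast intro: E_H)+

text \<open>Closedness of the relation under norm limits of pairs. Limits of martingales and changes
  of version both reduce to it.\<close>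

lemma is_cond_exp_closed:
  assumes [measurable]: "X \<in> borel_measurable M" and Y: "Y \<in> borel_measurable (F t)"
    and approx: "\<And>e. 0 < e \<Longrightarrow> \<exists>X' Y'. is_cond_exp t X' Y' \<and>
      L1_norm (\<lambda>\<omega>. X' \<omega> - X \<omega>) \<le> ennreal e \<and> L1_norm (\<lambda>\<omega>. Y' \<omega> - Y \<omega>) \<le> ennreal e"
  shows "is_cond_exp t X Y"
  unfolding is_cond_exp_def
proof (intro conjI allI impI)
  note [measurable] = measurable_F_M[OF Y]
  fix e :: real assume e: "0 < e"
  obtain X' Y' where c: "is_cond_exp t X' Y'"
    and le: "L1_norm (\<lambda>\<omega>. X' \<omega> - X \<omega>) \<le> ennreal (e/2)" "L1_norm (\<lambda>\<omega>. Y' \<omega> - Y \<omega>) \<le> ennreal (e/2)"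
    using approx[of "e/2"] e by auto
  note [measurable] = is_cond_exp_measurable[OF c]
  obtain h where h: "h \<in> H" "L1_norm (\<lambda>\<omega>. h \<omega> - X' \<omega>) \<le> ennreal (e/2)"
    "L1_norm (\<lambda>\<omega>. E t h \<omega> - Y' \<omega>) \<le> ennreal (e/2)"
    by (rule is_cond_expE[OF c, of "e/2"]) (use e in auto)
  note [measurable] = H_measurableD[OF h(1)] E_M[OF h(1)]
  have e2: "ennreal (e/2) + ennreal (e/2) = ennreal e" using e by (simp flip: ennreal_plus)
  have "L1_norm (\<lambda>\<omega>. h \<omega> - X \<omega>) \<le> L1_norm (\<lambda>\<omega>. h \<omega> - X' \<omega>) + L1_norm (\<lambda>\<omega>. X' \<omega> - X \<omega>)"
    by (intro L1_norm_le2) auto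
  also have "\<dots> \<le> ennreal e" unfolding e2[symmetric] by (intro add_mono h le)
  moreover have "L1_norm (\<lambda>\<omega>. E t h \<omega> - Y \<omega>) \<le> L1_norm (\<lambda>\<omega>. E t h \<omega> - Y' \<omega>) + L1_norm (\<lambda>\<omega>. Y' \<omega> - Y \<omega>)"
    by (intro L1_norm_le2) auto
  moreover have "\<dots> \<le> ennreal e" unfolding e2[symmetric] by (intro add_mono h le)
  ultimately show "\<exists>h\<in>H. L1_norm (\<lambda>\<omega>. h \<omega> - X \<omega>) \<le> ennreal e \<and> L1_norm (\<lambda>\<omega>. E t h \<omega> - Y \<omega>) \<le> ennreal e"
    using h(1) by (meson order_trans)
qed (use Y in simp_all)

lemma L1_norm_AE_0: "AE \<omega> in qs_measure. X \<omega> = 0 \<Longrightarrow> L1_norm X = 0"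
  using L1_norm_mono[of X "\<lambda>_. 0"] by (auto simp: L1_norm_const)

lemma is_cond_exp_cong_AE:
  assumes "is_cond_exp t X Y" "AE \<omega> in qs_measure. X \<omega> = X' \<omega>" "AE \<omega> in qs_measure. Y \<omega> = Y' \<omega>"
    "X' \<in> borel_measurable M" "Y' \<in> borel_measurable (F t)"
  shows "is_cond_exp t X' Y'"
proof (rule is_cond_exp_closed[OF assms(4,5)])
  have "L1_norm (\<lambda>\<omega>. X \<omega> - X' \<omega>) = 0" "L1_norm (\<lambda>\<omega>. Y \<omega> - Y' \<omega>) = 0"
    using assms(2,3) by (auto intro!: L1_norm_AE_0)
  then show "\<exists>X'' Y''. is_cond_exp t X'' Y'' \<and> L1_norm (\<lambda>\<omega>. X'' \<omega> - X' \<omega>) \<le> ennreal e \<and> L1_norm (\<lambda>\<omega>. Y'' \<omega> - Y' \<omega>) \<le> ennreal e" for e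
    using assms(1) by (intro exI[of _ X] exI[of _ Y]) simp
qed

lemma is_cond_exp_H: "h \<in> H \<Longrightarrow> is_cond_exp t h (E t h)"
  unfolding is_cond_exp_def
  by (auto simp: H_measurableD E_F L1_norm_const intro!: bexI[of _ h])

text \<open>By contraction, \<open>E t\<close> maps an approximating sequence to a Cauchy sequence,
  which has an \<open>F t\<close>-measurable limit by completeness.\<close>

lemma is_cond_exp_exists:
  assumes X: "X \<in> L1_real" obtains Y where "is_cond_exp t X Y"
proof -
  note [measurable] = L1_real_measurable[OF X]
  obtain h :: "nat \<Rightarrow> 'a \<Rightarrow> real" where h: "\<And>n. h n \<in> H"
    and small: "\<And>e. 0 < e \<Longrightarrow> \<exists>n0. \<forall>n\<ge>n0. L1_norm (\<lambda>\<omega>. h n \<omega> - X \<omega>) \<le> ennreal e"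
    using L1_real_seq[OF X] by auto
  have [measurable]: "h n \<in> borel_measurable M" "E t (h n) \<in> borel_measurable M" for n
    using h by (auto intro: H_measurableD E_M)
  have "\<exists>n0. \<forall>m\<ge>n0. \<forall>n\<ge>n0. L1_norm (\<lambda>\<omega>. E t (h m) \<omega> - E t (h n) \<omega>) \<le> ennreal e" if e: "0 < e" for e
  proof -
    obtain n0 where n0: "\<And>n. n \<ge> n0 \<Longrightarrow> L1_norm (\<lambda>\<omega>. h n \<omega> - X \<omega>) \<le> ennreal (e/2)"
      using small[of "e/2"] e by auto
    have "L1_norm (\<lambda>\<omega>. E t (h m) \<omega> - E t (h n) \<omega>) \<le> ennreal e" if "n0 \<le> m" "n0 \<le> n" for m n
    proof -
      have "L1_norm (\<lambda>\<omega>. E t (h m) \<omega> - E t (h n) \<omega>) \<le> L1_norm (\<lambda>\<omega>. h m \<omega> - h n \<omega>)"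
        by (intro L1_norm_E_diff h)
      also have "\<dots> \<le> L1_norm (\<lambda>\<omega>. h m \<omega> - X \<omega>) + L1_norm (\<lambda>\<omega>. h n \<omega> - X \<omega>)"
        by (intro L1_norm_le2) auto
      also have "\<dots> \<le> ennreal (e/2) + ennreal (e/2)"
        by (intro add_mono n0 that)
      also have "\<dots> = ennreal e" using \<open>0 < e\<close> by (simp flip: ennreal_plus)
      finally show ?thesis .
    qed
    then show ?thesis by blast
  qed
  then obtain Y where Y: "Y \<in> borel_measurable (F t)"
    and lim: "\<And>e. 0 < e \<Longrightarrow> \<exists>n0. \<forall>n\<ge>n0. L1_norm (\<lambda>\<omega>. E t (h n) \<omega> - Y \<omega>) \<le> ennreal e"
    using h by (elim L1_complete[rotated]) (auto intro: E_F)
  have "is_cond_exp t X Y"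
    unfolding is_cond_exp_def
  proof (intro conjI allI impI Y)
    fix e :: real assume "0 < e"
    obtain n0 n1 where "\<forall>n\<ge>n0. L1_norm (\<lambda>\<omega>. h n \<omega> - X \<omega>) \<le> ennreal e"
      "\<forall>n\<ge>n1. L1_norm (\<lambda>\<omega>. E t (h n) \<omega> - Y \<omega>) \<le> ennreal e"
      using small[OF \<open>0 < e\<close>] lim[OF \<open>0 < e\<close>] by blast
    then show "\<exists>h\<in>H. L1_norm (\<lambda>\<omega>. h \<omega> - X \<omega>) \<le> ennreal e \<and> L1_norm (\<lambda>\<omega>. E t h \<omega> - Y \<omega>) \<le> ennreal e"
      using h by (intro bexI[of _ "h (max n0 n1)"]) auto
  qed simp
  then show ?thesis by (rule that)
qed

text \<open>The one-sided estimate on \<open>H\<close> survives approximation, at the price of four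
  errors e/4. It contains monotonicity, and with \<open>X'\<close> a trading gain it drives the
  upcrossing inequality.\<close>

lemma is_cond_exp_pos_part:
  assumes X: "is_cond_exp t X Y" and X': "is_cond_exp t X' Y'"
  shows "L1_norm (\<lambda>\<omega>. max (Y \<omega> - Y' \<omega>) 0) \<le> L1_norm (\<lambda>\<omega>. max (X \<omega> - X' \<omega>) 0)"
proof (rule ennreal_le_epsilon)
  fix e :: real assume e: "0 < e"
  note [measurable] = is_cond_exp_measurable[OF X] is_cond_exp_measurable[OF X']
  obtain h where h: "h \<in> H" "L1_norm (\<lambda>\<omega>. h \<omega> - X \<omega>) \<le> ennreal (e/4)" "L1_norm (\<lambda>\<omega>. E t h \<omega> - Y \<omega>) \<le> ennreal (e/4)"
    by (rule is_cond_expE[OF X, of "e/4"]) (use e in auto)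
  obtain k where k: "k \<in> H" "L1_norm (\<lambda>\<omega>. k \<omega> - X' \<omega>) \<le> ennreal (e/4)" "L1_norm (\<lambda>\<omega>. E t k \<omega> - Y' \<omega>) \<le> ennreal (e/4)"
    by (rule is_cond_expE[OF X', of "e/4"]) (use e in auto)
  note [measurable] = H_measurableD[OF h(1)] E_M[OF h(1)] H_measurableD[OF k(1)] E_M[OF k(1)]
  let ?d = "\<lambda>\<omega>. max (h \<omega> - k \<omega>) 0"
  have d: "?d \<in> H" using h k by (intro H_pos_part H_diff)
  note [measurable] = E_M[OF d]
  have "L1_norm (\<lambda>\<omega>. max (Y \<omega> - Y' \<omega>) 0)
      \<le> L1_norm (\<lambda>\<omega>. E t h \<omega> - Y \<omega>) + L1_norm (\<lambda>\<omega>. E t k \<omega> - Y' \<omega>) + L1_norm (E t ?d)"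
  proof (intro L1_norm_le3 AE_I2)
    fix \<omega> assume "\<omega> \<in> space qs_measure"
    then have "max (E t h \<omega> - E t k \<omega>) 0 \<le> E t ?d \<omega>"
      by (intro E_pos_part_le h k) simp
    then show "\<bar>max (Y \<omega> - Y' \<omega>) 0\<bar> \<le> \<bar>E t h \<omega> - Y \<omega>\<bar> + \<bar>E t k \<omega> - Y' \<omega>\<bar> + \<bar>E t ?d \<omega>\<bar>"
      by linarith
  qed auto
  also have "L1_norm (E t ?d) = L1_norm ?d"
    using d by (intro L1_norm_E_nonneg) auto
  also have "L1_norm ?d \<le> L1_norm (\<lambda>\<omega>. h \<omega> - X \<omega>) + L1_norm (\<lambda>\<omega>. k \<omega> - X' \<omega>) + L1_norm (\<lambda>\<omega>. max (X \<omega> - X' \<omega>) 0)"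
    by (intro L1_norm_le3 AE_I2) auto
  finally have "L1_norm (\<lambda>\<omega>. max (Y \<omega> - Y' \<omega>) 0)
      \<le> L1_norm (\<lambda>\<omega>. E t h \<omega> - Y \<omega>) + L1_norm (\<lambda>\<omega>. E t k \<omega> - Y' \<omega>) +
        (L1_norm (\<lambda>\<omega>. h \<omega> - X \<omega>) + L1_norm (\<lambda>\<omega>. k \<omega> - X' \<omega>) + L1_norm (\<lambda>\<omega>. max (X \<omega> - X' \<omega>) 0))"
    by (simp add: add_left_mono)
  also have "\<dots> \<le> ennreal (e/4) + ennreal (e/4) + (ennreal (e/4) + ennreal (e/4) + L1_norm (\<lambda>\<omega>. max (X \<omega> - X' \<omega>) 0))"
    by (intro add_mono h k order_refl)
  also have "\<dots> = L1_norm (\<lambda>\<omega>. max (X \<omega> - X' \<omega>) 0) + (ennreal (e/4) + ennreal (e/4) + ennreal (e/4) + ennreal (e/4))"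
    by (simp only: ac_simps)
  also have "ennreal (e/4) + ennreal (e/4) + ennreal (e/4) + ennreal (e/4) = ennreal e"
    using e by (simp flip: ennreal_plus)
  finally show "L1_norm (\<lambda>\<omega>. max (Y \<omega> - Y' \<omega>) 0) \<le> L1_norm (\<lambda>\<omega>. max (X \<omega> - X' \<omega>) 0) + ennreal e" .
qed

section \<open>Order, norm, tower and locality properties of conditional expectations\<close>

lemma is_cond_exp_mono:
  assumes X: "is_cond_exp t X Y" and X': "is_cond_exp t X' Y'" and le: "AE \<omega> in qs_measure. X \<omega> \<le> X' \<omega>"
  shows "AE \<omega> in qs_measure. Y \<omega> \<le> Y' \<omega>"
proof -
  note [measurable] = is_cond_exp_measurable[OF X] is_cond_exp_measurable[OF X']
  have "L1_norm (\<lambda>\<omega>. max (X \<omega> - X' \<omega>) 0) = 0"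
    using le by (auto intro!: L1_norm_AE_0)
  then have "AE \<omega> in qs_measure. max (Y \<omega> - Y' \<omega>) 0 = 0"
    using is_cond_exp_pos_part[OF X X'] by (intro L1_norm_eq_0_AE) auto
  then show ?thesis by eventually_elim auto
qed

lemma is_cond_exp_unique:
  assumes "is_cond_exp t X Y" "is_cond_exp t X Y'"
  shows "AE \<omega> in qs_measure. Y \<omega> = Y' \<omega>"
  using is_cond_exp_mono[OF assms] is_cond_exp_mono[OF assms(2,1)] by auto

lemma is_cond_exp_const: "is_cond_exp t (\<lambda>_. c) (\<lambda>_. c)"
  using is_cond_exp_H[OF H_const, of t c]
  by (rule is_cond_exp_cong_AE) (auto intro: AE_I2 simp: E_const)

lemma is_cond_exp_nonneg:
  assumes "is_cond_exp t X Y" "AE \<omega> in qs_measure. 0 \<le> X \<omega>"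
  shows "AE \<omega> in qs_measure. 0 \<le> Y \<omega>"
  by (rule is_cond_exp_mono[OF is_cond_exp_const assms])

text \<open>For nonnegative functions the norm is the mean, which conditioning preserves. One bound
  is the one-sided contraction. For the other, an approximant h may be negative somewhere, but since
  X \<ge> 0 its negative part is at most |h - X| and is charged to the error.\<close>

lemma is_cond_exp_L1_norm_eq:
  assumes X: "is_cond_exp t X Y" and pos: "AE \<omega> in qs_measure. 0 \<le> X \<omega>"
  shows "L1_norm Y = L1_norm X"
proof (rule antisym)
  note [measurable] = is_cond_exp_measurable[OF X]
  have "L1_norm Y \<le> L1_norm (\<lambda>\<omega>. max (Y \<omega> - 0) 0)"
    using is_cond_exp_nonneg[OF X pos] by (intro L1_norm_mono) auto
  also have "\<dots> \<le> L1_norm (\<lambda>\<omega>. max (X \<omega> - 0) 0)"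
    by (rule is_cond_exp_pos_part[OF X is_cond_exp_const])
  also have "\<dots> \<le> L1_norm X"
    by (intro L1_norm_mono) auto
  finally show "L1_norm Y \<le> L1_norm X" .
  show "L1_norm X \<le> L1_norm Y"
  proof (rule ennreal_le_epsilon)
    fix e :: real assume e: "0 < e"
    obtain h where h: "h \<in> H" "L1_norm (\<lambda>\<omega>. h \<omega> - X \<omega>) \<le> ennreal (e/3)" "L1_norm (\<lambda>\<omega>. E t h \<omega> - Y \<omega>) \<le> ennreal (e/3)"
      by (rule is_cond_expE[OF X, of "e/3"]) (use e in auto)
    let ?p = "\<lambda>\<omega>. max (h \<omega>) 0" and ?n = "\<lambda>\<omega>. max (- h \<omega>) 0"
    have p: "?p \<in> H" and n: "?n \<in> H" using h by (auto intro: H_pos_part H_uminus)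
    note [measurable] = H_measurableD[OF h(1)] E_M[OF h(1)] E_M[OF n]
    have "L1_norm X \<le> L1_norm (\<lambda>\<omega>. h \<omega> - X \<omega>) + L1_norm ?p"
      using pos by (intro L1_norm_le2) auto
    also have "L1_norm ?p = L1_norm (E t ?p)"
      using p by (intro L1_norm_E_nonneg[symmetric]) auto
    also have "L1_norm (E t ?p) \<le> L1_norm (\<lambda>\<omega>. E t h \<omega> - Y \<omega>) + L1_norm Y + L1_norm (E t ?n)"
    proof (intro L1_norm_le3 AE_I2)
      fix \<omega> assume "\<omega> \<in> space qs_measure"
      then have \<omega>: "\<omega> \<in> space M" by simp
      \<comment> \<open>From h^+ = h + h^-, subadditivity bounds E_t(h^+) by E_t(h) + E_t(h^-), and
        the last term is small in norm.\<close>
      have "(\<lambda>\<omega>. h \<omega> + ?n \<omega>) = ?p" by (auto simp: fun_eq_iff max_def)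
      then have "E t ?p \<omega> \<le> E t h \<omega> + E t ?n \<omega>"
        using E_subadditive[OF h(1) n \<omega>, of t] by simp
      moreover have "0 \<le> E t ?p \<omega>" using p \<omega> by (intro E_nonneg) auto
      ultimately show "\<bar>E t ?p \<omega>\<bar> \<le> \<bar>E t h \<omega> - Y \<omega>\<bar> + \<bar>Y \<omega>\<bar> + \<bar>E t ?n \<omega>\<bar>" by linarith
    qed auto
    also have "L1_norm (E t ?n) = L1_norm ?n"
      using n by (intro L1_norm_E_nonneg) auto
    also have "L1_norm ?n \<le> L1_norm (\<lambda>\<omega>. h \<omega> - X \<omega>)"
      using pos by (intro L1_norm_mono) auto
    finally have "L1_norm X \<le> L1_norm (\<lambda>\<omega>. h \<omega> - X \<omega>)
        + (L1_norm (\<lambda>\<omega>. E t h \<omega> - Y \<omega>) + L1_norm Y + L1_norm (\<lambda>\<omega>. h \<omega> - X \<omega>))"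
      by (simp add: add_left_mono)
    also have "\<dots> \<le> ennreal (e/3) + (ennreal (e/3) + L1_norm Y + ennreal (e/3))"
      by (intro add_mono h order_refl)
    also have "\<dots> = L1_norm Y + (ennreal (e/3) + ennreal (e/3) + ennreal (e/3))"
      by (simp only: ac_simps)
    also have "ennreal (e/3) + ennreal (e/3) + ennreal (e/3) = ennreal e"
      using e by (simp flip: ennreal_plus)
    finally show "L1_norm X \<le> L1_norm Y + ennreal e" .
  qed
qed

text \<open>\<open>E t h\<close> is close to Y, hence to an approximant k of Y, and contraction of
  \<open>E s\<close> carries this to \<open>E s (E t h)\<close>, which is
  \<open>E s h\<close>.\<close>

lemma is_cond_exp_tower:
  assumes X: "is_cond_exp t X Y" and Y: "is_cond_exp s Y Z" and "s \<le> t"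
  shows "is_cond_exp s X Z"
  unfolding is_cond_exp_def
proof (intro conjI allI impI is_cond_exp_measurable[OF X] is_cond_exp_measurable[OF Y])
  note [measurable] = is_cond_exp_measurable[OF X] is_cond_exp_measurable[OF Y]
  fix e :: real assume e: "0 < e"
  obtain h where h: "h \<in> H" "L1_norm (\<lambda>\<omega>. h \<omega> - X \<omega>) \<le> ennreal (e/3)" "L1_norm (\<lambda>\<omega>. E t h \<omega> - Y \<omega>) \<le> ennreal (e/3)"
    by (rule is_cond_expE[OF X, of "e/3"]) (use e in auto)
  obtain k where k: "k \<in> H" "L1_norm (\<lambda>\<omega>. k \<omega> - Y \<omega>) \<le> ennreal (e/3)" "L1_norm (\<lambda>\<omega>. E s k \<omega> - Z \<omega>) \<le> ennreal (e/3)"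
    by (rule is_cond_expE[OF Y, of "e/3"]) (use e in auto)
  note [measurable] = H_measurableD[OF k(1)] E_M[OF h(1)] E_M[OF E_H[OF h(1)]] E_M[OF k(1)]
  have "L1_norm (\<lambda>\<omega>. E s (E t h) \<omega> - E s k \<omega>) \<le> L1_norm (\<lambda>\<omega>. E t h \<omega> - k \<omega>)"
    by (intro L1_norm_E_diff E_H h k)
  also have "\<dots> \<le> L1_norm (\<lambda>\<omega>. E t h \<omega> - Y \<omega>) + L1_norm (\<lambda>\<omega>. k \<omega> - Y \<omega>)"
    by (intro L1_norm_le2 AE_I2) auto
  also have "\<dots> \<le> ennreal (e/3) + ennreal (e/3)"
    by (intro add_mono h k)
  finally have "L1_norm (\<lambda>\<omega>. E s (E t h) \<omega> - E s k \<omega>) \<le> ennreal (e/3) + ennreal (e/3)" .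
  moreover have "L1_norm (\<lambda>\<omega>. E s h \<omega> - Z \<omega>) \<le> L1_norm (\<lambda>\<omega>. E s (E t h) \<omega> - E s k \<omega>) + L1_norm (\<lambda>\<omega>. E s k \<omega> - Z \<omega>)"
    using E_tower[OF h(1) \<open>s \<le> t\<close>] by (intro L1_norm_le2 AE_I2) auto
  ultimately have "L1_norm (\<lambda>\<omega>. E s h \<omega> - Z \<omega>) \<le> ennreal (e/3) + ennreal (e/3) + ennreal (e/3)"
    using k by (elim order_trans) (auto intro!: add_mono)
  also have "\<dots> = ennreal e" using e by (simp flip: ennreal_plus)
  finally show "\<exists>h\<in>H. L1_norm (\<lambda>\<omega>. h \<omega> - X \<omega>) \<le> ennreal e \<and> L1_norm (\<lambda>\<omega>. E s h \<omega> - Z \<omega>) \<le> ennreal e"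
    using h(1,2) e by (intro bexI[of _ h] conjI order_trans[OF h(2)] ennreal_leI) auto
qed

text \<open>Existence and uniqueness turn the tower property around. In this form it shows that the
  conditional expectations of one fixed function are a martingale.\<close>

lemma is_cond_exp_tower':
  assumes X: "is_cond_exp t X Y" and Z: "is_cond_exp s X Z" and "s \<le> t"
  shows "is_cond_exp s Y Z"
proof -
  obtain W where W: "is_cond_exp s Y W"
    using is_cond_exp_exists[OF is_cond_exp_L1_real(2)[OF X]] by blast
  have "AE \<omega> in qs_measure. W \<omega> = Z \<omega>"
    using is_cond_exp_unique[OF is_cond_exp_tower[OF X W \<open>s \<le> t\<close>] Z] .
  then show ?thesis
    using is_cond_exp_measurable[OF Z] is_cond_exp_measurable[OF W] by (intro is_cond_exp_cong_AE[OF W]) auto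
qed

text \<open>Locality stands in for linear decomposition: pasting along a set known at time t
  commutes with conditioning. Stopping and trading are both expressed through it.\<close>

lemma is_cond_exp_if:
  assumes X: "is_cond_exp t X Y" and X': "is_cond_exp t X' Y'" and A: "A \<in> sets (F t)"
  shows "is_cond_exp t (\<lambda>\<omega>. if \<omega> \<in> A then X \<omega> else X' \<omega>) (\<lambda>\<omega>. if \<omega> \<in> A then Y \<omega> else Y' \<omega>)"
  unfolding is_cond_exp_def
proof (intro conjI allI impI)
  note [measurable] = is_cond_exp_measurable[OF X] is_cond_exp_measurable[OF X']
  have AM [measurable]: "A \<in> sets M" using A sets_F_subset by auto
  note [measurable] = A
  show "(\<lambda>\<omega>. if \<omega> \<in> A then X \<omega> else X' \<omega>) \<in> borel_measurable M" by measurable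
  show "(\<lambda>\<omega>. if \<omega> \<in> A then Y \<omega> else Y' \<omega>) \<in> borel_measurable (F t)" by measurable
  fix e :: real assume e: "0 < e"
  obtain h where h: "h \<in> H" "L1_norm (\<lambda>\<omega>. h \<omega> - X \<omega>) \<le> ennreal (e/2)" "L1_norm (\<lambda>\<omega>. E t h \<omega> - Y \<omega>) \<le> ennreal (e/2)"
    by (rule is_cond_expE[OF X, of "e/2"]) (use e in auto)
  obtain k where k: "k \<in> H" "L1_norm (\<lambda>\<omega>. k \<omega> - X' \<omega>) \<le> ennreal (e/2)" "L1_norm (\<lambda>\<omega>. E t k \<omega> - Y' \<omega>) \<le> ennreal (e/2)"
    by (rule is_cond_expE[OF X', of "e/2"]) (use e in auto)
  note [measurable] = H_measurableD[OF h(1)] E_M[OF h(1)] H_measurableD[OF k(1)] E_M[OF k(1)]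
  let ?g = "\<lambda>\<omega>. indicator A \<omega> * h \<omega> + indicator (space M - A) \<omega> * k \<omega>"
  have g: "?g \<in> H" using h k by (intro H_add H_indicator) auto
  have cA: "space M - A \<in> sets (F t)" using A space_F by (metis sets.compl_sets)
  \<comment> \<open>\<open>?g\<close> and h have the same product with the indicator of
    \<open>A\<close>, so locality identifies their conditional expectations on \<open>A\<close>;
    likewise \<open>?g\<close> and k on the complement.\<close>
  have Eg: "E t ?g \<omega> = (if \<omega> \<in> A then E t h \<omega> else E t k \<omega>)" if \<omega>: "\<omega> \<in> space M" for \<omega>
  proof (cases "\<omega> \<in> A")
    case True
    have "(\<lambda>\<omega>. indicator A \<omega> * ?g \<omega>) = (\<lambda>\<omega>. indicator A \<omega> * h \<omega>)"
      by (auto simp: fun_eq_iff indicator_def)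
    then show ?thesis
      using E_indicator[OF g A \<omega>] E_indicator[OF h(1) A \<omega>] True by simp
  next
    case False
    have "(\<lambda>\<omega>. indicator (space M - A) \<omega> * ?g \<omega>) = (\<lambda>\<omega>. indicator (space M - A) \<omega> * k \<omega>)"
      by (auto simp: fun_eq_iff indicator_def)
    then show ?thesis
      using E_indicator[OF g cA \<omega>] E_indicator[OF k(1) cA \<omega>] False \<omega> by simp
  qed
  have e2: "ennreal (e/2) + ennreal (e/2) = ennreal e" using e by (simp flip: ennreal_plus)
  have "L1_norm (\<lambda>\<omega>. ?g \<omega> - (if \<omega> \<in> A then X \<omega> else X' \<omega>)) \<le> L1_norm (\<lambda>\<omega>. h \<omega> - X \<omega>) + L1_norm (\<lambda>\<omega>. k \<omega> - X' \<omega>)"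
    by (intro L1_norm_le2 AE_I2) auto
  also have "\<dots> \<le> ennreal e" unfolding e2[symmetric] by (intro add_mono h k)
  moreover have "L1_norm (\<lambda>\<omega>. E t ?g \<omega> - (if \<omega> \<in> A then Y \<omega> else Y' \<omega>)) \<le> L1_norm (\<lambda>\<omega>. E t h \<omega> - Y \<omega>) + L1_norm (\<lambda>\<omega>. E t k \<omega> - Y' \<omega>)"
    by (intro L1_norm_le2 AE_I2) (auto simp: Eg)
  moreover have "\<dots> \<le> ennreal e" unfolding e2[symmetric] by (intro add_mono h k)
  ultimately show "\<exists>h\<in>H. L1_norm (\<lambda>\<omega>. h \<omega> - (if \<omega> \<in> A then X \<omega> else X' \<omega>)) \<le> ennreal e \<and>
      L1_norm (\<lambda>\<omega>. E t h \<omega> - (if \<omega> \<in> A then Y \<omega> else Y' \<omega>)) \<le> ennreal e"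
    using g by (meson order_trans)
qed

text \<open>Approximants provided by membership in \<open>L1_real\<close> need not be
  \<open>F t\<close>-measurable. Simple functions below the positive and the negative part can be
  chosen so, and |X| itself dominates their error.\<close>

lemma L1_real_F_approx:
  assumes X: "X \<in> L1_real" "X \<in> borel_measurable (F t)" and e: "0 < (e::real)"
  obtains h where "h \<in> H" "h \<in> borel_measurable (F t)" "L1_norm (\<lambda>\<omega>. h \<omega> - X \<omega>) \<le> ennreal e"
proof -
  note [measurable] = L1_real_measurable[OF X(1)] X(2)
  \<comment> \<open>\<open>ennreal\<close> sends negative reals to 0, so p increases to the positive
    part of X; q does the same for the negative part.\<close>
  obtain p where p: "\<And>n. p n \<in> H" "\<And>n. p n \<in> borel_measurable (F t)"
    "\<And>n \<omega>. \<omega> \<in> space M \<Longrightarrow> 0 \<le> p n \<omega>"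
    "\<And>\<omega>. \<omega> \<in> space M \<Longrightarrow> incseq (\<lambda>n. ennreal (p n \<omega>))"
    "\<And>\<omega>. \<omega> \<in> space M \<Longrightarrow> (SUP n. ennreal (p n \<omega>)) = ennreal (X \<omega>)"
    by (rule ennreal_approx_H[of "\<lambda>\<omega>. ennreal (X \<omega>)" "F t"]) (auto simp: space_F sets_F_subset)
  obtain q where q: "\<And>n. q n \<in> H" "\<And>n. q n \<in> borel_measurable (F t)"
    "\<And>n \<omega>. \<omega> \<in> space M \<Longrightarrow> 0 \<le> q n \<omega>"
    "\<And>\<omega>. \<omega> \<in> space M \<Longrightarrow> incseq (\<lambda>n. ennreal (q n \<omega>))"
    "\<And>\<omega>. \<omega> \<in> space M \<Longrightarrow> (SUP n. ennreal (q n \<omega>)) = ennreal (- X \<omega>)"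
    by (rule ennreal_approx_H[of "\<lambda>\<omega>. ennreal (- X \<omega>)" "F t"]) (auto simp: space_F sets_F_subset)
  have lim: "(\<lambda>n. f n) \<longlonglongrightarrow> max x 0" "\<And>n. f n \<le> max x 0"
    if f: "\<And>n. 0 \<le> f n" "incseq (\<lambda>n. ennreal (f n))" "(SUP n. ennreal (f n)) = ennreal x" for f :: "nat \<Rightarrow> real" and x
  proof -
    have m: "ennreal x = ennreal (max x 0)" by (simp add: max_def ennreal_neg)
    show "f n \<le> max x 0" for n
    proof -
      have "ennreal (f n) \<le> ennreal (max x 0)"
        unfolding m[symmetric] f(3)[symmetric] by (rule SUP_upper) simp
      then show ?thesis by (subst (asm) ennreal_le_iff) auto
    qed
    show "f \<longlonglongrightarrow> max x 0"
      using LIMSEQ_SUP[OF f(2)] unfolding f(3) m by (subst (asm) tendsto_ennreal_iff) (auto simp: f(1))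
  qed
  have [measurable]: "p n \<in> borel_measurable M" "q n \<in> borel_measurable M" for n
    using p q H_measurableD by auto
  have "\<forall>\<^sub>F n in sequentially. L1_norm (\<lambda>\<omega>. (p n \<omega> - q n \<omega>) - X \<omega>) \<le> ennreal e"
  proof (rule L1_dominated_convergence[OF X(1)])
    fix n show "AE \<omega> in qs_measure. \<bar>(p n \<omega> - q n \<omega>) - X \<omega>\<bar> \<le> \<bar>X \<omega>\<bar>"
    proof (rule AE_I2)
      fix \<omega> assume "\<omega> \<in> space qs_measure"
      then have "p n \<omega> \<le> max (X \<omega>) 0" "q n \<omega> \<le> max (- X \<omega>) 0" "0 \<le> p n \<omega>" "0 \<le> q n \<omega>"
        using lim(2)[OF p(3-5)] lim(2)[OF q(3-5)] p(3) q(3) by auto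
      then show "\<bar>(p n \<omega> - q n \<omega>) - X \<omega>\<bar> \<le> \<bar>X \<omega>\<bar>" by (auto simp: max_def split: if_splits)
    qed
  next
    show "AE \<omega> in qs_measure. (\<lambda>n. (p n \<omega> - q n \<omega>) - X \<omega>) \<longlonglongrightarrow> 0"
    proof (rule AE_I2)
      fix \<omega> assume "\<omega> \<in> space qs_measure"
      then have "(\<lambda>n. (p n \<omega> - q n \<omega>) - X \<omega>) \<longlonglongrightarrow> (max (X \<omega>) 0 - max (- X \<omega>) 0) - X \<omega>"
        using lim(1)[OF p(3-5)] lim(1)[OF q(3-5)] by (intro tendsto_intros) auto
      then show "(\<lambda>n. (p n \<omega> - q n \<omega>) - X \<omega>) \<longlonglongrightarrow> 0" by (simp add: max_def split: if_splits)
    qed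
  qed (use e in auto)
  then obtain n where n: "L1_norm (\<lambda>\<omega>. (p n \<omega> - q n \<omega>) - X \<omega>) \<le> ennreal e"
    by (auto simp: eventually_sequentially)
  show ?thesis
    by (rule that[of "\<lambda>\<omega>. p n \<omega> - q n \<omega>"]) (use n p q in \<open>auto intro: H_diff\<close>)
qed

text \<open>The translation rule on \<open>H\<close> passes to L^1 because W has approximants in
  \<open>H\<close> that are themselves \<open>F t\<close>-measurable.\<close>

lemma is_cond_exp_translate:
  assumes X: "is_cond_exp t X Y" and W: "W \<in> L1_real" "W \<in> borel_measurable (F t)"
  shows "is_cond_exp t (\<lambda>\<omega>. X \<omega> + W \<omega>) (\<lambda>\<omega>. Y \<omega> + W \<omega>)"
  unfolding is_cond_exp_def
proof (intro conjI allI impI)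
  note [measurable] = is_cond_exp_measurable[OF X] L1_real_measurable[OF W(1)] W(2)
  show "(\<lambda>\<omega>. X \<omega> + W \<omega>) \<in> borel_measurable M" "(\<lambda>\<omega>. Y \<omega> + W \<omega>) \<in> borel_measurable (F t)" by measurable
  fix e :: real assume e: "0 < e"
  obtain h where h: "h \<in> H" "L1_norm (\<lambda>\<omega>. h \<omega> - X \<omega>) \<le> ennreal (e/2)" "L1_norm (\<lambda>\<omega>. E t h \<omega> - Y \<omega>) \<le> ennreal (e/2)"
    by (rule is_cond_expE[OF X, of "e/2"]) (use e in auto)
  obtain w where w: "w \<in> H" "w \<in> borel_measurable (F t)" "L1_norm (\<lambda>\<omega>. w \<omega> - W \<omega>) \<le> ennreal (e/2)"
    by (rule L1_real_F_approx[OF W, of "e/2"]) (use e in auto)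
  note [measurable] = H_measurableD[OF h(1)] E_M[OF h(1)] H_measurableD[OF w(1)]
  have e2: "ennreal (e/2) + ennreal (e/2) = ennreal e" using e by (simp flip: ennreal_plus)
  have "L1_norm (\<lambda>\<omega>. h \<omega> + w \<omega> - (X \<omega> + W \<omega>)) \<le> L1_norm (\<lambda>\<omega>. h \<omega> - X \<omega>) + L1_norm (\<lambda>\<omega>. w \<omega> - W \<omega>)"
    by (intro L1_norm_le2 AE_I2) auto
  also have "\<dots> \<le> ennreal e" unfolding e2[symmetric] by (intro add_mono h w)
  moreover have "L1_norm (\<lambda>\<omega>. E t (\<lambda>\<omega>. h \<omega> + w \<omega>) \<omega> - (Y \<omega> + W \<omega>)) \<le> L1_norm (\<lambda>\<omega>. E t h \<omega> - Y \<omega>) + L1_norm (\<lambda>\<omega>. w \<omega> - W \<omega>)"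
    using E_translate[OF h(1) w(1,2)] by (intro L1_norm_le2 AE_I2) auto
  moreover have "\<dots> \<le> ennreal e" unfolding e2[symmetric] by (intro add_mono h w)
  ultimately show "\<exists>h\<in>H. L1_norm (\<lambda>\<omega>. h \<omega> - (X \<omega> + W \<omega>)) \<le> ennreal e \<and> L1_norm (\<lambda>\<omega>. E t h \<omega> - (Y \<omega> + W \<omega>)) \<le> ennreal e"
    using H_add[OF h(1) w(1)] by (meson order_trans)
qed

lemma is_cond_exp_self:
  assumes "X \<in> L1_real" "X \<in> borel_measurable (F t)"
  shows "is_cond_exp t X X"
  using is_cond_exp_translate[OF is_cond_exp_const[of t 0] assms] by simp

lemma L1_real_excess:
  assumes "X \<in> L1_real" shows "(\<lambda>\<omega>. max (\<bar>X \<omega>\<bar> - c) 0) \<in> L1_real"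
  unfolding L1_real_def
proof safe
  note [measurable] = L1_real_measurable[OF assms]
  show "(\<lambda>\<omega>. max (\<bar>X \<omega>\<bar> - c) 0) \<in> borel_measurable M" by measurable
  fix e :: real assume "0 < e"
  with assms obtain h where h: "h \<in> H" "L1_norm (\<lambda>\<omega>. h \<omega> - X \<omega>) \<le> ennreal e"
    by (rule L1_realE)
  note [measurable] = H_measurableD[OF h(1)]
  have "L1_norm (\<lambda>\<omega>. max (\<bar>h \<omega>\<bar> - c) 0 - max (\<bar>X \<omega>\<bar> - c) 0) \<le> L1_norm (\<lambda>\<omega>. h \<omega> - X \<omega>)"
    by (intro L1_norm_mono AE_I2) auto
  then show "\<exists>h\<in>H. L1_norm (\<lambda>\<omega>. h \<omega> - max (\<bar>X \<omega>\<bar> - c) 0) \<le> ennreal e"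
    using h by (intro bexI[of _ "\<lambda>\<omega>. max (\<bar>h \<omega>\<bar> - c) 0"] H_pos_part H_diff H_abs H_const) auto
qed

text \<open>Jensen for this one convex function: on \<open>H\<close> it is |E_t(h)| \<le> E_t(|h|),
  followed by translation by -c, monotonicity and positivity.\<close>

lemma is_cond_exp_excess:
  assumes X: "is_cond_exp t X Y" and X': "is_cond_exp t (\<lambda>\<omega>. max (\<bar>X \<omega>\<bar> - c) 0) Y'"
  shows "AE \<omega> in qs_measure. max (\<bar>Y \<omega>\<bar> - c) 0 \<le> Y' \<omega>"
proof -
  note [measurable] = is_cond_exp_measurable[OF X] is_cond_exp_measurable[OF X']
  have "AE \<omega> in qs_measure. max (max (\<bar>Y \<omega>\<bar> - c) 0 - Y' \<omega>) 0 = 0"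
  proof (rule L1_norm_eps_AE)
    fix e :: real assume e: "0 < e"
    obtain h where h: "h \<in> H" "L1_norm (\<lambda>\<omega>. h \<omega> - X \<omega>) \<le> ennreal (e/4)" "L1_norm (\<lambda>\<omega>. E t h \<omega> - Y \<omega>) \<le> ennreal (e/4)"
      by (rule is_cond_expE[OF X, of "e/4"]) (use e in auto)
    obtain k where k: "k \<in> H" "L1_norm (\<lambda>\<omega>. k \<omega> - max (\<bar>X \<omega>\<bar> - c) 0) \<le> ennreal (e/4)" "L1_norm (\<lambda>\<omega>. E t k \<omega> - Y' \<omega>) \<le> ennreal (e/4)"
      by (rule is_cond_expE[OF X', of "e/4"]) (use e in auto)
    let ?g = "\<lambda>\<omega>. max (\<bar>h \<omega>\<bar> - c) 0"
    have g: "?g \<in> H" using h(1) by (intro H_pos_part H_diff H_abs H_const)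
    note [measurable] = H_measurableD[OF h(1)] E_M[OF h(1)] H_measurableD[OF k(1)] E_M[OF k(1)] E_M[OF g]
    have "L1_norm (\<lambda>\<omega>. max (max (\<bar>Y \<omega>\<bar> - c) 0 - Y' \<omega>) 0)
      \<le> L1_norm (\<lambda>\<omega>. E t h \<omega> - Y \<omega>) + L1_norm (\<lambda>\<omega>. E t k \<omega> - Y' \<omega>) + L1_norm (\<lambda>\<omega>. E t ?g \<omega> - E t k \<omega>)"
    proof (intro L1_norm_le3 AE_I2)
      fix \<omega> assume "\<omega> \<in> space qs_measure"
      then have \<omega>: "\<omega> \<in> space M" by simp
      have c: "(\<lambda>_. c) \<in> H" "(\<lambda>_. - c) \<in> H" by (rule H_const)+
      have "\<bar>E t h \<omega>\<bar> \<le> E t (\<lambda>\<omega>. \<bar>h \<omega>\<bar>) \<omega>"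
        using E_abs_diff_le[OF h(1) H_const[of 0] \<omega>, of t] \<omega> by (simp add: E_const)
      moreover have "E t (\<lambda>\<omega>. \<bar>h \<omega>\<bar> + - c) \<omega> = E t (\<lambda>\<omega>. \<bar>h \<omega>\<bar>) \<omega> + - c"
        using h(1) c \<omega> by (intro E_translate H_abs) auto
      moreover have "E t (\<lambda>\<omega>. \<bar>h \<omega>\<bar> + - c) \<omega> \<le> E t ?g \<omega>"
        using h(1) g c \<omega> by (intro E_mono H_add H_abs) auto
      moreover have "0 \<le> E t ?g \<omega>" using g \<omega> by (intro E_nonneg) auto
      ultimately show "\<bar>max (max (\<bar>Y \<omega>\<bar> - c) 0 - Y' \<omega>) 0\<bar> \<le> \<bar>E t h \<omega> - Y \<omega>\<bar> + \<bar>E t k \<omega> - Y' \<omega>\<bar> + \<bar>E t ?g \<omega> - E t k \<omega>\<bar>"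
        by simp
    qed auto
    also have "L1_norm (\<lambda>\<omega>. E t ?g \<omega> - E t k \<omega>) \<le> L1_norm (\<lambda>\<omega>. ?g \<omega> - k \<omega>)"
      by (intro L1_norm_E_diff g k)
    also have "L1_norm (\<lambda>\<omega>. ?g \<omega> - k \<omega>) \<le> L1_norm (\<lambda>\<omega>. h \<omega> - X \<omega>) + L1_norm (\<lambda>\<omega>. k \<omega> - max (\<bar>X \<omega>\<bar> - c) 0)"
      by (intro L1_norm_le2 AE_I2) auto
    finally have "L1_norm (\<lambda>\<omega>. max (max (\<bar>Y \<omega>\<bar> - c) 0 - Y' \<omega>) 0)
        \<le> L1_norm (\<lambda>\<omega>. E t h \<omega> - Y \<omega>) + L1_norm (\<lambda>\<omega>. E t k \<omega> - Y' \<omega>) +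
          (L1_norm (\<lambda>\<omega>. h \<omega> - X \<omega>) + L1_norm (\<lambda>\<omega>. k \<omega> - max (\<bar>X \<omega>\<bar> - c) 0))"
      by (simp add: add_left_mono)
    also have "\<dots> \<le> ennreal (e/4) + ennreal (e/4) + (ennreal (e/4) + ennreal (e/4))"
      by (intro add_mono h k)
    also have "\<dots> = ennreal e" using e by (simp flip: ennreal_plus)
    finally show "L1_norm (\<lambda>\<omega>. max (max (\<bar>Y \<omega>\<bar> - c) 0 - Y' \<omega>) 0) \<le> ennreal e" .
  qed simp
  then show ?thesis by eventually_elim linarith
qed

section \<open>Martingales and stopping\<close>

lemma L1_real_diff:
  assumes "X \<in> L1_real" "Y \<in> L1_real" shows "(\<lambda>\<omega>. X \<omega> - Y \<omega>) \<in> L1_real"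
  unfolding L1_real_def
proof safe
  note [measurable] = L1_real_measurable[OF assms(1)] L1_real_measurable[OF assms(2)]
  show "(\<lambda>\<omega>. X \<omega> - Y \<omega>) \<in> borel_measurable M" by measurable
  fix e :: real assume e: "0 < e"
  obtain h where h: "h \<in> H" "L1_norm (\<lambda>\<omega>. h \<omega> - X \<omega>) \<le> ennreal (e/2)"
    by (rule L1_realE[OF assms(1), of "e/2"]) (use e in auto)
  obtain k where k: "k \<in> H" "L1_norm (\<lambda>\<omega>. k \<omega> - Y \<omega>) \<le> ennreal (e/2)"
    by (rule L1_realE[OF assms(2), of "e/2"]) (use e in auto)
  note [measurable] = H_measurableD[OF h(1)] H_measurableD[OF k(1)]
  have "L1_norm (\<lambda>\<omega>. h \<omega> - k \<omega> - (X \<omega> - Y \<omega>)) \<le> L1_norm (\<lambda>\<omega>. h \<omega> - X \<omega>) + L1_norm (\<lambda>\<omega>. k \<omega> - Y \<omega>)"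
    by (intro L1_norm_le2 AE_I2) auto
  also have "\<dots> \<le> ennreal (e/2) + ennreal (e/2)" by (intro add_mono h k)
  also have "\<dots> = ennreal e" using e by (simp flip: ennreal_plus)
  finally show "\<exists>h\<in>H. L1_norm (\<lambda>\<omega>. h \<omega> - (X \<omega> - Y \<omega>)) \<le> ennreal e"
    using H_diff[OF h(1) k(1)] by (rule bexI)
qed

lemma simple_function_L1_real:
  assumes "simple_function M f" shows "f \<in> L1_real"
proof -
  obtain h where h: "h \<in> H" "\<And>\<omega>. \<omega> \<in> space M \<Longrightarrow> h \<omega> = f \<omega>"
    using simple_function_H[OF assms] by auto
  have "L1_norm (\<lambda>\<omega>. h \<omega> - f \<omega>) = 0"
    using h(2) by (intro L1_norm_AE_0 AE_I2) auto
  then show ?thesis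
    using h(1) borel_measurable_simple_function[OF assms] by (auto simp: L1_real_def intro!: bexI[of _ h])
qed

text \<open>The excess over c replaces the indicator form of the tail: convexity makes it accessible
  to Jensen, and continuity lets it pass to limits by Fatou.\<close>

definition uniformly_integrable :: "(nat \<Rightarrow> 'a \<Rightarrow> real) \<Rightarrow> bool" where
  "uniformly_integrable x \<longleftrightarrow> (\<forall>e>0. \<exists>c\<ge>0. \<forall>n. L1_norm (\<lambda>\<omega>. max (\<bar>x n \<omega>\<bar> - c) 0) \<le> ennreal e)"

text \<open>Vitali's argument: the tails beyond c are uniformly small, and the clipped parts are
  bounded, so that dominated convergence applies to them.\<close>

lemma uniformly_integrable_L1_convergence:
  assumes x [measurable]: "\<And>n. x n \<in> borel_measurable M" and ui: "uniformly_integrable x"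
    and y [measurable]: "y \<in> borel_measurable M"
    and lim: "AE \<omega> in qs_measure. (\<lambda>n. x n \<omega>) \<longlonglongrightarrow> y \<omega>" and e: "0 < (e::real)"
  shows "\<forall>\<^sub>F n in sequentially. L1_norm (\<lambda>\<omega>. x n \<omega> - y \<omega>) \<le> ennreal e"
proof -
  obtain c where c: "0 \<le> c" "\<And>n. L1_norm (\<lambda>\<omega>. max (\<bar>x n \<omega>\<bar> - c) 0) \<le> ennreal (e/3)"
    using ui e unfolding uniformly_integrable_def by (metis zero_less_divide_iff zero_less_numeral)
  have yc: "L1_norm (\<lambda>\<omega>. max (\<bar>y \<omega>\<bar> - c) 0) \<le> ennreal (e/3)"
  proof (rule L1_norm_Fatou[of "\<lambda>n \<omega>. max (\<bar>x n \<omega>\<bar> - c) 0"])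
    show "AE \<omega> in qs_measure. (\<lambda>n. max (\<bar>x n \<omega>\<bar> - c) 0) \<longlonglongrightarrow> max (\<bar>y \<omega>\<bar> - c) 0"
      using lim by eventually_elim (intro tendsto_intros)
  qed (use c in auto)
  \<comment> \<open>|x n - y| is at most the sum of the two excesses and this clipped difference,
    which is dominated by the constant 2 c, a member of \<open>H\<close>.\<close>
  let ?d = "\<lambda>n \<omega>. max (- c) (min c (x n \<omega>)) - max (- c) (min c (y \<omega>))"
  have "\<forall>\<^sub>F n in sequentially. L1_norm (?d n) \<le> ennreal (e/3)"
  proof (rule L1_dominated_convergence[OF H_L1_real[OF H_const[of "2 * c"]]])
    show "AE \<omega> in qs_measure. \<bar>?d n \<omega>\<bar> \<le> \<bar>2 * c\<bar>" for n
      using c(1) by (intro AE_I2) linarith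
    show "AE \<omega> in qs_measure. (\<lambda>n. ?d n \<omega>) \<longlonglongrightarrow> 0"
      using lim
    proof eventually_elim
      case (elim \<omega>)
      then have "(\<lambda>n. ?d n \<omega>) \<longlonglongrightarrow> max (- c) (min c (y \<omega>)) - max (- c) (min c (y \<omega>))"
        by (intro tendsto_intros)
      then show ?case by simp
    qed
  qed (use e in auto)
  then show ?thesis
  proof eventually_elim
    case (elim n)
    have "L1_norm (\<lambda>\<omega>. x n \<omega> - y \<omega>) \<le> L1_norm (\<lambda>\<omega>. max (\<bar>x n \<omega>\<bar> - c) 0) + L1_norm (\<lambda>\<omega>. max (\<bar>y \<omega>\<bar> - c) 0) + L1_norm (?d n)"
      using c(1) by (intro L1_norm_le3 AE_I2) (auto simp del: max.bounded_iff, linarith)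
    also have "\<dots> \<le> ennreal (e/3) + ennreal (e/3) + ennreal (e/3)"
      by (intro add_mono c yc elim)
    also have "\<dots> = ennreal e" using e by (simp flip: ennreal_plus)
    finally show ?case .
  qed
qed

lemma uniformly_integrable_bounded:
  assumes x [measurable]: "\<And>n. x n \<in> borel_measurable M" and ui: "uniformly_integrable x"
  obtains B where "0 \<le> B" "\<And>n. L1_norm (x n) \<le> ennreal B"
proof -
  obtain c where c: "0 \<le> c" "\<And>n. L1_norm (\<lambda>\<omega>. max (\<bar>x n \<omega>\<bar> - c) 0) \<le> ennreal 1"
    using ui unfolding uniformly_integrable_def by (metis zero_less_one)
  have "L1_norm (x n) \<le> ennreal (c + 1)" for n
  proof -
    have "L1_norm (x n) \<le> L1_norm (\<lambda>_. c) + L1_norm (\<lambda>\<omega>. max (\<bar>x n \<omega>\<bar> - c) 0)"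
      using c(1) by (intro L1_norm_le2 AE_I2) auto
    also have "\<dots> \<le> ennreal c + ennreal 1"
      using c by (intro add_mono) (auto simp: L1_norm_const)
    finally show ?thesis using c(1) by simp
  qed
  then show ?thesis using c(1) by (intro that[of "c + 1"]) auto
qed

section \<open>Real-valued martingales and their stopped processes\<close>

definition martingale :: "(nat \<Rightarrow> 'a \<Rightarrow> real) \<Rightarrow> bool" where
  "martingale x \<longleftrightarrow> (\<forall>s t. s \<le> t \<longrightarrow> is_cond_exp s (x t) (x s))"

lemma martingaleD: "martingale x \<Longrightarrow> s \<le> t \<Longrightarrow> is_cond_exp s (x t) (x s)"
  by (simp add: martingale_def)

lemma martingaleI:
  assumes step: "\<And>n. is_cond_exp n (x (Suc n)) (x n)" shows "martingale x"
  unfolding martingale_def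
proof (intro allI impI)
  fix s t :: nat assume "s \<le> t"
  then show "is_cond_exp s (x t) (x s)"
  proof (induction t rule: dec_induct)
    case base
    show ?case using step[of s] by (intro is_cond_exp_self is_cond_exp_L1_real is_cond_exp_measurable)
  next
    case (step t)
    then show ?case using is_cond_exp_tower[OF assms, of s t] by simp
  qed
qed

lemma martingale_L1_real: "martingale x \<Longrightarrow> x n \<in> L1_real"
  and martingale_F: "martingale x \<Longrightarrow> x n \<in> borel_measurable (F n)"
  and martingale_M: "martingale x \<Longrightarrow> x n \<in> borel_measurable M"
  using martingaleD[of x n n] by (auto dest: is_cond_exp_L1_real is_cond_exp_measurable)

text \<open>For n \<ge> t the pairs (\<open>x n\<close>, \<open>x t\<close>) belong to the relation;
  the second component is fixed and the first converges to y in norm.\<close>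

lemma martingale_closed:
  assumes x: "martingale x" and ui: "uniformly_integrable x" and y: "y \<in> borel_measurable M"
    and lim: "AE \<omega> in qs_measure. (\<lambda>n. x n \<omega>) \<longlonglongrightarrow> y \<omega>"
  shows "is_cond_exp t y (x t)"
proof (rule is_cond_exp_closed[OF y martingale_F[OF x]])
  fix e :: real assume "0 < e"
  then have "\<forall>\<^sub>F n in sequentially. L1_norm (\<lambda>\<omega>. x n \<omega> - y \<omega>) \<le> ennreal e"
    by (intro uniformly_integrable_L1_convergence martingale_M x ui y lim)
  then have "\<forall>\<^sub>F n in sequentially. t \<le> n \<and> L1_norm (\<lambda>\<omega>. x n \<omega> - y \<omega>) \<le> ennreal e"
    using eventually_ge_at_top[of t] by eventually_elim simp
  then obtain n where "t \<le> n" "L1_norm (\<lambda>\<omega>. x n \<omega> - y \<omega>) \<le> ennreal e"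
    by (auto simp: eventually_sequentially)
  then show "\<exists>X' Y'. is_cond_exp t X' Y' \<and> L1_norm (\<lambda>\<omega>. X' \<omega> - y \<omega>) \<le> ennreal e \<and> L1_norm (\<lambda>\<omega>. Y' \<omega> - x t \<omega>) \<le> ennreal e"
    using martingaleD[OF x] by (intro exI[of _ "x n"] exI[of _ "x t"]) (simp add: L1_norm_const)
qed

text \<open>The minimum with n is finite, so \<open>the_enat\<close> is never applied to
  \<infinity>.\<close>

definition stopped :: "('a \<Rightarrow> enat) \<Rightarrow> (nat \<Rightarrow> 'a \<Rightarrow> real) \<Rightarrow> nat \<Rightarrow> 'a \<Rightarrow> real" where
  "stopped T x n \<omega> = x (the_enat (min (T \<omega>) (enat n))) \<omega>"

lemma stopped_ge: "enat n \<le> T \<omega> \<Longrightarrow> stopped T x n \<omega> = x n \<omega>"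
  by (simp add: stopped_def min_def)

text \<open>The case distinction is T \<le> n, not T \<le> n + 1: this event is known at time n, so
  the step to n + 1 can be pasted there.\<close>

lemma stopped_Suc: "stopped T x (Suc n) \<omega> = (if T \<omega> \<le> enat n then stopped T x n \<omega> else x (Suc n) \<omega>)"
proof (cases "T \<omega> \<le> enat n")
  case True
  then have "T \<omega> \<le> enat (Suc n)" by (rule order_trans) simp
  with True show ?thesis by (simp add: stopped_def min_absorb1)
next
  case False
  then have "enat (Suc n) \<le> T \<omega>" by (simp add: not_le ileI1 flip: eSuc_enat)
  with False show ?thesis by (simp add: stopped_ge)
qed

text \<open>One index serves both processes, so a comparison at all fixed times up to n carries over
  to the stopped processes.\<close>

lemma stopped_le_ex: "\<exists>k\<le>n. stopped T x n \<omega> = x k \<omega> \<and> stopped T z n \<omega> = z k \<omega>"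
proof -
  have "the_enat (min (T \<omega>) (enat n)) \<le> n"
    by (cases "T \<omega>") auto
  then show ?thesis by (auto simp: stopped_def)
qed

text \<open>On {T \<le> n} the value is frozen and known at time n; elsewhere the step is that of x,
  and the stopped process still equals \<open>x n\<close> there.\<close>

lemma martingale_stopped:
  assumes T: "\<And>n. {\<omega>\<in>space M. T \<omega> \<le> enat n} \<in> sets (F n)" and x: "martingale x"
  shows "martingale (stopped T x)"
proof (rule martingaleI)
  have cong: "is_cond_exp t (stopped T x (Suc n)) V"
    if "is_cond_exp t (\<lambda>\<omega>. if \<omega> \<in> {\<omega>\<in>space M. T \<omega> \<le> enat n} then stopped T x n \<omega> else x (Suc n) \<omega>) U"
      "\<And>\<omega>. \<omega> \<in> space M \<Longrightarrow> U \<omega> = V \<omega>" for t n U V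
    using that(1)
  proof (rule is_cond_exp_cong_AE)
    note [measurable] = is_cond_exp_measurable[OF that(1)]
    show "stopped T x (Suc n) \<in> borel_measurable M"
      using is_cond_exp_measurable(1)[OF that(1)] by (rule measurable_cong[THEN iffD1, rotated]) (simp add: stopped_Suc)
    show "V \<in> borel_measurable (F t)"
      using is_cond_exp_measurable(2)[OF that(1)] by (rule measurable_cong[THEN iffD1, rotated]) (simp add: that space_F)
  qed (auto simp: stopped_Suc that intro!: AE_I2)
  have self: "is_cond_exp n (stopped T x n) (stopped T x n)" for n
  proof (induction n)
    case 0
    have "stopped T x 0 = x 0" by (simp add: fun_eq_iff stopped_ge flip: zero_enat_def)
    then show ?case using martingaleD[OF x] by simp
  next
    case (Suc n)
    have "is_cond_exp (Suc n) (stopped T x n) (stopped T x n)"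
      using is_cond_exp_measurable(2)[OF Suc] is_cond_exp_L1_real[OF Suc]
      by (intro is_cond_exp_self) (auto intro: measurable_F_mono[of n "Suc n"])
    moreover have "{\<omega>\<in>space M. T \<omega> \<le> enat n} \<in> sets (F (Suc n))"
      using T[of n] sets_F_mono[of n "Suc n"] by auto
    ultimately have "is_cond_exp (Suc n)
        (\<lambda>\<omega>. if \<omega> \<in> {\<omega>\<in>space M. T \<omega> \<le> enat n} then stopped T x n \<omega> else x (Suc n) \<omega>)
        (\<lambda>\<omega>. if \<omega> \<in> {\<omega>\<in>space M. T \<omega> \<le> enat n} then stopped T x n \<omega> else x (Suc n) \<omega>)"
      by (intro is_cond_exp_if martingaleD[OF x]) auto
    then show ?case by (rule cong) (simp add: stopped_Suc)
  qed
  show "is_cond_exp n (stopped T x (Suc n)) (stopped T x n)" for n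
  proof (rule cong)
    show "is_cond_exp n (\<lambda>\<omega>. if \<omega> \<in> {\<omega>\<in>space M. T \<omega> \<le> enat n} then stopped T x n \<omega> else x (Suc n) \<omega>)
        (\<lambda>\<omega>. if \<omega> \<in> {\<omega>\<in>space M. T \<omega> \<le> enat n} then stopped T x n \<omega> else x n \<omega>)"
      by (intro is_cond_exp_if self T martingaleD[OF x]) simp
  qed (auto simp: stopped_ge)
qed

text \<open>The level c serving x also serves the stopped process with the same e, since stopping
  leaves the norm of a nonnegative martingale unchanged.\<close>

lemma uniformly_integrable_stopped:
  assumes T: "\<And>n. {\<omega>\<in>space M. T \<omega> \<le> enat n} \<in> sets (F n)" and x: "martingale x"
    and ui: "uniformly_integrable x"
  shows "uniformly_integrable (stopped T x)"
  unfolding uniformly_integrable_def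
proof (intro allI impI)
  fix e :: real assume "0 < e"
  then obtain c where c: "0 \<le> c" "\<And>n. L1_norm (\<lambda>\<omega>. max (\<bar>x n \<omega>\<bar> - c) 0) \<le> ennreal e"
    using ui unfolding uniformly_integrable_def by metis
  have "L1_norm (\<lambda>\<omega>. max (\<bar>stopped T x n \<omega>\<bar> - c) 0) \<le> ennreal e" for n
  proof -
    let ?\<phi> = "\<lambda>\<omega>. max (\<bar>x n \<omega>\<bar> - c) 0"
    \<comment> \<open>With n fixed, z consists of the conditional expectations, at all times t, of
      the single excess at time n.\<close>
    have "\<exists>Z. is_cond_exp t ?\<phi> Z" for t
      using is_cond_exp_exists[OF L1_real_excess[OF martingale_L1_real[OF x]]] by metis
    then obtain z where z: "\<And>t. is_cond_exp t ?\<phi> (z t)" by metis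
    have zm: "martingale z"
      unfolding martingale_def using is_cond_exp_tower'[OF z z] by simp
    \<comment> \<open>The comparison is needed at a random index, so the exceptional sets of all
      fixed times are collected first.\<close>
    have "AE \<omega> in qs_measure. k \<le> n \<longrightarrow> max (\<bar>x k \<omega>\<bar> - c) 0 \<le> z k \<omega>" for k
      using is_cond_exp_excess[OF martingaleD[OF x] z, of k] by (cases "k \<le> n") auto
    then have "AE \<omega> in qs_measure. \<forall>k. k \<le> n \<longrightarrow> max (\<bar>x k \<omega>\<bar> - c) 0 \<le> z k \<omega>"
      by (simp add: AE_all_countable)
    then have le: "AE \<omega> in qs_measure. max (\<bar>stopped T x n \<omega>\<bar> - c) 0 \<le> stopped T z n \<omega>"
    proof eventually_elim
      case (elim \<omega>)
      then show ?case using stopped_le_ex[of n T x \<omega> z] by auto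
    qed
    have "L1_norm (\<lambda>\<omega>. max (\<bar>stopped T x n \<omega>\<bar> - c) 0) \<le> L1_norm (stopped T z n)"
      using le by (intro L1_norm_mono martingale_M martingale_stopped T zm) auto
    \<comment> \<open>The stopped z is nonnegative quasi-surely because it dominates an excess, so
      its norm at time n is its norm at time 0, where stopping has no effect.\<close>
    also have "\<dots> = L1_norm (stopped T z 0)"
    proof (rule is_cond_exp_L1_norm_eq[symmetric])
      show "is_cond_exp 0 (stopped T z n) (stopped T z 0)"
        by (intro martingaleD martingale_stopped T zm) simp
    qed (use le in auto)
    also have "stopped T z 0 = z 0" by (simp add: fun_eq_iff stopped_ge flip: zero_enat_def)
    also have "L1_norm (z 0) = L1_norm ?\<phi>"
      by (rule is_cond_exp_L1_norm_eq[OF z]) simp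
    also have "\<dots> \<le> ennreal e" by (rule c)
    finally show ?thesis .
  qed
  then show "\<exists>c\<ge>0. \<forall>n. L1_norm (\<lambda>\<omega>. max (\<bar>stopped T x n \<omega>\<bar> - c) 0) \<le> ennreal e"
    using c(1) by blast
qed

end

section \<open>Upcrossings and martingale convergence\<close>

text \<open>
  The strategy buys one unit as soon as the price is at most \<open>a\<close> and sells it as soon as the price
  is at least \<open>b\<close>; \<open>holding a b x n\<close> is the position after trading at time \<open>n\<close>.
\<close>

primrec holding :: "real \<Rightarrow> real \<Rightarrow> (nat \<Rightarrow> real) \<Rightarrow> nat \<Rightarrow> bool" where
  "holding a b x 0 = (x 0 \<le> a)"
| "holding a b x (Suc n) = (if holding a b x n then x (Suc n) < b else x (Suc n) \<le> a)"

text \<open>The new gain is grouped as \<open>x (Suc n)\<close> plus a term known at time n, the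
  form to which translation of conditional expectations applies.\<close>

primrec gain :: "real \<Rightarrow> real \<Rightarrow> (nat \<Rightarrow> real) \<Rightarrow> nat \<Rightarrow> real" where
  "gain a b x 0 = 0"
| "gain a b x (Suc n) = (if holding a b x n then x (Suc n) + (gain a b x n - x n) else gain a b x n)"

primrec upcrossings :: "real \<Rightarrow> real \<Rightarrow> (nat \<Rightarrow> real) \<Rightarrow> nat \<Rightarrow> nat" where
  "upcrossings a b x 0 = 0"
| "upcrossings a b x (Suc n) =
    (if holding a b x n \<and> \<not> holding a b x (Suc n) then Suc (upcrossings a b x n) else upcrossings a b x n)"

lemma upcrossings_le: "upcrossings a b x n \<le> n"
  by (induction n) (auto simp del: holding.simps)

lemma upcrossings_mono: "m \<le> n \<Longrightarrow> upcrossings a b x m \<le> upcrossings a b x n"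
  by (rule lift_Suc_mono_le) (auto simp del: holding.simps)

text \<open>Each completed upcrossing earns at least b - a, and an open position was bought at a
  price of at most a; the last term accounts for its current loss.\<close>

lemma upcrossings_gain:
  "(b - a) * real (upcrossings a b x n) \<le> gain a b x n + (if holding a b x n then a - x n else 0)"
  by (induction n) (auto simp: algebra_simps split: if_splits)

text \<open>From any stage on, a price at most a forces a purchase unless a position is already
  held, and a later price at least b forces a sale, so the count grows again.\<close>

lemma upcrossings_unbounded:
  assumes low: "\<exists>\<^sub>\<infinity>n. x n \<le> a" and high: "\<exists>\<^sub>\<infinity>n. b \<le> x n"
  shows "\<exists>n. N \<le> upcrossings a b x n"
proof (induction N)
  case (Suc N)
  then obtain n0 where n0: "N \<le> upcrossings a b x n0" by blast
  obtain n1 where n1: "n0 \<le> n1" "holding a b x n1"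
  proof -
    obtain k where k: "n0 < k" "x k \<le> a" using low by (auto simp: INFM_nat)
    then obtain j where j: "k = Suc j" "n0 \<le> j" by (cases k) auto
    show thesis
      using k j that[of j] that[of "Suc j"] by (cases "holding a b x j") auto
  qed
  obtain m where m: "n1 < m" "\<not> holding a b x m"
  proof -
    obtain k where k: "n1 < k" "b \<le> x k" using high by (auto simp: INFM_nat)
    then obtain j where j: "k = Suc j" "n1 \<le> j" by (cases k) auto
    show thesis
    proof (cases "holding a b x j")
      case True
      then show thesis using k j that[of "Suc j"] by auto
    next
      case False
      then show thesis using n1 j that[of j] by (cases "n1 = j") auto
    qed
  qed
  \<comment> \<open>The first time after n1 without a position: at its predecessor the position is
    still held, so the counter increases at l.\<close>
  define l where "l = (LEAST m. n1 < m \<and> \<not> holding a b x m)"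
  have l: "n1 < l" "\<not> holding a b x l"
    unfolding l_def using LeastI[of "\<lambda>m. n1 < m \<and> \<not> holding a b x m" m] m by auto
  then obtain j where j: "l = Suc j" "n1 \<le> j" by (cases l) auto
  have "holding a b x j"
    using not_less_Least[of j "\<lambda>m. n1 < m \<and> \<not> holding a b x m"] n1 j
    unfolding l_def[symmetric] by (cases "n1 = j") auto
  then have "upcrossings a b x l = Suc (upcrossings a b x j)"
    using l j by simp
  moreover have "N \<le> upcrossings a b x j"
    using n0 upcrossings_mono[of n0 j a b x] n1 j by simp
  ultimately show ?case by (intro exI[of _ l]) simp
qed simp

text \<open>If liminf < limsup, two rationals fit strictly between them and the sequence oscillates
  across the gap. Rational levels leave countably many conditions, whose exceptional sets can be
  united.\<close>

lemma ereal_convergent_if_no_oscillation: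
  fixes x :: "nat \<Rightarrow> real"
  assumes "\<And>a b. a \<in> \<rat> \<Longrightarrow> b \<in> \<rat> \<Longrightarrow> a < b \<Longrightarrow> \<not> ((\<exists>\<^sub>\<infinity>n. x n \<le> a) \<and> (\<exists>\<^sub>\<infinity>n. b \<le> x n))"
  shows "(\<lambda>n. ereal (x n)) \<longlonglongrightarrow> limsup (\<lambda>n. ereal (x n))"
proof -
  let ?x = "\<lambda>n. ereal (x n)"
  have "\<not> liminf ?x < limsup ?x"
  proof
    assume "liminf ?x < limsup ?x"
    then obtain p :: rat where p: "liminf ?x < real_of_rat p" "real_of_rat p < limsup ?x"
      using ereal_dense3 by blast
    then obtain q :: rat where q: "ereal (real_of_rat p) < real_of_rat q" "real_of_rat q < limsup ?x"
      using ereal_dense3 by blast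
    have "\<exists>\<^sub>\<infinity>n. x n \<le> real_of_rat p"
    proof (rule ccontr)
      assume "\<not> (\<exists>\<^sub>\<infinity>n. x n \<le> real_of_rat p)"
      then have "\<forall>\<^sub>F n in sequentially. ereal (real_of_rat p) \<le> ?x n"
        by (simp add: frequently_def cofinite_eq_sequentially not_le) (auto elim: eventually_mono)
      then have "ereal (real_of_rat p) \<le> liminf ?x" by (rule Liminf_bounded)
      then show False using p by simp
    qed
    moreover have "\<exists>\<^sub>\<infinity>n. real_of_rat q \<le> x n"
    proof (rule ccontr)
      assume "\<not> (\<exists>\<^sub>\<infinity>n. real_of_rat q \<le> x n)"
      then have "\<forall>\<^sub>F n in sequentially. ?x n \<le> ereal (real_of_rat q)"
        by (simp add: frequently_def cofinite_eq_sequentially not_le) (auto elim: eventually_mono)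
      then have "limsup ?x \<le> ereal (real_of_rat q)" by (rule Limsup_bounded)
      then show False using q by simp
    qed
    ultimately show False using assms[of "real_of_rat p" "real_of_rat q"] q by (auto simp: Rats_def)
  qed
  then have "liminf ?x = limsup ?x" using Liminf_le_Limsup[of sequentially ?x] by simp
  then show ?thesis by (intro Liminf_eq_Limsup) auto
qed

section \<open>Trading gains as martingales and Doob's convergence theorem\<close>

context SL_expectation
begin

lemma holding_measurable:
  assumes x: "\<And>n. x n \<in> borel_measurable (F n)"
  shows "Measurable.pred (F n) (\<lambda>\<omega>. holding a b (\<lambda>k. x k \<omega>) n)"
proof (induction n)
  case 0
  note [measurable] = x
  show ?case by simp
next
  case (Suc n)
  note [measurable] = x
  have "{\<omega>\<in>space (F n). holding a b (\<lambda>k. x k \<omega>) n} \<in> sets (F (Suc n))"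
    using Suc sets_F_mono[of n "Suc n"] by (auto simp: pred_def)
  then have [measurable]: "Measurable.pred (F (Suc n)) (\<lambda>\<omega>. holding a b (\<lambda>k. x k \<omega>) n)"
    by (simp add: pred_def space_F)
  show ?case by simp
qed

lemma gain_measurable:
  assumes x: "\<And>n. x n \<in> borel_measurable (F n)"
  shows "(\<lambda>\<omega>. gain a b (\<lambda>k. x k \<omega>) n) \<in> borel_measurable (F n)"
proof (induction n)
  case (Suc n)
  have [measurable]: "Measurable.pred (F (Suc n)) (\<lambda>\<omega>. holding a b (\<lambda>k. x k \<omega>) n)"
    using holding_measurable[where x = x and n = n and a = a and b = b, OF x] sets_F_mono[of n "Suc n"] by (auto simp: pred_def space_F)
  have [measurable]: "(\<lambda>\<omega>. gain a b (\<lambda>k. x k \<omega>) n) \<in> borel_measurable (F (Suc n))"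
    "x n \<in> borel_measurable (F (Suc n))" "x (Suc n) \<in> borel_measurable (F (Suc n))"
    using Suc x by (auto intro: measurable_F_mono[of n "Suc n"])
  show ?case by simp
qed simp

text \<open>While a position is held, the next gain is \<open>x (Suc n)\<close> plus a term known at
  time n; otherwise the gain is unchanged. The two cases are pasted along the holding event.\<close>

lemma martingale_gain:
  assumes x: "martingale x"
  shows "martingale (\<lambda>n \<omega>. gain a b (\<lambda>k. x k \<omega>) n)"
proof (rule martingaleI)
  let ?g = "\<lambda>n \<omega>. gain a b (\<lambda>k. x k \<omega>) n"
  have step: "is_cond_exp n (?g (Suc n)) (?g n)" if g: "?g n \<in> L1_real" for n
  proof -
    let ?A = "{\<omega>\<in>space M. holding a b (\<lambda>k. x k \<omega>) n}"
    have gF: "?g n \<in> borel_measurable (F n)" by (intro gain_measurable martingale_F x)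
    have "is_cond_exp n (\<lambda>\<omega>. x (Suc n) \<omega> + (?g n \<omega> - x n \<omega>)) (\<lambda>\<omega>. x n \<omega> + (?g n \<omega> - x n \<omega>))"
      using gF martingale_F[OF x]
      by (intro is_cond_exp_translate martingaleD[OF x] L1_real_diff g martingale_L1_real[OF x] borel_measurable_diff) auto
    moreover have "?A \<in> sets (F n)"
      using holding_measurable[where x = x and n = n and a = a and b = b, OF martingale_F[OF x]] by (simp add: pred_def space_F)
    moreover note is_cond_exp_self[OF g gF]
    ultimately have c: "is_cond_exp n (\<lambda>\<omega>. if \<omega> \<in> ?A then x (Suc n) \<omega> + (?g n \<omega> - x n \<omega>) else ?g n \<omega>)
        (\<lambda>\<omega>. if \<omega> \<in> ?A then x n \<omega> + (?g n \<omega> - x n \<omega>) else ?g n \<omega>)"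
      by (intro is_cond_exp_if)
    have "?g (Suc n) \<in> borel_measurable M"
      by (intro measurable_F_M[OF gain_measurable] martingale_F x)
    then show ?thesis
      by (intro is_cond_exp_cong_AE[OF c _ _ _ gF]) (auto intro!: AE_I2)
  qed
  \<comment> \<open>The martingale step assumes that the gain lies in L^1 at time n and yields it at
    time n + 1.\<close>
  have "?g n \<in> L1_real" for n
  proof (induction n)
    case 0
    show ?case by (simp add: H_L1_real H_const)
  next
    case (Suc n)
    then show ?case using step[THEN is_cond_exp_L1_real(1)] by simp
  qed
  then show "is_cond_exp n (?g (Suc n)) (?g n)" for n by (rule step)
qed

text \<open>The gain g has mean 0, so one-sided comparison bounds the mean of the scaled counter u
  by that of (u - g)^+, and the pathwise inequality bounds this by (a - x n)^+.\<close>

lemma upcrossing_inequality: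
  assumes x: "martingale x" and ab: "a < b"
  shows "L1_norm (\<lambda>\<omega>. (b - a) * real (upcrossings a b (\<lambda>k. x k \<omega>) n)) \<le> L1_norm (\<lambda>\<omega>. max (a - x n \<omega>) 0)"
    and "(\<lambda>\<omega>. (b - a) * real (upcrossings a b (\<lambda>k. x k \<omega>) n)) \<in> borel_measurable M"
proof -
  let ?u = "\<lambda>n \<omega>. (b - a) * real (upcrossings a b (\<lambda>k. x k \<omega>) n)" and ?g = "\<lambda>n \<omega>. gain a b (\<lambda>k. x k \<omega>) n"
  have [measurable]: "Measurable.pred M (\<lambda>\<omega>. holding a b (\<lambda>k. x k \<omega>) n)" for n
    using holding_measurable[where x = x and n = n and a = a and b = b, OF martingale_F[OF x]] sets_F_subset by (auto simp: pred_def space_F)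
  have "(\<lambda>\<omega>. upcrossings a b (\<lambda>k. x k \<omega>) n) \<in> measurable M (count_space UNIV)" for n
    by (induction n) (simp_all del: holding.simps)
  then show um [measurable]: "?u n \<in> borel_measurable M" for n by measurable
  \<comment> \<open>The counter takes at most n + 1 values, so it is a simple function and therefore
    lies in L^1.\<close>
  have "?u n ` space M \<subseteq> (\<lambda>k. (b - a) * real k) ` {..n}"
    using upcrossings_le by auto
  then have "finite (?u n ` space M)" by (rule finite_subset) simp
  then have "simple_function M (?u n)"
    using um by (simp add: simple_function_borel_measurable)
  then obtain v where v: "is_cond_exp 0 (?u n) v"
    using is_cond_exp_exists[OF simple_function_L1_real] by blast
  have g: "is_cond_exp 0 (?g n) (\<lambda>_. 0)"
    using martingaleD[OF martingale_gain[OF x], of 0 n] by simp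
  note [measurable] = is_cond_exp_measurable[OF v] martingale_M[OF x]
  have pos: "AE \<omega> in qs_measure. 0 \<le> ?u n \<omega>" using ab by simp
  have "L1_norm (?u n) = L1_norm v"
    by (rule is_cond_exp_L1_norm_eq[OF v pos, symmetric])
  also have "\<dots> \<le> L1_norm (\<lambda>\<omega>. max (v \<omega> - 0) 0)"
    using is_cond_exp_nonneg[OF v pos] by (intro L1_norm_mono) auto
  also have "\<dots> \<le> L1_norm (\<lambda>\<omega>. max (?u n \<omega> - ?g n \<omega>) 0)"
    by (rule is_cond_exp_pos_part[OF v g])
  also have "\<dots> \<le> L1_norm (\<lambda>\<omega>. max (a - x n \<omega>) 0)"
  proof (intro L1_norm_mono AE_I2)
    fix \<omega>
    show "\<bar>max (?u n \<omega> - ?g n \<omega>) 0\<bar> \<le> \<bar>max (a - x n \<omega>) 0\<bar>"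
      using upcrossings_gain[of b a "\<lambda>k. x k \<omega>" n] by (auto split: if_splits)
  qed simp
  finally show "L1_norm (?u n) \<le> L1_norm (\<lambda>\<omega>. max (a - x n \<omega>) 0)" .
qed

text \<open>The bound |a| + B on the scaled counters does not depend on n, so the total number of
  upcrossings is finite quasi-surely for each pair a < b. The limit is extended-valued here; its
  finiteness is left to Fatou.\<close>

lemma martingale_convergence:
  assumes x: "martingale x" and B: "\<And>n. L1_norm (x n) \<le> ennreal B"
  shows "AE \<omega> in qs_measure. (\<lambda>n. ereal (x n \<omega>)) \<longlonglongrightarrow> limsup (\<lambda>n. ereal (x n \<omega>))"
proof -
  note [measurable] = martingale_M[OF x]
  have "AE \<omega> in qs_measure. \<not> ((\<exists>\<^sub>\<infinity>n. x n \<omega> \<le> a) \<and> (\<exists>\<^sub>\<infinity>n. b \<le> x n \<omega>))" if ab: "a < b" for a b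
  proof -
    let ?u = "\<lambda>n \<omega>. (b - a) * real (upcrossings a b (\<lambda>k. x k \<omega>) n)"
    have [measurable]: "?u n \<in> borel_measurable M" for n by (rule upcrossing_inequality[OF x ab])
    have "upper (\<lambda>\<omega>. SUP n. ennreal (?u n \<omega>)) = (SUP n. upper (\<lambda>\<omega>. ennreal (?u n \<omega>)))"
      using ab by (intro upper_SUP) (auto simp: incseq_def intro!: ennreal_leI mult_left_mono upcrossings_mono)
    also have "\<dots> \<le> ennreal \<bar>a\<bar> + ennreal B"
    proof (rule SUP_least)
      fix n
      have "upper (\<lambda>\<omega>. ennreal (?u n \<omega>)) = L1_norm (?u n)"
        using ab by (simp add: L1_norm_def)
      also have "\<dots> \<le> L1_norm (\<lambda>\<omega>. max (a - x n \<omega>) 0)" by (rule upcrossing_inequality[OF x ab])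
      also have "\<dots> \<le> L1_norm (\<lambda>_. a) + L1_norm (x n)" by (intro L1_norm_le2 AE_I2) auto
      also have "\<dots> \<le> ennreal \<bar>a\<bar> + ennreal B" by (intro add_mono B) (simp add: L1_norm_const)
      finally show "upper (\<lambda>\<omega>. ennreal (?u n \<omega>)) \<le> ennreal \<bar>a\<bar> + ennreal B" .
    qed
    also have "\<dots> < \<infinity>" by simp
    finally have "AE \<omega> in qs_measure. (SUP n. ennreal (?u n \<omega>)) < \<infinity>"
      by (intro upper_finite_AE) auto
    then show ?thesis
    proof eventually_elim
      case (elim \<omega>)
      then obtain C where C: "0 \<le> C" "(SUP n. ennreal (?u n \<omega>)) = ennreal C"
        by (cases "SUP n. ennreal (?u n \<omega>)" rule: ennreal_cases) auto
      have le: "?u n \<omega> \<le> C" for n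
      proof -
        have "ennreal (?u n \<omega>) \<le> ennreal C" unfolding C(2)[symmetric] by (rule SUP_upper) simp
        then show ?thesis using C(1) by (simp add: ennreal_le_iff)
      qed
      obtain N :: nat where N: "C < real N * (b - a)" using ab reals_Archimedean3[of "b - a"] by auto
      show ?case
      proof
        assume "(\<exists>\<^sub>\<infinity>n. x n \<omega> \<le> a) \<and> (\<exists>\<^sub>\<infinity>n. b \<le> x n \<omega>)"
        then obtain n where "N \<le> upcrossings a b (\<lambda>k. x k \<omega>) n"
          using upcrossings_unbounded[of "\<lambda>k. x k \<omega>" a b N] by auto
        then have "real N * (b - a) \<le> ?u n \<omega>" using ab by (simp add: mult.commute)
        then show False using le[of n] N by simp
      qed
    qed
  qed
  then have "AE \<omega> in qs_measure. \<forall>a\<in>\<rat>. \<forall>b\<in>\<rat>. a < b \<longrightarrow> \<not> ((\<exists>\<^sub>\<infinity>n. x n \<omega> \<le> a) \<and> (\<exists>\<^sub>\<infinity>n. b \<le> x n \<omega>))"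
    by (simp add: AE_ball_countable countable_rat)
  then show ?thesis
    by eventually_elim (rule ereal_convergent_if_no_oscillation, blast)
qed

section \<open>Optional stopping for the completion\<close>

text \<open>Contraction compares a given approximating sequence with the approximants that the
  relation provides, so any such sequence computes Y.\<close>

lemma is_cond_exp_limit:
  assumes c: "is_cond_exp t X Y" and h: "\<And>n. h n \<in> H"
    and lim: "\<And>e. 0 < e \<Longrightarrow> \<exists>n0. \<forall>n\<ge>n0. L1_norm (\<lambda>\<omega>. h n \<omega> - X \<omega>) \<le> ennreal e" and e: "0 < e"
  shows "\<exists>n0. \<forall>n\<ge>n0. L1_norm (\<lambda>\<omega>. E t (h n) \<omega> - Y \<omega>) \<le> ennreal e"
proof -
  obtain k where k: "k \<in> H" "L1_norm (\<lambda>\<omega>. k \<omega> - X \<omega>) \<le> ennreal (e/3)" "L1_norm (\<lambda>\<omega>. E t k \<omega> - Y \<omega>) \<le> ennreal (e/3)"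
    by (rule is_cond_expE[OF c, of "e/3"]) (use e in auto)
  obtain n0 where n0: "\<And>n. n \<ge> n0 \<Longrightarrow> L1_norm (\<lambda>\<omega>. h n \<omega> - X \<omega>) \<le> ennreal (e/3)"
    using lim[of "e/3"] e by auto
  have "L1_norm (\<lambda>\<omega>. E t (h n) \<omega> - Y \<omega>) \<le> ennreal e" if "n0 \<le> n" for n
  proof -
    note [measurable] = is_cond_exp_measurable[OF c] H_measurableD[OF h] H_measurableD[OF k(1)] E_M[OF h] E_M[OF k(1)]
    have "L1_norm (\<lambda>\<omega>. E t (h n) \<omega> - E t k \<omega>) \<le> L1_norm (\<lambda>\<omega>. h n \<omega> - k \<omega>)"
      by (intro L1_norm_E_diff h k)
    also have "\<dots> \<le> L1_norm (\<lambda>\<omega>. h n \<omega> - X \<omega>) + L1_norm (\<lambda>\<omega>. k \<omega> - X \<omega>)"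
      by (intro L1_norm_le2 AE_I2) auto
    also have "\<dots> \<le> ennreal (e/3) + ennreal (e/3)" by (intro add_mono n0 that k)
    finally have "L1_norm (\<lambda>\<omega>. E t (h n) \<omega> - E t k \<omega>) \<le> ennreal (e/3) + ennreal (e/3)" .
    moreover have "L1_norm (\<lambda>\<omega>. E t (h n) \<omega> - Y \<omega>) \<le> L1_norm (\<lambda>\<omega>. E t (h n) \<omega> - E t k \<omega>) + L1_norm (\<lambda>\<omega>. E t k \<omega> - Y \<omega>)"
      by (intro L1_norm_le2 AE_I2) auto
    ultimately have "L1_norm (\<lambda>\<omega>. E t (h n) \<omega> - Y \<omega>) \<le> ennreal (e/3) + ennreal (e/3) + ennreal (e/3)"
      using k by (elim order_trans) (auto intro!: add_mono)
    also have "\<dots> = ennreal e" using e by (simp flip: ennreal_plus)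
    finally show ?thesis .
  qed
  then show ?thesis by blast
qed

text \<open>Fatou in [0, \<infinity>] bounds the upper expectation of |X|, which is then finite
  quasi-surely.\<close>

lemma L1_bounded_limit_finite:
  assumes Z [measurable]: "\<And>n. Z n \<in> borel_measurable M" and X [measurable]: "X \<in> borel_measurable M"
    and lim: "AE \<omega> in qs_measure. (\<lambda>n. ereal (Z n \<omega>)) \<longlonglongrightarrow> X \<omega>"
    and B: "\<And>n. n \<ge> n0 \<Longrightarrow> L1_norm (Z n) \<le> u" and u: "u < \<infinity>"
  shows "AE \<omega> in qs_measure. \<bar>X \<omega>\<bar> \<noteq> \<infinity> \<and> (\<lambda>n. Z n \<omega>) \<longlonglongrightarrow> real_of_ereal (X \<omega>)"
proof -
  have "upper (\<lambda>\<omega>. e2ennreal \<bar>X \<omega>\<bar>) \<le> u"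
  proof (rule upper_Fatou[of "\<lambda>n \<omega>. ennreal \<bar>Z n \<omega>\<bar>" _ n0])
    show "AE \<omega> in qs_measure. e2ennreal \<bar>X \<omega>\<bar> \<le> liminf (\<lambda>n. ennreal \<bar>Z n \<omega>\<bar>)"
      using lim
    proof eventually_elim
      case (elim \<omega>)
      then have "(\<lambda>n. e2ennreal \<bar>ereal (Z n \<omega>)\<bar>) \<longlonglongrightarrow> e2ennreal \<bar>X \<omega>\<bar>"
        by (intro tendsto_intros)
      then have "liminf (\<lambda>n. ennreal \<bar>Z n \<omega>\<bar>) = e2ennreal \<bar>X \<omega>\<bar>"
        by (intro lim_imp_Liminf[OF sequentially_bot]) (simp add: e2ennreal_ereal)
      then show ?case by simp
    qed
  qed (use B in \<open>auto simp: L1_norm_def\<close>)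
  then have "AE \<omega> in qs_measure. e2ennreal \<bar>X \<omega>\<bar> < \<infinity>"
    using u by (intro upper_finite_AE) auto
  with lim show ?thesis
  proof eventually_elim
    case (elim \<omega>)
    have fin: "\<bar>X \<omega>\<bar> \<noteq> \<infinity>"
      using elim(2) by (cases "X \<omega>") (auto simp: e2ennreal_infty)
    then have "(\<lambda>n. ereal (Z n \<omega>)) \<longlonglongrightarrow> ereal (real_of_ereal (X \<omega>))"
      using elim(1) by (simp add: ereal_real)
    with fin show ?case by simp
  qed
qed

section \<open>Elements of the completion and their real-valued representatives\<close>

lemma L1_norm_H_le_iff:
  assumes "X \<in> H" "0 \<le> e"
  shows "L1_norm X \<le> ennreal e \<longleftrightarrow> mean (\<lambda>\<omega>. \<bar>X \<omega>\<bar>) \<le> e"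
  using assms by (simp add: L1_norm_H ennreal_le_iff)

text \<open>A Cauchy sequence with a quasi-surely convergent subsequence converges in norm to the
  same limit. Together with \<open>L1_representsI\<close> this turns representation into norm
  approximation of a real-valued function.\<close>

lemma L1_representsD:
  assumes "L1_represents M H E Xs X"
  shows "AE \<omega> in qs_measure. \<bar>X \<omega>\<bar> \<noteq> \<infinity>" "\<And>n. Xs n \<in> H" "X \<in> borel_measurable M"
    "0 < e \<Longrightarrow> \<exists>n0. \<forall>n\<ge>n0. L1_norm (\<lambda>\<omega>. Xs n \<omega> - real_of_ereal (X \<omega>)) \<le> ennreal e"
proof -
  show H: "\<And>n. Xs n \<in> H" and X: "X \<in> borel_measurable M"
    using assms by (auto simp: L1_represents_def L1_Cauchy_def)
  note [measurable] = H_measurableD[OF H] X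
  obtain r :: "nat \<Rightarrow> nat" where r: "strict_mono r" "AE \<omega> in qs_measure. (\<lambda>n. ereal (Xs (r n) \<omega>)) \<longlonglongrightarrow> X \<omega>"
    using assms by (auto simp: L1_represents_def quasi_surely_iff_AE)
  have rk: "k \<le> r k" for k using r(1) by (rule seq_suble)
  have Cauchy: "\<exists>n0. \<forall>m\<ge>n0. \<forall>n\<ge>n0. L1_norm (\<lambda>\<omega>. Xs m \<omega> - Xs n \<omega>) \<le> ennreal e" if e: "0 < e" for e
  proof -
    obtain n0 where "\<forall>m\<ge>n0. \<forall>n\<ge>n0. mean (\<lambda>\<omega>. \<bar>Xs m \<omega> - Xs n \<omega>\<bar>) < e"
      using assms e unfolding L1_represents_def L1_Cauchy_def by meson
    then have "\<forall>m\<ge>n0. \<forall>n\<ge>n0. L1_norm (\<lambda>\<omega>. Xs m \<omega> - Xs n \<omega>) \<le> ennreal e"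
      using e by (simp add: L1_norm_H_le_iff H_diff H less_imp_le)
    then show ?thesis by blast
  qed
  obtain n1 where n1: "\<And>m n. m \<ge> n1 \<Longrightarrow> n \<ge> n1 \<Longrightarrow> L1_norm (\<lambda>\<omega>. Xs m \<omega> - Xs n \<omega>) \<le> ennreal 1"
    using Cauchy[of 1] by auto
  have lim: "AE \<omega> in qs_measure. \<bar>X \<omega>\<bar> \<noteq> \<infinity> \<and> (\<lambda>n. Xs (r n) \<omega>) \<longlonglongrightarrow> real_of_ereal (X \<omega>)"
  proof (rule L1_bounded_limit_finite[OF _ X r(2)])
    show "L1_norm (Xs (r n)) \<le> ennreal 1 + L1_norm (Xs n1)" if "n1 \<le> n" for n
    proof -
      have "L1_norm (Xs (r n)) \<le> L1_norm (\<lambda>\<omega>. Xs (r n) \<omega> - Xs n1 \<omega>) + L1_norm (Xs n1)"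
        by (intro L1_norm_le2 AE_I2) auto
      also have "\<dots> \<le> ennreal 1 + L1_norm (Xs n1)"
        using rk[of n] that by (intro add_right_mono n1) auto
      finally show ?thesis .
    qed
    show "ennreal 1 + L1_norm (Xs n1) < \<infinity>" by (simp add: L1_norm_H H)
  qed simp
  then show "AE \<omega> in qs_measure. \<bar>X \<omega>\<bar> \<noteq> \<infinity>" by eventually_elim simp
  assume "0 < e"
  then obtain n0 where n0: "\<And>m n. m \<ge> n0 \<Longrightarrow> n \<ge> n0 \<Longrightarrow> L1_norm (\<lambda>\<omega>. Xs m \<omega> - Xs n \<omega>) \<le> ennreal e"
    using Cauchy by metis
  have "L1_norm (\<lambda>\<omega>. Xs n \<omega> - real_of_ereal (X \<omega>)) \<le> ennreal e" if n: "n0 \<le> n" for n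
  \<comment> \<open>n stays fixed while Fatou runs along the subsequence, which upgrades
    subsequential pointwise convergence to norm convergence of the whole sequence.\<close>
  proof (rule L1_norm_Fatou[of "\<lambda>k \<omega>. Xs n \<omega> - Xs (r k) \<omega>" _ n0])
    show "AE \<omega> in qs_measure. (\<lambda>k. Xs n \<omega> - Xs (r k) \<omega>) \<longlonglongrightarrow> Xs n \<omega> - real_of_ereal (X \<omega>)"
      using lim by eventually_elim (intro tendsto_intros, simp)
    show "L1_norm (\<lambda>\<omega>. Xs n \<omega> - Xs (r k) \<omega>) \<le> ennreal e" if "n0 \<le> k" for k
      using that n rk[of k] by (intro n0) auto
  qed simp
  then show "\<exists>n0. \<forall>n\<ge>n0. L1_norm (\<lambda>\<omega>. Xs n \<omega> - real_of_ereal (X \<omega>)) \<le> ennreal e" by blast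
qed

lemma L1_representsI:
  assumes H: "\<And>n. Xs n \<in> H" and X: "X \<in> borel_measurable M" and fin: "AE \<omega> in qs_measure. \<bar>X \<omega>\<bar> \<noteq> \<infinity>"
    and lim: "\<And>e. 0 < e \<Longrightarrow> \<exists>n0. \<forall>n\<ge>n0. L1_norm (\<lambda>\<omega>. Xs n \<omega> - real_of_ereal (X \<omega>)) \<le> ennreal e"
  shows "L1_represents M H E Xs X"
  unfolding L1_represents_def L1_Cauchy_def quasi_surely_iff_AE
proof (intro conjI allI impI H X)
  note [measurable] = H_measurableD[OF H] X
  fix e :: real assume e: "0 < e"
  obtain n0 where n0: "\<And>n. n \<ge> n0 \<Longrightarrow> L1_norm (\<lambda>\<omega>. Xs n \<omega> - real_of_ereal (X \<omega>)) \<le> ennreal (e/3)"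
    using lim[of "e/3"] e by auto
  have "mean (\<lambda>\<omega>. \<bar>Xs m \<omega> - Xs n \<omega>\<bar>) < e" if "n0 \<le> m" "n0 \<le> n" for m n
  proof -
    have "L1_norm (\<lambda>\<omega>. Xs m \<omega> - Xs n \<omega>) \<le> L1_norm (\<lambda>\<omega>. Xs m \<omega> - real_of_ereal (X \<omega>)) + L1_norm (\<lambda>\<omega>. Xs n \<omega> - real_of_ereal (X \<omega>))"
      by (intro L1_norm_le2 AE_I2) auto
    also have "\<dots> \<le> ennreal (e/3) + ennreal (e/3)" by (intro add_mono n0 that)
    also have "\<dots> = ennreal (2 * e/3)" using e by (simp flip: ennreal_plus)
    finally have "mean (\<lambda>\<omega>. \<bar>Xs m \<omega> - Xs n \<omega>\<bar>) \<le> 2 * e/3"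
      using e by (subst (asm) L1_norm_H_le_iff) (auto intro: H_diff H)
    then show ?thesis using e by simp
  qed
  then show "\<exists>N. \<forall>m\<ge>N. \<forall>n\<ge>N. mean (\<lambda>\<omega>. \<bar>Xs m \<omega> - Xs n \<omega>\<bar>) < e" by blast
next
  note [measurable] = H_measurableD[OF H] X
  have "\<forall>k. \<exists>n0. \<forall>n\<ge>n0. L1_norm (\<lambda>\<omega>. Xs n \<omega> - real_of_ereal (X \<omega>)) \<le> ennreal ((1/2)^k)"
    by (intro allI lim) simp
  then obtain K :: "nat \<Rightarrow> nat" where K: "\<And>k n. n \<ge> K k \<Longrightarrow> L1_norm (\<lambda>\<omega>. Xs n \<omega> - real_of_ereal (X \<omega>)) \<le> ennreal ((1/2)^k)"
    by metis
  \<comment> \<open>The summand k makes r strictly increasing even where the thresholds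
    \<open>K\<close> vanish.\<close>
  define r where "r k = (\<Sum>i\<le>k. K i) + k" for k
  have "strict_mono r" by (simp add: strict_mono_Suc_iff r_def)
  have r: "K k \<le> r k" for k
    using member_le_sum[of k "{..k}" K] by (simp add: r_def)
  have "AE \<omega> in qs_measure. summable (\<lambda>k. \<bar>Xs (r k) \<omega> - real_of_ereal (X \<omega>)\<bar>)"
    using K r by (intro L1_norm_summable_AE) auto
  with fin have "AE \<omega> in qs_measure. (\<lambda>k. ereal (Xs (r k) \<omega>)) \<longlonglongrightarrow> X \<omega>"
  proof eventually_elim
    case (elim \<omega>)
    have "(\<lambda>k. Xs (r k) \<omega> - real_of_ereal (X \<omega>)) \<longlonglongrightarrow> 0"
      by (rule tendsto_rabs_zero_cancel[OF summable_LIMSEQ_zero[OF elim(2)]])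
    then have "(\<lambda>k. ereal (Xs (r k) \<omega>)) \<longlonglongrightarrow> ereal (real_of_ereal (X \<omega>))"
      by (rule tendsto_ereal[OF LIM_zero_cancel])
    then show ?case by (subst (asm) ereal_real'[OF elim(1)])
  qed
  with \<open>strict_mono r\<close> show "\<exists>r. strict_mono r \<and> (AE \<omega> in qs_measure. (\<lambda>n. ereal (Xs (r n) \<omega>)) \<longlonglongrightarrow> X \<omega>)"
    by blast
qed

lemma L1_space_iff:
  "X \<in> L1_space M H E \<longleftrightarrow> X \<in> borel_measurable M \<and> (AE \<omega> in qs_measure. \<bar>X \<omega>\<bar> \<noteq> \<infinity>) \<and>
    (\<lambda>\<omega>. real_of_ereal (X \<omega>)) \<in> L1_real"
proof safe
  assume "X \<in> L1_space M H E"
  then obtain Xs where Xs: "L1_represents M H E Xs X" by (auto simp: L1_space_def)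
  note D = L1_representsD[OF Xs]
  show "X \<in> borel_measurable M" "AE \<omega> in qs_measure. \<bar>X \<omega>\<bar> \<noteq> \<infinity>" by (rule D)+
  show "(\<lambda>\<omega>. real_of_ereal (X \<omega>)) \<in> L1_real"
    using D(3) D(2) D(4) unfolding L1_real_def by (auto intro: borel_measurable_real_of_ereal) (meson order_refl)
next
  assume X: "X \<in> borel_measurable M" "AE \<omega> in qs_measure. \<bar>X \<omega>\<bar> \<noteq> \<infinity>" "(\<lambda>\<omega>. real_of_ereal (X \<omega>)) \<in> L1_real"
  obtain h :: "nat \<Rightarrow> 'a \<Rightarrow> real" where h: "\<forall>n. h n \<in> H"
    "\<forall>e>0. \<exists>n0. \<forall>n\<ge>n0. L1_norm (\<lambda>\<omega>. h n \<omega> - real_of_ereal (X \<omega>)) \<le> ennreal e"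
    using L1_real_seq[OF X(3)] by auto
  then have "L1_represents M H E h X" using X(1,2) by (intro L1_representsI) auto
  then show "X \<in> L1_space M H E" by (auto simp: L1_space_def)
qed

text \<open>Whatever version the choice operator returns satisfies the defining property, once
  existence is supplied by the real-valued theory; uniqueness of versions then applies to
  it.\<close>

lemma L1_expect_is_cond_exp:
  fixes t :: nat
  assumes X: "X \<in> L1_space M H E"
  defines "Y \<equiv> L1_expect M F H E t X"
  shows "Y \<in> borel_measurable (F t)" "AE \<omega> in qs_measure. \<bar>Y \<omega>\<bar> \<noteq> \<infinity>"
    "is_cond_exp t (\<lambda>\<omega>. real_of_ereal (X \<omega>)) (\<lambda>\<omega>. real_of_ereal (Y \<omega>))"
proof -
  let ?P = "\<lambda>Y. Y \<in> borel_measurable (F t) \<and> (\<exists>Xs. L1_represents M H E Xs X \<and> L1_represents M H E (\<lambda>n. E t (Xs n)) Y)"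
  have "\<exists>Y. ?P Y"
  proof -
    obtain Xs where Xs: "L1_represents M H E Xs X" using X by (auto simp: L1_space_def)
    note D = L1_representsD[OF Xs]
    obtain y where y: "is_cond_exp t (\<lambda>\<omega>. real_of_ereal (X \<omega>)) y"
      using X is_cond_exp_exists unfolding L1_space_iff by blast
    note ym = is_cond_exp_measurable(2,3)[OF y]
    have "L1_represents M H E (\<lambda>n. E t (Xs n)) (\<lambda>\<omega>. ereal (y \<omega>))"
      using is_cond_exp_limit[OF y D(2) D(4)] D(2) ym by (intro L1_representsI E_H) auto
    then show ?thesis using Xs ym by (intro exI[of _ "\<lambda>\<omega>. ereal (y \<omega>)"]) auto
  qed
  then have "?P Y" unfolding Y_def L1_expect_def by (rule someI_ex)
  then obtain Xs where Y: "Y \<in> borel_measurable (F t)"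
    and Xs: "L1_represents M H E Xs X" "L1_represents M H E (\<lambda>n. E t (Xs n)) Y" by blast
  note D = L1_representsD[OF Xs(1)] and D' = L1_representsD[OF Xs(2)]
  show "Y \<in> borel_measurable (F t)" by fact
  show "AE \<omega> in qs_measure. \<bar>Y \<omega>\<bar> \<noteq> \<infinity>" by (rule D')
  show "is_cond_exp t (\<lambda>\<omega>. real_of_ereal (X \<omega>)) (\<lambda>\<omega>. real_of_ereal (Y \<omega>))"
    unfolding is_cond_exp_def
  proof (intro conjI allI impI)
    show "(\<lambda>\<omega>. real_of_ereal (X \<omega>)) \<in> borel_measurable M" "(\<lambda>\<omega>. real_of_ereal (Y \<omega>)) \<in> borel_measurable (F t)"
      using D(3) Y by auto
    fix e :: real assume "0 < e"
    obtain n0 n1 where "\<forall>n\<ge>n0. L1_norm (\<lambda>\<omega>. Xs n \<omega> - real_of_ereal (X \<omega>)) \<le> ennreal e"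
      "\<forall>n\<ge>n1. L1_norm (\<lambda>\<omega>. E t (Xs n) \<omega> - real_of_ereal (Y \<omega>)) \<le> ennreal e"
      using D(4)[OF \<open>0 < e\<close>] D'(4)[OF \<open>0 < e\<close>] by blast
    then show "\<exists>h\<in>H. L1_norm (\<lambda>\<omega>. h \<omega> - real_of_ereal (X \<omega>)) \<le> ennreal e \<and> L1_norm (\<lambda>\<omega>. E t h \<omega> - real_of_ereal (Y \<omega>)) \<le> ennreal e"
      using D(2) by (intro bexI[of _ "Xs (max n0 n1)"]) auto
  qed
qed

lemma F_0_const:
  assumes "f \<in> borel_measurable (F 0)" and "\<omega> \<in> space M" "\<omega>' \<in> space M"
  shows "f \<omega> = (f \<omega>' :: ereal)"
proof -
  have "f -` {f \<omega>'} \<inter> space (F 0) \<in> sets (F 0)"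
    using assms(1) by (rule measurable_sets) simp
  then have "f -` {f \<omega>'} \<inter> space M = space M"
    using assms(3) by (auto simp: F_0_trivial space_F)
  then show ?thesis using assms(2) by blast
qed

text \<open>Conditioning at time 0 preserves the norm of a nonnegative function and returns a
  constant on \<open>space M\<close>, whose norm is its absolute value.\<close>

lemma L1_mean_eq_L1_norm:
  assumes X: "X \<in> L1_space M H E" and pos: "AE \<omega> in qs_measure. 0 \<le> X \<omega>"
  shows "L1_norm (\<lambda>\<omega>. real_of_ereal (X \<omega>)) = ennreal \<bar>L1_mean M F H E X\<bar>"
proof -
  let ?Y = "L1_expect M F H E 0 X"
  note Y = L1_expect_is_cond_exp[OF X, of 0]
  have "L1_norm (\<lambda>\<omega>. real_of_ereal (X \<omega>)) = L1_norm (\<lambda>\<omega>. real_of_ereal (?Y \<omega>))"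
    using pos by (intro is_cond_exp_L1_norm_eq[OF Y(3), symmetric]) (auto elim: eventually_mono simp: real_of_ereal_pos)
  also have "\<dots> = L1_norm (\<lambda>_. L1_mean M F H E X)"
  proof -
    have "real_of_ereal (?Y \<omega>) = L1_mean M F H E X" if "\<omega> \<in> space M" for \<omega>
      unfolding L1_mean_def using F_0_const[OF Y(1) that some_space] by simp
    then show ?thesis by (intro antisym L1_norm_mono AE_I2) (auto simp: is_cond_exp_measurable[OF Y(3)])
  qed
  finally show ?thesis by (simp add: L1_norm_const)
qed

lemma SL_martingale_real:
  assumes "SL_martingale M F H E X"
  shows "martingale (\<lambda>n \<omega>. real_of_ereal (X n \<omega>))"
  unfolding martingale_def
proof (intro allI impI)
  fix s t :: nat assume "s \<le> t"
  have X: "X n \<in> L1_space M H E" "X n \<in> borel_measurable (F n)" for n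
    using assms by (auto simp: SL_martingale_def)
  have "AE \<omega> in qs_measure. X s \<omega> = L1_expect M F H E s (X t) \<omega>"
    using assms \<open>s \<le> t\<close> by (auto simp: SL_martingale_def quasi_surely_iff_AE)
  then have eq: "AE \<omega> in qs_measure. real_of_ereal (L1_expect M F H E s (X t) \<omega>) = real_of_ereal (X s \<omega>)"
    by eventually_elim simp
  show "is_cond_exp s (\<lambda>\<omega>. real_of_ereal (X t \<omega>)) (\<lambda>\<omega>. real_of_ereal (X s \<omega>))"
    by (rule is_cond_exp_cong_AE[OF L1_expect_is_cond_exp(3)[OF X(1)[of t]] _ eq])
      (use X(1)[of t] X(2)[of s] in \<open>auto simp: L1_space_iff\<close>)
qed

text \<open>For c \<ge> 0 the excess over c is at most |X| on {|X| \<ge> c} and 0 elsewhere, so the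
  indicator form bounds the excess form.\<close>

lemma SL_uniformly_integrable_real:
  assumes "SL_uniformly_integrable M F H E (range X)"
  shows "uniformly_integrable (\<lambda>n \<omega>. real_of_ereal (X n \<omega>))"
  unfolding uniformly_integrable_def
proof (intro allI impI)
  fix e :: real assume e: "0 < e"
  let ?V = "\<lambda>c n \<omega>. indicator {\<omega>\<in>space M. \<bar>X n \<omega>\<bar> \<ge> ereal c} \<omega> * \<bar>X n \<omega>\<bar>"
  have X: "X n \<in> L1_space M H E" for n
    using assms by (auto simp: SL_uniformly_integrable_def)
  have "\<forall>\<^sub>F c in at_top. \<forall>n. \<bar>L1_mean M F H E (?V c n)\<bar> < e"
    using assms e by (auto simp: SL_uniformly_integrable_def uniform_limit_iff)
  then have "\<forall>\<^sub>F c in at_top. 0 \<le> c \<and> (\<forall>n. \<bar>L1_mean M F H E (?V c n)\<bar> < e)"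
    using eventually_ge_at_top[of 0] by eventually_elim simp
  then obtain c where c: "0 \<le> c" "\<And>n. \<bar>L1_mean M F H E (?V c n)\<bar> < e"
    by (auto dest: eventually_happens)
  have "L1_norm (\<lambda>\<omega>. max (\<bar>real_of_ereal (X n \<omega>)\<bar> - c) 0) \<le> ennreal e" for n
  proof -
    have XM [measurable]: "X n \<in> borel_measurable M" and fin: "AE \<omega> in qs_measure. \<bar>X n \<omega>\<bar> \<noteq> \<infinity>"
      and xL: "(\<lambda>\<omega>. real_of_ereal (X n \<omega>)) \<in> L1_real"
      using X[of n] by (auto simp: L1_space_iff)
    let ?A = "{\<omega>\<in>space M. \<bar>X n \<omega>\<bar> \<ge> ereal c}"
    \<comment> \<open>\<open>L1_mean\<close> rests on a choice that is controlled for members of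
      \<open>L1_space\<close>, so the truncated function has to be placed there.\<close>
    have V: "?V c n \<in> L1_space M H E"
      unfolding L1_space_iff
    proof (intro conjI)
      show "?V c n \<in> borel_measurable M" by measurable
      show "AE \<omega> in qs_measure. \<bar>?V c n \<omega>\<bar> \<noteq> \<infinity>"
        using fin by eventually_elim (auto simp: indicator_def)
      show "(\<lambda>\<omega>. real_of_ereal (?V c n \<omega>)) \<in> L1_real"
        unfolding L1_real_def
      proof safe
        show "(\<lambda>\<omega>. real_of_ereal (?V c n \<omega>)) \<in> borel_measurable M" by measurable
        fix d :: real assume "0 < d"
        with xL obtain h where h: "h \<in> H" "L1_norm (\<lambda>\<omega>. h \<omega> - real_of_ereal (X n \<omega>)) \<le> ennreal d"
          by (rule L1_realE)
        note [measurable] = H_measurableD[OF h(1)]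
        \<comment> \<open>The same set \<open>?A\<close> cuts down \<open>X n\<close> and its
          approximant h, so the error does not grow.\<close>
        have "L1_norm (\<lambda>\<omega>. indicator ?A \<omega> * \<bar>h \<omega>\<bar> - real_of_ereal (?V c n \<omega>)) \<le> L1_norm (\<lambda>\<omega>. h \<omega> - real_of_ereal (X n \<omega>))"
        proof (intro L1_norm_mono AE_I2)
          fix \<omega>
          have "real_of_ereal (?V c n \<omega>) = indicator ?A \<omega> * \<bar>real_of_ereal (X n \<omega>)\<bar>"
            by (simp add: indicator_def)
          then show "\<bar>indicator ?A \<omega> * \<bar>h \<omega>\<bar> - real_of_ereal (?V c n \<omega>)\<bar> \<le> \<bar>h \<omega> - real_of_ereal (X n \<omega>)\<bar>"
            using abs_triangle_ineq3[of "h \<omega>" "real_of_ereal (X n \<omega>)"]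
            by (cases "\<omega> \<in> ?A") (simp_all del: abs_real_of_ereal)
        qed simp
        then show "\<exists>h\<in>H. L1_norm (\<lambda>\<omega>. h \<omega> - real_of_ereal (?V c n \<omega>)) \<le> ennreal d"
          using h by (intro bexI[of _ "\<lambda>\<omega>. indicator ?A \<omega> * \<bar>h \<omega>\<bar>"] H_indicator H_abs) auto
      qed
    qed
    have "L1_norm (\<lambda>\<omega>. max (\<bar>real_of_ereal (X n \<omega>)\<bar> - c) 0) \<le> L1_norm (\<lambda>\<omega>. real_of_ereal (?V c n \<omega>))"
    proof (intro L1_norm_mono)
      have "AE \<omega> in qs_measure. \<omega> \<in> space M" using AE_space[of qs_measure] by simp
      with fin show "AE \<omega> in qs_measure. \<bar>max (\<bar>real_of_ereal (X n \<omega>)\<bar> - c) 0\<bar> \<le> \<bar>real_of_ereal (?V c n \<omega>)\<bar>"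
      proof eventually_elim
        case (elim \<omega>)
        then obtain z where "X n \<omega> = ereal z" by (cases "X n \<omega>") auto
        with elim c(1) show ?case by (auto simp: indicator_def)
      qed
    qed simp
    also have "\<dots> = ennreal \<bar>L1_mean M F H E (?V c n)\<bar>"
      by (rule L1_mean_eq_L1_norm[OF V]) (auto intro!: AE_I2 simp: indicator_def)
    also have "\<dots> \<le> ennreal e" using c(2)[of n] by (intro ennreal_leI) simp
    finally show ?thesis .
  qed
  then show "\<exists>c\<ge>0. \<forall>n. L1_norm (\<lambda>\<omega>. max (\<bar>real_of_ereal (X n \<omega>)\<bar> - c) 0) \<le> ennreal e"
    using c(1) by blast
qed

section \<open>Extended stopping times and the optional stopping identity\<close>

lemma stopping_time_measurable:
  assumes T: "stopping_time (F_enat M F) T"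
  shows "{\<omega>\<in>space M. T \<omega> \<le> enat n} \<in> sets (F n)" "T \<in> measurable M (count_space UNIV)"
proof -
  show *: "{\<omega>\<in>space M. T \<omega> \<le> enat n} \<in> sets (F n)" for n
    using stopping_timeD[OF T, of "enat n"] by (simp add: F_enat_def pred_def space_F)
  then have [measurable]: "Measurable.pred M (\<lambda>\<omega>. T \<omega> \<le> enat n)" for n
    using sets_F_subset by (auto simp: pred_def)
  have "Measurable.pred M (\<lambda>\<omega>. T \<omega> = m)" for m
  proof (cases m)
    case (enat n)
    have "(\<lambda>\<omega>. T \<omega> = m) = (\<lambda>\<omega>. T \<omega> \<le> enat n \<and> (\<forall>k<n. \<not> T \<omega> \<le> enat k))"
    proof
      fix \<omega> show "(T \<omega> = m) = (T \<omega> \<le> enat n \<and> (\<forall>k<n. \<not> T \<omega> \<le> enat k))"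
        unfolding enat by (cases "T \<omega>") (auto, meson le_refl not_le order_le_less)
    qed
    then show ?thesis by simp
  next
    case infinity
    have "(\<lambda>\<omega>. T \<omega> = m) = (\<lambda>\<omega>. \<forall>k. \<not> T \<omega> \<le> enat k)"
    proof
      fix \<omega> show "(T \<omega> = m) = (\<forall>k. \<not> T \<omega> \<le> enat k)"
        unfolding infinity by (cases "T \<omega>") auto
    qed
    then show ?thesis by simp
  qed
  then show "T \<in> measurable M (count_space UNIV)"
    by (subst measurable_count_space_eq2_countable) (auto simp: pred_def vimage_def Int_def conj_commute)
qed

lemma process_at_measurable:
  assumes X: "\<And>n. X n \<in> borel_measurable M" "Xinf \<in> borel_measurable M" and T: "T \<in> measurable M (count_space UNIV)"
  shows "process_at X Xinf T \<in> borel_measurable M"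
proof -
  have "(\<lambda>\<omega>. (case m of enat n \<Rightarrow> X n \<omega> | \<infinity> \<Rightarrow> Xinf \<omega>)) \<in> borel_measurable M" for m
    using X by (cases m) auto
  from measurable_compose_countable[OF this T] show ?thesis
    by (simp add: process_at_def[abs_def])
qed

lemma optional_stopping:
  assumes T: "stopping_time (F_enat M F) T"
    and ST: "\<And>\<omega>. \<omega> \<in> space M \<Longrightarrow> S \<omega> \<le> T \<omega>"
    and X: "SL_martingale M F H E X" and ui: "SL_uniformly_integrable M F H E (range X)"
  shows "\<exists>Xinf. qs_limit M E X Xinf"
    and "qs_limit M E X Xinf \<Longrightarrow> process_at X Xinf T \<in> L1_space M H E"
    and "qs_limit M E X Xinf \<Longrightarrow> quasi_surely M E
        (\<lambda>\<omega>. process_at X Xinf S \<omega> = L1_expect_at M F H E S (process_at X Xinf T) \<omega>)"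
proof -
  define x where "x n \<omega> = real_of_ereal (X n \<omega>)" for n \<omega>
  have x: "martingale x" and uix: "uniformly_integrable x"
    using SL_martingale_real[OF X] SL_uniformly_integrable_real[OF ui] by (simp_all add: x_def[abs_def])
  have XM [measurable]: "X n \<in> borel_measurable M" and Xfin: "AE \<omega> in qs_measure. \<bar>X n \<omega>\<bar> \<noteq> \<infinity>" for n
    using X by (auto simp: SL_martingale_def L1_space_iff)
  have "AE \<omega> in qs_measure. X n \<omega> = ereal (x n \<omega>)" for n
    using Xfin[of n] by eventually_elim (auto simp: x_def ereal_real)
  then have fin: "AE \<omega> in qs_measure. \<forall>n. X n \<omega> = ereal (x n \<omega>)"
    by (simp add: AE_all_countable)
  obtain B where B: "\<And>n. L1_norm (x n) \<le> ennreal B"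
    using uniformly_integrable_bounded[OF martingale_M[OF x] uix] by blast
  show "\<exists>Xinf. qs_limit M E X Xinf"
  proof
    show "qs_limit M E X (\<lambda>\<omega>. limsup (\<lambda>n. X n \<omega>))"
      unfolding qs_limit_def quasi_surely_iff_AE
    proof
      show "AE \<omega> in qs_measure. (\<lambda>n. X n \<omega>) \<longlonglongrightarrow> limsup (\<lambda>n. X n \<omega>)"
        using fin martingale_convergence[OF x B] by eventually_elim simp
    qed measurable
  qed
  \<comment> \<open>An arbitrary quasi-sure limit is taken; the norm bound on x makes it finite
    quasi-surely.\<close>
  assume "qs_limit M E X Xinf"
  then have Xinf [measurable]: "Xinf \<in> borel_measurable M" and "AE \<omega> in qs_measure. (\<lambda>n. X n \<omega>) \<longlonglongrightarrow> Xinf \<omega>"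
    by (auto simp: qs_limit_def quasi_surely_iff_AE)
  with fin have "AE \<omega> in qs_measure. (\<lambda>n. ereal (x n \<omega>)) \<longlonglongrightarrow> Xinf \<omega>"
    by (auto elim: eventually_elim2)
  from L1_bounded_limit_finite[OF martingale_M[OF x] Xinf this B]
  have lim: "AE \<omega> in qs_measure. \<bar>Xinf \<omega>\<bar> \<noteq> \<infinity> \<and> (\<lambda>n. x n \<omega>) \<longlonglongrightarrow> real_of_ereal (Xinf \<omega>)"
    by simp
  let ?XT = "process_at X Xinf T"
  have XT [measurable]: "?XT \<in> borel_measurable M"
    by (intro process_at_measurable stopping_time_measurable[OF T]) auto
  have XTfin: "AE \<omega> in qs_measure. \<bar>?XT \<omega>\<bar> \<noteq> \<infinity>"
    using fin lim by eventually_elim (auto simp: process_at_def split: enat.split)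
  \<comment> \<open>If T is finite, the stopped path is eventually constant with value X_T; if T =
    \<infinity>, it is the path of x itself.\<close>
  have "AE \<omega> in qs_measure. (\<lambda>n. stopped T x n \<omega>) \<longlonglongrightarrow> real_of_ereal (?XT \<omega>)"
    using lim
  proof eventually_elim
    case (elim \<omega>)
    show ?case
    proof (cases "T \<omega>")
      case (enat k)
      then have "\<forall>\<^sub>F n in sequentially. stopped T x n \<omega> = real_of_ereal (?XT \<omega>)"
        by (intro eventually_sequentiallyI[of k]) (simp add: stopped_def process_at_def x_def min_def)
      then show ?thesis by (rule tendsto_eventually)
    next
      case infinity
      then show ?thesis using elim by (simp add: stopped_def process_at_def)
    qed
  qed
  then have cond: "is_cond_exp t (\<lambda>\<omega>. real_of_ereal (?XT \<omega>)) (stopped T x t)" for t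
    by (intro martingale_closed martingale_stopped uniformly_integrable_stopped stopping_time_measurable[OF T] x uix) auto
  show L: "?XT \<in> L1_space M H E"
    unfolding L1_space_iff using XT XTfin is_cond_exp_L1_real(1)[OF cond] by blast
  note Y = L1_expect_is_cond_exp[OF L]
  have "AE \<omega> in qs_measure. real_of_ereal (L1_expect M F H E t ?XT \<omega>) = stopped T x t \<omega>" for t
    by (rule is_cond_exp_unique[OF Y(3) cond])
  \<comment> \<open>All fixed times are handled outside one polar set, so the random time S can be
    inserted pointwise afterwards.\<close>
  with Y(2) have "AE \<omega> in qs_measure. \<forall>t. \<bar>L1_expect M F H E t ?XT \<omega>\<bar> \<noteq> \<infinity> \<and>
      real_of_ereal (L1_expect M F H E t ?XT \<omega>) = stopped T x t \<omega>"
    by (simp add: AE_all_countable)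
  moreover have "AE \<omega> in qs_measure. \<omega> \<in> space M" using AE_space[of qs_measure] by simp
  ultimately show "quasi_surely M E (\<lambda>\<omega>. process_at X Xinf S \<omega> = L1_expect_at M F H E S ?XT \<omega>)"
    unfolding quasi_surely_iff_AE using fin
  proof eventually_elim
    case (elim \<omega>)
    show ?case
    proof (cases "S \<omega>")
      case (enat t)
      then have "enat t \<le> T \<omega>" using ST[OF elim(2)] by simp
      then have "real_of_ereal (L1_expect M F H E t ?XT \<omega>) = x t \<omega>"
        using elim(1) by (simp add: stopped_ge)
      \<comment> \<open>Finiteness is essential here: \<open>real_of_ereal\<close> sends infinite
        values to 0, so equality of real parts alone would not determine the value.\<close>
      moreover have "L1_expect M F H E t ?XT \<omega> = ereal (real_of_ereal (L1_expect M F H E t ?XT \<omega>))"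
        by (rule ereal_real'[OF conjunct1[OF elim(1)[THEN spec, of t]], symmetric])
      ultimately show ?thesis
        using elim(3) enat by (simp add: process_at_def L1_expect_at_def)
    next
      \<comment> \<open>S = \<infinity> forces T = \<infinity>, and both sides become
        \<open>Xinf\<close>.\<close>
      case infinity
      then have "T \<omega> = \<infinity>" using ST[OF elim(2)] by simp
      with infinity show ?thesis by (simp add: process_at_def L1_expect_at_def)
    qed
  qed
qed

end

theorem theorem4p6:
  fixes M :: "'a measure" and F :: "nat \<Rightarrow> 'a measure" and H :: "('a \<Rightarrow> real) set"
    and E :: "nat \<Rightarrow> ('a \<Rightarrow> real) \<Rightarrow> 'a \<Rightarrow> real"
    and X :: "nat \<Rightarrow> 'a \<Rightarrow> ereal" and S T :: "'a \<Rightarrow> enat"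
  assumes "SL_expectation M F H E"
    and "stopping_time (F_enat M F) S" and "stopping_time (F_enat M F) T"
    and "\<And>\<omega>. \<omega> \<in> space M \<Longrightarrow> S \<omega> \<le> T \<omega>"
    and "SL_martingale M F H E X"
    and "SL_uniformly_integrable M F H E (range X)"
  shows "(\<exists>Xinf. qs_limit M E X Xinf) \<and>
    (\<forall>Xinf. qs_limit M E X Xinf \<longrightarrow>
      process_at X Xinf T \<in> L1_space M H E \<and>
      quasi_surely M E
        (\<lambda>\<omega>. process_at X Xinf S \<omega> = L1_expect_at M F H E S (process_at X Xinf T) \<omega>))"
  using SL_expectation.optional_stopping[OF assms(1,3-6)] by blast

end
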